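(* Let $R$ be a finitely generated residually finite ring such that all finitely presented right $R$-modules are residually finite. The following are equivalent: (1) the profinite completion $\widehat{R}$ of $R$ is a flat left $R$-module; (2) $R$ is right coherent.
   Context: Rings are unital, not necessarily commutative; $R$ is finitely generated as a ring. A ring $R$ is right coherent if every finitely generated submodule of a free right $R$-module is finitely presented. A right $R$-module $M$ is residually finite if the intersection of all its submodules of finite index (as additive subgroups) is $0$; $R$ is residually finite if the intersection of its two-sided ideals of finite index is $0$ (equivalently, it is residually finite as a right $R$-module). The profinite completion of $R$ is $\widehat{R}=\varprojlim R/I$, where $I$ ranges over the two-sided ideals of finite index in $R$; it is an $R$-bimodule. *)

theory Defs
  imports
    "HOL-Algebra.Module"
    "HOL-Algebra.QuotRing"
    "HOL-Algebra.Generated_Rings"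
    "HOL-Algebra.Generated_Groups"
    "HOL-Algebra.Free_Abelian_Groups"
begin

section \<open>Left and right modules over a noncommutative ring\<close>

text \<open>
  HOL-Algebra's locale \<open>module\<close> requires a commutative ring, so only its record type and its
  notion of \<open>submodule\<close> (which makes no assumption on the ring) are reused here.  For a right
  module, \<open>a \<odot>\<^bsub>M\<^esub> x\<close> stands for the right action of \<open>a\<close> on \<open>x\<close>, that is for \<open>x a\<close>; left and
  right modules differ only in the order of multiplication in the associativity law.  The
  multiplicative components of a module record play no role.
\<close>

locale left_module = R?: ring R + M?: abelian_group M
  for R :: "('a, 'r) ring_scheme" (structure) and M :: "('a, 'm, 'c) module_scheme" (structure) +
  assumes smult_closed:
      "\<lbrakk>a \<in> carrier R; x \<in> carrier M\<rbrakk> \<Longrightarrow> a \<odot>\<^bsub>M\<^esub> x \<in> carrier M"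
    and smult_l_distr:
      "\<lbrakk>a \<in> carrier R; b \<in> carrier R; x \<in> carrier M\<rbrakk> \<Longrightarrow>
        (a \<oplus>\<^bsub>R\<^esub> b) \<odot>\<^bsub>M\<^esub> x = a \<odot>\<^bsub>M\<^esub> x \<oplus>\<^bsub>M\<^esub> b \<odot>\<^bsub>M\<^esub> x"
    and smult_r_distr:
      "\<lbrakk>a \<in> carrier R; x \<in> carrier M; y \<in> carrier M\<rbrakk> \<Longrightarrow>
        a \<odot>\<^bsub>M\<^esub> (x \<oplus>\<^bsub>M\<^esub> y) = a \<odot>\<^bsub>M\<^esub> x \<oplus>\<^bsub>M\<^esub> a \<odot>\<^bsub>M\<^esub> y"
    and smult_assoc:
      "\<lbrakk>a \<in> carrier R; b \<in> carrier R; x \<in> carrier M\<rbrakk> \<Longrightarrow>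
        (a \<otimes>\<^bsub>R\<^esub> b) \<odot>\<^bsub>M\<^esub> x = a \<odot>\<^bsub>M\<^esub> (b \<odot>\<^bsub>M\<^esub> x)"
    and smult_one:
      "x \<in> carrier M \<Longrightarrow> \<one>\<^bsub>R\<^esub> \<odot>\<^bsub>M\<^esub> x = x"

locale right_module = R?: ring R + M?: abelian_group M
  for R :: "('a, 'r) ring_scheme" (structure) and M :: "('a, 'm, 'c) module_scheme" (structure) +
  assumes smult_closed:
      "\<lbrakk>a \<in> carrier R; x \<in> carrier M\<rbrakk> \<Longrightarrow> a \<odot>\<^bsub>M\<^esub> x \<in> carrier M"
    and smult_l_distr:
      "\<lbrakk>a \<in> carrier R; b \<in> carrier R; x \<in> carrier M\<rbrakk> \<Longrightarrow>
        (a \<oplus>\<^bsub>R\<^esub> b) \<odot>\<^bsub>M\<^esub> x = a \<odot>\<^bsub>M\<^esub> x \<oplus>\<^bsub>M\<^esub> b \<odot>\<^bsub>M\<^esub> x"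
    and smult_r_distr:
      "\<lbrakk>a \<in> carrier R; x \<in> carrier M; y \<in> carrier M\<rbrakk> \<Longrightarrow>
        a \<odot>\<^bsub>M\<^esub> (x \<oplus>\<^bsub>M\<^esub> y) = a \<odot>\<^bsub>M\<^esub> x \<oplus>\<^bsub>M\<^esub> a \<odot>\<^bsub>M\<^esub> y"
    and smult_assoc:
      "\<lbrakk>a \<in> carrier R; b \<in> carrier R; x \<in> carrier M\<rbrakk> \<Longrightarrow>
        (a \<otimes>\<^bsub>R\<^esub> b) \<odot>\<^bsub>M\<^esub> x = b \<odot>\<^bsub>M\<^esub> (a \<odot>\<^bsub>M\<^esub> x)"
    and smult_one:
      "x \<in> carrier M \<Longrightarrow> \<one>\<^bsub>R\<^esub> \<odot>\<^bsub>M\<^esub> x = x"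

definition rmodule_hom ::
    "('a, 'r) ring_scheme \<Rightarrow> ('a, 'm) module \<Rightarrow> ('a, 'n) module \<Rightarrow> ('m \<Rightarrow> 'n) set" where
  "rmodule_hom R M N =
    {\<phi> \<in> hom (add_monoid M) (add_monoid N).
       \<forall>a\<in>carrier R. \<forall>x\<in>carrier M. \<phi> (a \<odot>\<^bsub>M\<^esub> x) = a \<odot>\<^bsub>N\<^esub> \<phi> x}"

definition finitely_generated_module ::
    "('a, 'r) ring_scheme \<Rightarrow> ('a, 'm) module \<Rightarrow> bool" where
  "finitely_generated_module R M \<longleftrightarrow>
    (\<exists>S. finite S \<and> S \<subseteq> carrier M \<and> \<Inter>{N. submodule N R M \<and> S \<subseteq> N} = carrier M)"

text \<open>The free right module \<open>R\<^sup>(\<^sup>X\<^sup>)\<close> of finitely supported families; the action is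
  multiplication from the right.\<close>

definition free_right_module ::
    "('a, 'r) ring_scheme \<Rightarrow> 'i set \<Rightarrow> ('a, 'i \<Rightarrow> 'a) module" where
  "free_right_module R X =
    \<lparr>carrier = {f \<in> (\<Pi>\<^sub>E i\<in>X. carrier R). finite {i \<in> X. f i \<noteq> \<zero>\<^bsub>R\<^esub>}},
     monoid.mult = undefined, one = undefined,
     ring.zero = (\<lambda>i\<in>X. \<zero>\<^bsub>R\<^esub>),
     ring.add = (\<lambda>f g. \<lambda>i\<in>X. f i \<oplus>\<^bsub>R\<^esub> g i),
     module.smult = (\<lambda>a f. \<lambda>i\<in>X. f i \<otimes>\<^bsub>R\<^esub> a)\<rparr>"

text \<open>\<open>M\<close> is free if it has a basis \<open>B\<close>, i.e. the map \<open>R\<^sup>(\<^sup>B\<^sup>) \<rightarrow> M\<close> sending \<open>f\<close> to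
  \<open>\<Sum>\<^sub>b b (f b)\<close> is bijective.\<close>

definition is_free_right_module ::
    "('a, 'r) ring_scheme \<Rightarrow> ('a, 'm) module \<Rightarrow> bool" where
  "is_free_right_module R M \<longleftrightarrow> right_module R M \<and>
    (\<exists>B \<subseteq> carrier M.
       bij_betw (\<lambda>f. \<Oplus>\<^bsub>M\<^esub>b \<in> {b \<in> B. f b \<noteq> \<zero>\<^bsub>R\<^esub>}. f b \<odot>\<^bsub>M\<^esub> b)
         (carrier (free_right_module R B)) (carrier M))"

text \<open>There is an exact sequence \<open>0 \<rightarrow> K \<rightarrow> R\<^sup>n \<rightarrow> M \<rightarrow> 0\<close> with \<open>K\<close> finitely generated.\<close>

definition finitely_presented_right_module ::
    "('a, 'r) ring_scheme \<Rightarrow> ('a, 'm) module \<Rightarrow> bool" where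
  "finitely_presented_right_module R M \<longleftrightarrow> right_module R M \<and>
    (\<exists>(n::nat) \<phi>. let F = free_right_module R {..<n} in
       \<phi> \<in> rmodule_hom R F M \<and> \<phi> ` carrier F = carrier M \<and>
       finitely_generated_module R (F\<lparr>carrier := a_kernel F M \<phi>\<rparr>))"

text \<open>
  HOL cannot quantify over all types inside a definition, so notions that quantify over all
  modules take a universe type \<open>'u\<close>, and the modules range over those whose carrier is a set of
  elements of \<open>'u\<close>.  Over a countable ring, such as a finitely generated one, every countable module
  has a copy in any infinite \<open>'u\<close>; a theorem stated for a type variable \<open>'u\<close> covers modules of every
  size.
\<close>

definition right_coherent :: "('a, 'r) ring_scheme \<Rightarrow> 'u itself \<Rightarrow> bool" where
  "right_coherent R (_ :: 'u itself) \<longleftrightarrow>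
    (\<forall>(F :: ('a, 'u) module) N.
       is_free_right_module R F \<and> submodule N R F \<and>
       finitely_generated_module R (F\<lparr>carrier := N\<rparr>) \<longrightarrow>
       finitely_presented_right_module R (F\<lparr>carrier := N\<rparr>))"


section \<open>Finite generation and residual finiteness\<close>

definition finitely_generated_ring :: "('a, 'r) ring_scheme \<Rightarrow> bool" where
  "finitely_generated_ring R \<longleftrightarrow>
    (\<exists>S. finite S \<and> S \<subseteq> carrier R \<and> generate_ring R S = carrier R)"

definition residually_finite_module ::
    "('a, 'r) ring_scheme \<Rightarrow> ('a, 'm) module \<Rightarrow> bool" where
  "residually_finite_module R M \<longleftrightarrow>
    \<Inter>{N. submodule N R M \<and> finite (a_rcosets\<^bsub>M\<^esub> N)} = {\<zero>\<^bsub>M\<^esub>}"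

definition finite_index_ideals :: "('a, 'r) ring_scheme \<Rightarrow> 'a set set" where
  "finite_index_ideals R = {I. ideal I R \<and> finite (a_rcosets\<^bsub>R\<^esub> I)}"

definition residually_finite_ring :: "('a, 'r) ring_scheme \<Rightarrow> bool" where
  "residually_finite_ring R \<longleftrightarrow> \<Inter>(finite_index_ideals R) = {\<zero>\<^bsub>R\<^esub>}"


section \<open>The profinite completion\<close>

text \<open>
  The inverse limit is realised as the set of compatible families in the product of the \<open>R Quot I\<close>.
  For \<open>I \<subseteq> J\<close> the transition map \<open>R Quot I \<rightarrow> R Quot J\<close> sends a coset \<open>C\<close> of \<open>I\<close> to the coset
  \<open>C <+>\<^bsub>R\<^esub> J\<close> of \<open>J\<close> containing it.  The ring structure is componentwise, and \<open>smult\<close> is the left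
  action of \<open>R\<close>, through the canonical maps \<open>a \<mapsto> I +>\<^bsub>R\<^esub> a\<close>.
\<close>

definition profinite_completion ::
    "('a, 'r) ring_scheme \<Rightarrow> ('a, 'a set \<Rightarrow> 'a set) module" where
  "profinite_completion R =
    \<lparr>carrier = {x \<in> (\<Pi>\<^sub>E I\<in>finite_index_ideals R. carrier (R Quot I)).
        \<forall>I\<in>finite_index_ideals R. \<forall>J\<in>finite_index_ideals R. I \<subseteq> J \<longrightarrow> x I <+>\<^bsub>R\<^esub> J = x J},
     monoid.mult = (\<lambda>x y. \<lambda>I\<in>finite_index_ideals R. x I \<otimes>\<^bsub>R Quot I\<^esub> y I),
     one = (\<lambda>I\<in>finite_index_ideals R. \<one>\<^bsub>R Quot I\<^esub>),
     ring.zero = (\<lambda>I\<in>finite_index_ideals R. \<zero>\<^bsub>R Quot I\<^esub>),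
     ring.add = (\<lambda>x y. \<lambda>I\<in>finite_index_ideals R. x I \<oplus>\<^bsub>R Quot I\<^esub> y I),
     module.smult = (\<lambda>a x. \<lambda>I\<in>finite_index_ideals R. (I +>\<^bsub>R\<^esub> a) \<otimes>\<^bsub>R Quot I\<^esub> x I)\<rparr>"


section \<open>Tensor products and flatness\<close>

text \<open>
  For a right module \<open>A\<close> and a left module \<open>L\<close>, the abelian group \<open>A \<otimes>\<^sub>R L\<close> (written
  multiplicatively, as everywhere in HOL-Algebra) is the quotient of the free abelian group on
  \<open>A \<times> L\<close> by biadditivity and the relations \<open>(x a, l) = (x, a l)\<close>.
\<close>

definition tensor_relations ::
    "('a, 'r) ring_scheme \<Rightarrow> ('a, 'm) module \<Rightarrow> ('a, 'n) module \<Rightarrow> ('m \<times> 'n \<Rightarrow>\<^sub>0 int) set" where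
  "tensor_relations R A L =
     {frag_of (x \<oplus>\<^bsub>A\<^esub> y, l) - frag_of (x, l) - frag_of (y, l) | x y l.
        x \<in> carrier A \<and> y \<in> carrier A \<and> l \<in> carrier L} \<union>
     {frag_of (x, l \<oplus>\<^bsub>L\<^esub> k) - frag_of (x, l) - frag_of (x, k) | x l k.
        x \<in> carrier A \<and> l \<in> carrier L \<and> k \<in> carrier L} \<union>
     {frag_of (a \<odot>\<^bsub>A\<^esub> x, l) - frag_of (x, a \<odot>\<^bsub>L\<^esub> l) | a x l.
        a \<in> carrier R \<and> x \<in> carrier A \<and> l \<in> carrier L}"

definition tensor_kernel ::
    "('a, 'r) ring_scheme \<Rightarrow> ('a, 'm) module \<Rightarrow> ('a, 'n) module \<Rightarrow> ('m \<times> 'n \<Rightarrow>\<^sub>0 int) set" where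
  "tensor_kernel R A L =
     generate (free_Abelian_group (carrier A \<times> carrier L)) (tensor_relations R A L)"

definition tensor_product ::
    "('a, 'r) ring_scheme \<Rightarrow> ('a, 'm) module \<Rightarrow> ('a, 'n) module \<Rightarrow>
     ('m \<times> 'n \<Rightarrow>\<^sub>0 int) set monoid" where
  "tensor_product R A L = free_Abelian_group (carrier A \<times> carrier L) Mod tensor_kernel R A L"

text \<open>The map \<open>\<phi> \<otimes> id : A \<otimes>\<^sub>R L \<rightarrow> B \<otimes>\<^sub>R L\<close>, computed on representatives.\<close>

definition tensor_map ::
    "('a, 'r) ring_scheme \<Rightarrow> ('a, 'm) module \<Rightarrow> ('a, 'n) module \<Rightarrow> ('k \<Rightarrow> 'm) \<Rightarrow>
     ('k \<times> 'n \<Rightarrow>\<^sub>0 int) set \<Rightarrow> ('m \<times> 'n \<Rightarrow>\<^sub>0 int) set" where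
  "tensor_map R B L \<phi> X =
     the_elem ((\<lambda>c. tensor_kernel R B L #>\<^bsub>free_Abelian_group (carrier B \<times> carrier L)\<^esub>
                     frag_extend (\<lambda>(x, l). frag_of (\<phi> x, l)) c) ` X)"

definition flat_left_module ::
    "('a, 'r) ring_scheme \<Rightarrow> ('a, 'n) module \<Rightarrow> 'u itself \<Rightarrow> bool" where
  "flat_left_module R L (_ :: 'u itself) \<longleftrightarrow> left_module R L \<and>
    (\<forall>(A :: ('a, 'u) module) (B :: ('a, 'u) module) \<phi>.
       right_module R A \<and> right_module R B \<and> \<phi> \<in> rmodule_hom R A B \<and> inj_on \<phi> (carrier A) \<longrightarrow>
       inj_on (tensor_map R B L \<phi>) (carrier (tensor_product R A L)))"

end

theory Submission
  imports Defs
begin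

text \<open>
  Write \<open>L\<close> for the profinite completion of \<open>R\<close>.  Both implications go through the equational
  criterion: \<open>L\<close> is flat iff every solution \<open>y \<in> L\<^sup>n\<close> of a finite homogeneous linear system over \<open>R\<close>
  is a combination, with coefficients in \<open>L\<close>, of solutions in \<open>R\<^sup>n\<close>.  If \<open>K \<subseteq> R\<^sup>n\<close> is the module of
  solutions over \<open>R\<close>, then \<open>K L \<subseteq> L\<^sup>n\<close> denotes the set of these combinations.

  The hypothesis on finitely presented modules enters in one form only: a finitely generated
  submodule of \<open>R\<^sup>n\<close> is closed in the profinite topology (\<open>fg_submodule_closed\<close>).  An ideal \<open>I\<close> of finite
  index in a finitely generated ring is finitely generated as a right ideal, by a version of
  Schreier's lemma (\<open>finite_index_ideal_fg\<close>).  Hence for a matrix \<open>g : R\<^sup>p \<rightarrow> R\<^sup>k\<close> the module \<open>g(I\<^sup>p)\<close> is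
  closed, and it has finite index in \<open>g(R\<^sup>p)\<close>; so \<open>g(R\<^sup>p) \<inter> J\<^sup>k \<subseteq> g(I\<^sup>p)\<close> for some \<open>J\<close> of finite index
  (\<open>artin_rees\<close>).  Schreier's lemma also shows that there are only countably many ideals of finite
  index, so that \<open>L\<close> is a limit along a descending chain.

  \<^emph>\<open>Coherence implies flatness.\<close>  Let \<open>r y = 0\<close> with \<open>y \<in> L\<^sup>n\<close>.  By coherence the kernel \<open>K\<close> of \<open>r\<close> on
  \<open>R\<^sup>n\<close> is the image of some \<open>g : R\<^sup>p \<rightarrow> R\<^sup>n\<close>.  The inclusion above, applied to \<open>r\<close>, shows that \<open>y\<close> is a limit
  of elements of \<open>K\<close>; applied to \<open>g\<close>, it lets one choose preimages of these elements in \<open>R\<^sup>p\<close> that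
  converge, whence \<open>y \<in> g(L\<^sup>p) = K L\<close> (\<open>profinite_kernel\<close>).

  \<^emph>\<open>Flatness implies coherence.\<close>  Let \<open>K\<close> be the kernel of a surjection \<open>R\<^sup>n \<rightarrow> N\<close> onto a submodule of a
  free module.  If \<open>y \<in> L\<^sup>n\<close> is a limit of elements of \<open>K\<close>, then \<open>\<Sum> s\<^sub>i \<otimes> y\<^sub>i\<close>, where \<open>s\<^sub>i\<close> are the generators
  of \<open>N\<close>, vanishes over the free module, hence over \<open>N\<close> by flatness, and therefore \<open>y \<in> K L\<close>
  (\<open>flat_generators\<close>).  If \<open>K\<close> were not finitely generated, it would be the union of an increasing
  sequence of finitely generated, hence closed, proper submodules \<open>S\<^sub>j\<close>; as in the proof of Baire's
  theorem one builds a limit \<open>y\<close> of elements of \<open>K\<close> that is kept away from every \<open>S\<^sub>j\<close>.  But \<open>K L\<close> is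
  the union of the \<open>S\<^sub>j L\<close>, so \<open>y\<close> would belong to some \<open>S\<^sub>j L\<close>, a contradiction
  (\<open>fg_if_closure_generated\<close>).

  The link with the tensor product as constructed from generators and relations is
  \<open>tensor_kernel_iff\<close>: presenting \<open>A\<close> by all its elements identifies \<open>A \<otimes> L\<close> with \<open>L\<^sup>(\<^sup>A\<^sup>)\<close> modulo the
  combinations of relations of \<open>A\<close>.
\<close>

section \<open>Linear combinations\<close>

lemma (in abelian_monoid) finsum_swap:
  assumes "finite A" "finite B" "\<And>i j. i \<in> A \<Longrightarrow> j \<in> B \<Longrightarrow> f i j \<in> carrier G"
  shows "(\<Oplus>i\<in>A. \<Oplus>j\<in>B. f i j) = (\<Oplus>j\<in>B. \<Oplus>i\<in>A. f i j)"
  using assms(1,3)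
proof (induction A rule: finite_induct)
  case empty
  show ?case by (simp add: finsum_zero)
next
  case (insert x A)
  have "(\<Oplus>i\<in>insert x A. \<Oplus>j\<in>B. f i j) = (\<Oplus>j\<in>B. f x j) \<oplus> (\<Oplus>i\<in>A. \<Oplus>j\<in>B. f i j)"
    using insert by (subst finsum_insert) (auto intro!: finsum_closed)
  also have "\<dots> = (\<Oplus>j\<in>B. f x j) \<oplus> (\<Oplus>j\<in>B. \<Oplus>i\<in>A. f i j)"
    using insert by simp
  also have "\<dots> = (\<Oplus>j\<in>B. f x j \<oplus> (\<Oplus>i\<in>A. f i j))"
    using insert by (intro finsum_addf[symmetric]) (auto intro!: finsum_closed)
  also have "\<dots> = (\<Oplus>j\<in>B. \<Oplus>i\<in>insert x A. f i j)"
    using insert by (intro finsum_cong') (auto intro!: finsum_closed)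
  finally show ?case .
qed

lemma hom_finsum:
  assumes "abelian_group M" "abelian_group N" "h \<in> hom (add_monoid M) (add_monoid N)"
    and "finite X" "\<And>i. i \<in> X \<Longrightarrow> f i \<in> carrier M"
  shows "h (\<Oplus>\<^bsub>M\<^esub>i\<in>X. f i) = (\<Oplus>\<^bsub>N\<^esub>i\<in>X. h (f i))"
proof -
  interpret M: abelian_group M by fact
  interpret N: abelian_group N by fact
  interpret H: abelian_group_hom M N h
    by (rule abelian_group_homI) (use assms in \<open>auto intro!: group_hom.intro group_hom_axioms.intro M.a_group N.a_group\<close>)
  show ?thesis using assms(4,5)
  proof (induction X rule: finite_induct)
    case empty show ?case by simp
  next
    case (insert x X)
    have "h (\<Oplus>\<^bsub>M\<^esub>i\<in>insert x X. f i) = h (f x \<oplus>\<^bsub>M\<^esub> (\<Oplus>\<^bsub>M\<^esub>i\<in>X. f i))"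
      using insert by (subst M.finsum_insert) auto
    also have "\<dots> = h (f x) \<oplus>\<^bsub>N\<^esub> h (\<Oplus>\<^bsub>M\<^esub>i\<in>X. f i)"
      using insert by (intro H.hom_add) (auto intro!: M.finsum_closed)
    also have "\<dots> = (\<Oplus>\<^bsub>N\<^esub>i\<in>insert x X. h (f i))"
      using insert by (subst N.finsum_insert) auto
    finally show ?case .
  qed
qed

text \<open>
  Left and right modules differ only in the associativity law; whatever follows from additivity in
  both arguments is proved once, here.
\<close>

locale biadditive_action = R?: ring R + M?: abelian_group M
  for R :: "('a, 'r) ring_scheme" (structure) and M :: "('a, 'm, 'c) module_scheme" (structure) +
  assumes smult_closed [simp, intro]:
      "\<lbrakk>a \<in> carrier R; x \<in> carrier M\<rbrakk> \<Longrightarrow> a \<odot>\<^bsub>M\<^esub> x \<in> carrier M"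
    and smult_l_distr:
      "\<lbrakk>a \<in> carrier R; b \<in> carrier R; x \<in> carrier M\<rbrakk> \<Longrightarrow>
        (a \<oplus>\<^bsub>R\<^esub> b) \<odot>\<^bsub>M\<^esub> x = a \<odot>\<^bsub>M\<^esub> x \<oplus>\<^bsub>M\<^esub> b \<odot>\<^bsub>M\<^esub> x"
    and smult_r_distr:
      "\<lbrakk>a \<in> carrier R; x \<in> carrier M; y \<in> carrier M\<rbrakk> \<Longrightarrow>
        a \<odot>\<^bsub>M\<^esub> (x \<oplus>\<^bsub>M\<^esub> y) = a \<odot>\<^bsub>M\<^esub> x \<oplus>\<^bsub>M\<^esub> a \<odot>\<^bsub>M\<^esub> y"
begin

lemma smult_hom_r: "a \<in> carrier R \<Longrightarrow> (\<lambda>x. a \<odot>\<^bsub>M\<^esub> x) \<in> hom (add_monoid M) (add_monoid M)"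
  by (auto simp: hom_def smult_r_distr)

lemma smult_hom_l: "x \<in> carrier M \<Longrightarrow> (\<lambda>a. a \<odot>\<^bsub>M\<^esub> x) \<in> hom (add_monoid R) (add_monoid M)"
  by (auto simp: hom_def smult_l_distr)

lemma smult_finsum_r:
  assumes "finite X" "a \<in> carrier R" "\<And>i. i \<in> X \<Longrightarrow> f i \<in> carrier M"
  shows "a \<odot>\<^bsub>M\<^esub> (\<Oplus>\<^bsub>M\<^esub>i\<in>X. f i) = (\<Oplus>\<^bsub>M\<^esub>i\<in>X. a \<odot>\<^bsub>M\<^esub> f i)"
  by (rule hom_finsum[OF _ _ smult_hom_r]) (use assms in \<open>auto intro: M.abelian_group_axioms\<close>)

lemma smult_finsum_l:
  assumes "finite X" "x \<in> carrier M" "\<And>i. i \<in> X \<Longrightarrow> f i \<in> carrier R"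
  shows "(\<Oplus>\<^bsub>R\<^esub>i\<in>X. f i) \<odot>\<^bsub>M\<^esub> x = (\<Oplus>\<^bsub>M\<^esub>i\<in>X. f i \<odot>\<^bsub>M\<^esub> x)"
  by (rule hom_finsum[OF _ _ smult_hom_l]) (use assms in \<open>auto intro: M.abelian_group_axioms R.abelian_group_axioms\<close>)

lemma smult_zero_r [simp]: "a \<in> carrier R \<Longrightarrow> a \<odot>\<^bsub>M\<^esub> \<zero>\<^bsub>M\<^esub> = \<zero>\<^bsub>M\<^esub>"
  using smult_finsum_r[of "{}" a] by simp

lemma smult_zero_l [simp]: "x \<in> carrier M \<Longrightarrow> \<zero>\<^bsub>R\<^esub> \<odot>\<^bsub>M\<^esub> x = \<zero>\<^bsub>M\<^esub>"
  using smult_finsum_l[of "{}" x] by simp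

lemma smult_minus_l:
  assumes "a \<in> carrier R" "x \<in> carrier M" shows "(\<ominus>\<^bsub>R\<^esub> a) \<odot>\<^bsub>M\<^esub> x = \<ominus>\<^bsub>M\<^esub> (a \<odot>\<^bsub>M\<^esub> x)"
proof -
  have "(\<ominus>\<^bsub>R\<^esub> a) \<odot>\<^bsub>M\<^esub> x \<oplus>\<^bsub>M\<^esub> a \<odot>\<^bsub>M\<^esub> x = (\<ominus>\<^bsub>R\<^esub> a \<oplus>\<^bsub>R\<^esub> a) \<odot>\<^bsub>M\<^esub> x"
    using assms by (simp add: smult_l_distr)
  also have "\<dots> = \<zero>\<^bsub>M\<^esub>" using assms by (simp add: R.l_neg)
  finally show ?thesis using assms M.minus_equality by simp
qed

lemma smult_minus_r:
  assumes "a \<in> carrier R" "x \<in> carrier M" shows "a \<odot>\<^bsub>M\<^esub> (\<ominus>\<^bsub>M\<^esub> x) = \<ominus>\<^bsub>M\<^esub> (a \<odot>\<^bsub>M\<^esub> x)"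
proof -
  have "a \<odot>\<^bsub>M\<^esub> (\<ominus>\<^bsub>M\<^esub> x) \<oplus>\<^bsub>M\<^esub> a \<odot>\<^bsub>M\<^esub> x = a \<odot>\<^bsub>M\<^esub> (\<ominus>\<^bsub>M\<^esub> x \<oplus>\<^bsub>M\<^esub> x)"
    using assms by (simp add: smult_r_distr)
  also have "\<dots> = \<zero>\<^bsub>M\<^esub>" using assms by (simp add: M.l_neg)
  finally show ?thesis using assms M.minus_equality by simp
qed

lemma lincomb_add_l:
  assumes "\<And>i. i \<in> X \<Longrightarrow> a i \<in> carrier R" "\<And>i. i \<in> X \<Longrightarrow> b i \<in> carrier R" "\<And>i. i \<in> X \<Longrightarrow> s i \<in> carrier M"
  shows "(\<Oplus>\<^bsub>M\<^esub>i\<in>X. (a i \<oplus>\<^bsub>R\<^esub> b i) \<odot>\<^bsub>M\<^esub> s i) = (\<Oplus>\<^bsub>M\<^esub>i\<in>X. a i \<odot>\<^bsub>M\<^esub> s i) \<oplus>\<^bsub>M\<^esub> (\<Oplus>\<^bsub>M\<^esub>i\<in>X. b i \<odot>\<^bsub>M\<^esub> s i)"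
proof -
  have "(\<Oplus>\<^bsub>M\<^esub>i\<in>X. (a i \<oplus>\<^bsub>R\<^esub> b i) \<odot>\<^bsub>M\<^esub> s i) = (\<Oplus>\<^bsub>M\<^esub>i\<in>X. a i \<odot>\<^bsub>M\<^esub> s i \<oplus>\<^bsub>M\<^esub> b i \<odot>\<^bsub>M\<^esub> s i)"
    by (rule M.finsum_cong') (use assms in \<open>auto simp: smult_l_distr\<close>)
  also have "\<dots> = (\<Oplus>\<^bsub>M\<^esub>i\<in>X. a i \<odot>\<^bsub>M\<^esub> s i) \<oplus>\<^bsub>M\<^esub> (\<Oplus>\<^bsub>M\<^esub>i\<in>X. b i \<odot>\<^bsub>M\<^esub> s i)"
    by (rule M.finsum_addf) (use assms in auto)
  finally show ?thesis .
qed

lemma lincomb_minus_l: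
  assumes "finite X" "\<And>i. i \<in> X \<Longrightarrow> a i \<in> carrier R" "\<And>i. i \<in> X \<Longrightarrow> s i \<in> carrier M"
  shows "(\<Oplus>\<^bsub>M\<^esub>i\<in>X. (\<ominus>\<^bsub>R\<^esub> a i) \<odot>\<^bsub>M\<^esub> s i) = \<ominus>\<^bsub>M\<^esub> (\<Oplus>\<^bsub>M\<^esub>i\<in>X. a i \<odot>\<^bsub>M\<^esub> s i)"
proof -
  have "(\<Oplus>\<^bsub>M\<^esub>i\<in>X. (\<ominus>\<^bsub>R\<^esub> a i) \<odot>\<^bsub>M\<^esub> s i) \<oplus>\<^bsub>M\<^esub> (\<Oplus>\<^bsub>M\<^esub>i\<in>X. a i \<odot>\<^bsub>M\<^esub> s i)
      = (\<Oplus>\<^bsub>M\<^esub>i\<in>X. ((\<ominus>\<^bsub>R\<^esub> a i) \<oplus>\<^bsub>R\<^esub> a i) \<odot>\<^bsub>M\<^esub> s i)"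
    using assms by (intro lincomb_add_l[symmetric]) auto
  also have "\<dots> = (\<Oplus>\<^bsub>M\<^esub>i\<in>X. \<zero>\<^bsub>M\<^esub>)"
    by (rule M.finsum_cong') (use assms in \<open>auto simp: R.l_neg\<close>)
  finally show ?thesis
    using assms by (intro M.minus_equality[symmetric]) (auto simp: M.finsum_zero intro!: M.finsum_closed)
qed

lemma lincomb_zero_l:
  assumes "\<And>i. i \<in> X \<Longrightarrow> a i = \<zero>\<^bsub>R\<^esub>" "\<And>i. i \<in> X \<Longrightarrow> s i \<in> carrier M"
  shows "(\<Oplus>\<^bsub>M\<^esub>i\<in>X. a i \<odot>\<^bsub>M\<^esub> s i) = \<zero>\<^bsub>M\<^esub>"
  by (rule M.add.finprod_one_eqI) (use assms in auto)

lemma lincomb_single: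
  assumes "finite X" "j \<in> X" "a j \<in> carrier R" "\<And>i. i \<in> X \<Longrightarrow> s i \<in> carrier M"
    "\<And>i. i \<in> X \<Longrightarrow> i \<noteq> j \<Longrightarrow> a i = \<zero>\<^bsub>R\<^esub>"
  shows "(\<Oplus>\<^bsub>M\<^esub>i\<in>X. a i \<odot>\<^bsub>M\<^esub> s i) = a j \<odot>\<^bsub>M\<^esub> s j"
proof -
  have "(\<Oplus>\<^bsub>M\<^esub>i\<in>X. a i \<odot>\<^bsub>M\<^esub> s i) = (\<Oplus>\<^bsub>M\<^esub>i\<in>X. if j = i then a i \<odot>\<^bsub>M\<^esub> s i else \<zero>\<^bsub>M\<^esub>)"
  proof (rule M.finsum_cong')
    fix i assume "i \<in> X"
    then show "a i \<odot>\<^bsub>M\<^esub> s i = (if j = i then a i \<odot>\<^bsub>M\<^esub> s i else \<zero>\<^bsub>M\<^esub>)"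
      using assms by (cases "i = j") auto
  qed (use assms in auto)
  also have "\<dots> = a j \<odot>\<^bsub>M\<^esub> s j"
  proof -
    have "(\<lambda>i. a i \<odot>\<^bsub>M\<^esub> s i) \<in> X \<rightarrow> carrier M"
    proof
      fix i assume "i \<in> X"
      then show "a i \<odot>\<^bsub>M\<^esub> s i \<in> carrier M" using assms by (cases "i = j") auto
    qed
    then show ?thesis using assms by (intro M.finsum_singleton) auto
  qed
  finally show ?thesis .
qed

end

sublocale left_module \<subseteq> action: biadditive_action R M
  by (unfold_locales) (auto intro: smult_closed smult_l_distr smult_r_distr)

sublocale right_module \<subseteq> action: biadditive_action R M
  by (unfold_locales) (auto intro: smult_closed smult_l_distr smult_r_distr)

section \<open>Submodules and finite generation\<close>

context right_module
begin

lemma lincomb_smult: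
  assumes "finite X" "r \<in> carrier R" "\<And>i. i \<in> X \<Longrightarrow> a i \<in> carrier R" "\<And>i. i \<in> X \<Longrightarrow> s i \<in> carrier M"
  shows "r \<odot>\<^bsub>M\<^esub> (\<Oplus>\<^bsub>M\<^esub>i\<in>X. a i \<odot>\<^bsub>M\<^esub> s i) = (\<Oplus>\<^bsub>M\<^esub>i\<in>X. (a i \<otimes>\<^bsub>R\<^esub> r) \<odot>\<^bsub>M\<^esub> s i)"
proof -
  have "r \<odot>\<^bsub>M\<^esub> (\<Oplus>\<^bsub>M\<^esub>i\<in>X. a i \<odot>\<^bsub>M\<^esub> s i) = (\<Oplus>\<^bsub>M\<^esub>i\<in>X. r \<odot>\<^bsub>M\<^esub> (a i \<odot>\<^bsub>M\<^esub> s i))"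
    using assms by (intro action.smult_finsum_r) auto
  also have "\<dots> = (\<Oplus>\<^bsub>M\<^esub>i\<in>X. (a i \<otimes>\<^bsub>R\<^esub> r) \<odot>\<^bsub>M\<^esub> s i)"
    by (rule M.finsum_cong') (use assms in \<open>auto simp: smult_assoc\<close>)
  finally show ?thesis .
qed

text \<open>
  Negation is the action of \<open>-1\<close>, so closure under it is automatic.
\<close>

lemma submodule_iff:
  "submodule N R M \<longleftrightarrow> N \<subseteq> carrier M \<and> \<zero>\<^bsub>M\<^esub> \<in> N \<and> (\<forall>x\<in>N. \<forall>y\<in>N. x \<oplus>\<^bsub>M\<^esub> y \<in> N) \<and>
    (\<forall>a\<in>carrier R. \<forall>x\<in>N. a \<odot>\<^bsub>M\<^esub> x \<in> N)" (is "_ \<longleftrightarrow> ?r")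
proof
  assume "submodule N R M"
  then interpret N: submodule N R M .
  show ?r using N.subset N.one_closed N.m_closed N.smult_closed by auto
next
  assume r: ?r
  have inv: "\<ominus>\<^bsub>M\<^esub> x \<in> N" if "x \<in> N" for x
  proof -
    have "\<ominus>\<^bsub>M\<^esub> x = (\<ominus>\<^bsub>R\<^esub> \<one>\<^bsub>R\<^esub>) \<odot>\<^bsub>M\<^esub> x"
      using that r action.smult_minus_l[of "\<one>\<^bsub>R\<^esub>" x] smult_one[of x] by auto
    then show ?thesis using that r by auto
  qed
  show "submodule N R M"
    by (intro submodule.intro subgroup.intro submodule_axioms.intro)
       (use r inv in \<open>auto simp: a_inv_def\<close>)
qed

lemma right_module_submodule:
  assumes "submodule N R M"
  shows "right_module R (M\<lparr>carrier := N\<rparr>)"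
proof -
  have s: "N \<subseteq> carrier M" "\<zero>\<^bsub>M\<^esub> \<in> N" "\<And>x y. x \<in> N \<Longrightarrow> y \<in> N \<Longrightarrow> x \<oplus>\<^bsub>M\<^esub> y \<in> N"
    "\<And>a x. a \<in> carrier R \<Longrightarrow> x \<in> N \<Longrightarrow> a \<odot>\<^bsub>M\<^esub> x \<in> N"
    using assms unfolding submodule_iff by auto
  have inv: "\<exists>y\<in>N. y \<oplus>\<^bsub>M\<^esub> x = \<zero>\<^bsub>M\<^esub>" if "x \<in> N" for x
  proof
    show "(\<ominus>\<^bsub>R\<^esub> \<one>\<^bsub>R\<^esub>) \<odot>\<^bsub>M\<^esub> x \<in> N" using that s by auto
    show "(\<ominus>\<^bsub>R\<^esub> \<one>\<^bsub>R\<^esub>) \<odot>\<^bsub>M\<^esub> x \<oplus>\<^bsub>M\<^esub> x = \<zero>\<^bsub>M\<^esub>"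
      using that s action.smult_minus_l[of "\<one>\<^bsub>R\<^esub>" x] smult_one[of x] by (auto simp: M.l_neg subset_iff)
  qed
  have ag: "abelian_group (M\<lparr>carrier := N\<rparr>)"
    by (rule abelian_groupI) (use s inv in \<open>auto simp: M.a_ac subset_iff\<close>)
  show ?thesis
    by (rule right_module.intro[OF R.ring_axioms ag], unfold_locales)
       (use s in \<open>auto simp: smult_l_distr smult_r_distr smult_assoc smult_one subset_iff\<close>)
qed

lemma submodule_minus:
  assumes "submodule N R M" "x \<in> N" shows "\<ominus>\<^bsub>M\<^esub> x \<in> N"
  using submodule.axioms(1)[OF assms(1)] assms(2) by (metis a_inv_def subgroup.m_inv_closed)

lemma submodule_diff:
  assumes "submodule N R M" "x \<in> N" "y \<in> N" shows "x \<ominus>\<^bsub>M\<^esub> y \<in> N"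
  using assms submodule_minus[OF assms(1,3)] unfolding submodule_iff by (auto simp: a_minus_def)

lemma submodule_finsum:
  assumes "submodule N R M" "finite X" "\<And>i. i \<in> X \<Longrightarrow> f i \<in> N"
  shows "(\<Oplus>\<^bsub>M\<^esub>i\<in>X. f i) \<in> N"
  using assms(2,3)
proof (induction X rule: finite_induct)
  case empty then show ?case using assms(1) by (simp add: submodule_iff)
next
  case (insert x X)
  have "(\<Oplus>\<^bsub>M\<^esub>i\<in>insert x X. f i) = f x \<oplus>\<^bsub>M\<^esub> (\<Oplus>\<^bsub>M\<^esub>i\<in>X. f i)"
    using insert assms(1) unfolding submodule_iff by (subst M.finsum_insert) auto
  then show ?case using insert assms(1) by (auto simp: submodule_iff)
qed

lemma submodule_lincomb:
  assumes "submodule N R M" "finite X" "\<And>i. i \<in> X \<Longrightarrow> a i \<in> carrier R" "\<And>i. i \<in> X \<Longrightarrow> s i \<in> N"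
  shows "(\<Oplus>\<^bsub>M\<^esub>i\<in>X. a i \<odot>\<^bsub>M\<^esub> s i) \<in> N"
  by (rule submodule_finsum) (use assms in \<open>auto simp: submodule_iff\<close>)

lemma submodule_restrict_iff:
  assumes "submodule N R M"
  shows "submodule H R (M\<lparr>carrier := N\<rparr>) \<longleftrightarrow> submodule H R M \<and> H \<subseteq> N"
proof -
  interpret N: right_module R "M\<lparr>carrier := N\<rparr>" by (rule right_module_submodule[OF assms])
  show ?thesis using assms unfolding submodule_iff N.submodule_iff by auto
qed

lemma submodule_Int:
  assumes "submodule N R M" "submodule H R M" shows "submodule (N \<inter> H) R M"
  using assms unfolding submodule_iff by auto

end

text \<open>
  Finite generation of \<open>N\<close> in terms of the submodules of the ambient module: it makes images, sums and
  preimages easy to handle, since no record has to be restricted to \<open>N\<close>.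
\<close>

definition fg_submodule :: "('a, 'r) ring_scheme \<Rightarrow> ('a, 'm) module \<Rightarrow> 'm set \<Rightarrow> bool" where
  "fg_submodule R M N \<longleftrightarrow> submodule N R M \<and>
    (\<exists>S. finite S \<and> S \<subseteq> N \<and> (\<forall>H. submodule H R M \<longrightarrow> S \<subseteq> H \<longrightarrow> N \<subseteq> H))"

lemma finitely_generated_module_iff:
  assumes "right_module R M" "submodule N R M"
  shows "finitely_generated_module R (M\<lparr>carrier := N\<rparr>) \<longleftrightarrow> fg_submodule R M N"
proof -
  interpret right_module R M by fact
  have "(\<Inter>{H. submodule H R (M\<lparr>carrier := N\<rparr>) \<and> S \<subseteq> H} = N) \<longleftrightarrow>
      (\<forall>H. submodule H R M \<longrightarrow> S \<subseteq> H \<longrightarrow> N \<subseteq> H)" if S: "S \<subseteq> N" for S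
  proof
    assume eq: "\<Inter>{H. submodule H R (M\<lparr>carrier := N\<rparr>) \<and> S \<subseteq> H} = N"
    show "\<forall>H. submodule H R M \<longrightarrow> S \<subseteq> H \<longrightarrow> N \<subseteq> H"
    proof (intro allI impI)
      fix H assume H: "submodule H R M" "S \<subseteq> H"
      have "submodule (H \<inter> N) R (M\<lparr>carrier := N\<rparr>)"
        using assms H submodule_Int submodule_restrict_iff by auto
      moreover have "S \<subseteq> H \<inter> N" using S H by simp
      ultimately have "\<Inter>{H. submodule H R (M\<lparr>carrier := N\<rparr>) \<and> S \<subseteq> H} \<subseteq> H \<inter> N"
        by (intro Inter_lower) simp
      then show "N \<subseteq> H" unfolding eq by simp
    qed
  next
    assume *: "\<forall>H. submodule H R M \<longrightarrow> S \<subseteq> H \<longrightarrow> N \<subseteq> H"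
    have "submodule N R (M\<lparr>carrier := N\<rparr>)" using assms submodule_restrict_iff by auto
    then have "\<Inter>{H. submodule H R (M\<lparr>carrier := N\<rparr>) \<and> S \<subseteq> H} \<subseteq> N"
      using S by (intro Inter_lower) simp
    moreover have "N \<subseteq> \<Inter>{H. submodule H R (M\<lparr>carrier := N\<rparr>) \<and> S \<subseteq> H}"
      by (rule Inter_greatest) (simp add: * submodule_restrict_iff[OF assms(2)])
    ultimately show "\<Inter>{H. submodule H R (M\<lparr>carrier := N\<rparr>) \<and> S \<subseteq> H} = N" by (rule antisym)
  qed
  then show ?thesis using assms(2) unfolding finitely_generated_module_def fg_submodule_def
    by (simp cong: conj_cong)
qed

context right_module
begin

lemma lincombs_submodule:
  assumes "finite X" "\<And>i. i \<in> X \<Longrightarrow> s i \<in> carrier M"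
  shows "submodule ((\<lambda>a. \<Oplus>\<^bsub>M\<^esub>i\<in>X. a i \<odot>\<^bsub>M\<^esub> s i) ` (X \<rightarrow>\<^sub>E carrier R)) R M" (is "submodule ?N R M")
  unfolding submodule_iff
proof (intro conjI ballI)
  show "?N \<subseteq> carrier M" using assms by (auto intro!: M.finsum_closed)
  have "\<zero>\<^bsub>M\<^esub> = (\<Oplus>\<^bsub>M\<^esub>i\<in>X. (\<lambda>i\<in>X. \<zero>\<^bsub>R\<^esub>) i \<odot>\<^bsub>M\<^esub> s i)"
    using assms by (intro action.lincomb_zero_l[symmetric]) auto
  then show "\<zero>\<^bsub>M\<^esub> \<in> ?N" by (rule image_eqI[where x = "\<lambda>i\<in>X. \<zero>\<^bsub>R\<^esub>"]) auto
next
  fix x y assume "x \<in> ?N" "y \<in> ?N"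
  then obtain a b where a: "a \<in> X \<rightarrow>\<^sub>E carrier R" and b: "b \<in> X \<rightarrow>\<^sub>E carrier R"
    and x: "x = (\<Oplus>\<^bsub>M\<^esub>i\<in>X. a i \<odot>\<^bsub>M\<^esub> s i)" and y: "y = (\<Oplus>\<^bsub>M\<^esub>i\<in>X. b i \<odot>\<^bsub>M\<^esub> s i)" by auto
  have "x \<oplus>\<^bsub>M\<^esub> y = (\<Oplus>\<^bsub>M\<^esub>i\<in>X. (a i \<oplus>\<^bsub>R\<^esub> b i) \<odot>\<^bsub>M\<^esub> s i)"
    unfolding x y using a b assms by (intro action.lincomb_add_l[symmetric]) auto
  also have "\<dots> = (\<Oplus>\<^bsub>M\<^esub>i\<in>X. (\<lambda>i\<in>X. a i \<oplus>\<^bsub>R\<^esub> b i) i \<odot>\<^bsub>M\<^esub> s i)"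
    using a b assms by (intro M.finsum_cong') (auto simp: PiE_iff)
  finally show "x \<oplus>\<^bsub>M\<^esub> y \<in> ?N" by (rule image_eqI[where x = "\<lambda>i\<in>X. a i \<oplus>\<^bsub>R\<^esub> b i"]) (use a b in auto)
next
  fix r x assume r: "r \<in> carrier R" and "x \<in> ?N"
  then obtain a where a: "a \<in> X \<rightarrow>\<^sub>E carrier R" and x: "x = (\<Oplus>\<^bsub>M\<^esub>i\<in>X. a i \<odot>\<^bsub>M\<^esub> s i)" by auto
  have "r \<odot>\<^bsub>M\<^esub> x = (\<Oplus>\<^bsub>M\<^esub>i\<in>X. (a i \<otimes>\<^bsub>R\<^esub> r) \<odot>\<^bsub>M\<^esub> s i)"
    unfolding x using a r assms by (intro lincomb_smult) auto
  also have "\<dots> = (\<Oplus>\<^bsub>M\<^esub>i\<in>X. (\<lambda>i\<in>X. a i \<otimes>\<^bsub>R\<^esub> r) i \<odot>\<^bsub>M\<^esub> s i)"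
    using a r assms by (intro M.finsum_cong') (auto simp: PiE_iff)
  finally show "r \<odot>\<^bsub>M\<^esub> x \<in> ?N" by (rule image_eqI[where x = "\<lambda>i\<in>X. a i \<otimes>\<^bsub>R\<^esub> r"]) (use a r in auto)
qed

lemma lincombs_unit:
  assumes "finite X" "\<And>i. i \<in> X \<Longrightarrow> s i \<in> carrier M" "j \<in> X"
  shows "(\<Oplus>\<^bsub>M\<^esub>i\<in>X. (if i = j then \<one>\<^bsub>R\<^esub> else \<zero>\<^bsub>R\<^esub>) \<odot>\<^bsub>M\<^esub> s i) = s j"
  using action.lincomb_single[of X j "\<lambda>i. if i = j then \<one>\<^bsub>R\<^esub> else \<zero>\<^bsub>R\<^esub>" s] assms smult_one by simp

lemma generator_in_lincombs:
  assumes "finite X" "\<And>i. i \<in> X \<Longrightarrow> s i \<in> carrier M" "j \<in> X"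
  shows "s j \<in> (\<lambda>a. \<Oplus>\<^bsub>M\<^esub>i\<in>X. a i \<odot>\<^bsub>M\<^esub> s i) ` (X \<rightarrow>\<^sub>E carrier R)"
proof (rule image_eqI)
  show "(\<lambda>i\<in>X. if i = j then \<one>\<^bsub>R\<^esub> else \<zero>\<^bsub>R\<^esub>) \<in> X \<rightarrow>\<^sub>E carrier R" by auto
  have "s j = (\<Oplus>\<^bsub>M\<^esub>i\<in>X. (if i = j then \<one>\<^bsub>R\<^esub> else \<zero>\<^bsub>R\<^esub>) \<odot>\<^bsub>M\<^esub> s i)"
    using lincombs_unit[OF assms] by simp
  also have "\<dots> = (\<Oplus>\<^bsub>M\<^esub>i\<in>X. (\<lambda>i\<in>X. if i = j then \<one>\<^bsub>R\<^esub> else \<zero>\<^bsub>R\<^esub>) i \<odot>\<^bsub>M\<^esub> s i)"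
    using assms by (intro M.finsum_cong') auto
  finally show "s j = (\<Oplus>\<^bsub>M\<^esub>i\<in>X. (\<lambda>i\<in>X. if i = j then \<one>\<^bsub>R\<^esub> else \<zero>\<^bsub>R\<^esub>) i \<odot>\<^bsub>M\<^esub> s i)" .
qed

end

lemma fg_submodule_lincombs:
  assumes "right_module R M" "finite X" "\<And>i. i \<in> X \<Longrightarrow> s i \<in> carrier M"
  shows "fg_submodule R M ((\<lambda>a. \<Oplus>\<^bsub>M\<^esub>i\<in>X. a i \<odot>\<^bsub>M\<^esub> s i) ` (X \<rightarrow>\<^sub>E carrier R))" (is "fg_submodule R M ?N")
proof -
  interpret right_module R M by fact
  show ?thesis unfolding fg_submodule_def
  proof (intro conjI exI[of _ "s ` X"] allI impI)
    show "submodule ?N R M" using lincombs_submodule assms by blast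
    show "s ` X \<subseteq> ?N" using generator_in_lincombs[of X s] assms by blast
    show "?N \<subseteq> H" if "submodule H R M" "s ` X \<subseteq> H" for H
      using that assms by (auto intro!: submodule_lincomb)
  qed (use assms in auto)
qed

text \<open>
  The generators are enumerated without repetition, so that a map defined on generators can send the
  \<open>i\<close>-th one to the \<open>i\<close>-th unit vector.
\<close>

lemma fg_submodule_obtain_generators:
  assumes "right_module R M" "fg_submodule R M N"
  obtains n :: nat and s where "inj_on s {..<n}" "\<And>i. i < n \<Longrightarrow> s i \<in> N"
    "N = (\<lambda>a. \<Oplus>\<^bsub>M\<^esub>i\<in>{..<n}. a i \<odot>\<^bsub>M\<^esub> s i) ` ({..<n} \<rightarrow>\<^sub>E carrier R)"
proof -
  interpret right_module R M by fact
  have N: "submodule N R M" using assms unfolding fg_submodule_def by simp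
  obtain S where S: "finite S" "S \<subseteq> N" and "\<forall>H. submodule H R M \<longrightarrow> S \<subseteq> H \<longrightarrow> N \<subseteq> H"
    using assms(2) unfolding fg_submodule_def by (elim conjE exE) (rule that)
  then have least: "N \<subseteq> H" if "submodule H R M" "S \<subseteq> H" for H using that by simp
  obtain s where s: "bij_betw s {..<card S} S"
    using ex_bij_betw_nat_finite[OF S(1)] by (auto simp: atLeast0LessThan)
  let ?n = "card S"
  let ?N = "(\<lambda>a. \<Oplus>\<^bsub>M\<^esub>i\<in>{..<?n}. a i \<odot>\<^bsub>M\<^esub> s i) ` ({..<?n} \<rightarrow>\<^sub>E carrier R)"
  have sN: "s i \<in> N" if "i < ?n" for i using that s S(2) by (auto simp: bij_betw_def)
  have sM: "s i \<in> carrier M" if "i < ?n" for i using sN[OF that] N by (auto simp: submodule_iff)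
  have "?N \<subseteq> N" using N sN by (auto intro!: submodule_lincomb)
  moreover have "N \<subseteq> ?N"
  proof (rule least)
    show "submodule ?N R M" using sM by (intro lincombs_submodule) auto
    show "S \<subseteq> ?N"
    proof
      fix x assume "x \<in> S"
      then obtain j where "j < ?n" "x = s j" using s by (auto simp: bij_betw_def)
      then show "x \<in> ?N" using generator_in_lincombs[of "{..<?n}" s j] sM by auto
    qed
  qed
  ultimately have "N = ?N" by simp
  with sN show ?thesis by (rule that[of s ?n, OF bij_betw_imp_inj_on[OF s]])
qed

section \<open>Homomorphisms and free modules of finite rank\<close>

lemma rmodule_homD:
  assumes "h \<in> rmodule_hom R M N"
  shows "x \<in> carrier M \<Longrightarrow> h x \<in> carrier N"
    and "x \<in> carrier M \<Longrightarrow> y \<in> carrier M \<Longrightarrow> h (x \<oplus>\<^bsub>M\<^esub> y) = h x \<oplus>\<^bsub>N\<^esub> h y"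
    and "a \<in> carrier R \<Longrightarrow> x \<in> carrier M \<Longrightarrow> h (a \<odot>\<^bsub>M\<^esub> x) = a \<odot>\<^bsub>N\<^esub> h x"
  using assms by (auto simp: rmodule_hom_def hom_def)

locale right_module_hom = dom: right_module R M + cod: right_module R N
  for R :: "('a, 'r) ring_scheme" (structure) and M :: "('a, 'm) module" and N :: "('a, 'n) module" +
  fixes h assumes hom: "h \<in> rmodule_hom R M N"
begin

lemmas hom_closed [simp] = rmodule_homD(1)[OF hom]
lemmas hom_add = rmodule_homD(2)[OF hom]
lemmas hom_smult = rmodule_homD(3)[OF hom]

lemma hom_sum: "finite X \<Longrightarrow> (\<And>i. i \<in> X \<Longrightarrow> f i \<in> carrier M) \<Longrightarrow>
    h (\<Oplus>\<^bsub>M\<^esub>i\<in>X. f i) = (\<Oplus>\<^bsub>N\<^esub>i\<in>X. h (f i))"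
  by (rule hom_finsum) (use hom in \<open>auto simp: rmodule_hom_def dom.abelian_group_axioms cod.abelian_group_axioms\<close>)

lemma hom_zero [simp]: "h \<zero>\<^bsub>M\<^esub> = \<zero>\<^bsub>N\<^esub>"
  using hom_sum[of "{}"] by simp

lemma hom_minus: "x \<in> carrier M \<Longrightarrow> h (\<ominus>\<^bsub>M\<^esub> x) = \<ominus>\<^bsub>N\<^esub> h x"
  using hom_add[of "\<ominus>\<^bsub>M\<^esub> x" x] by (intro cod.minus_equality[symmetric]) (auto simp: dom.l_neg)

lemma hom_diff: "x \<in> carrier M \<Longrightarrow> y \<in> carrier M \<Longrightarrow> h (x \<ominus>\<^bsub>M\<^esub> y) = h x \<ominus>\<^bsub>N\<^esub> h y"
  by (simp add: a_minus_def hom_add hom_minus)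

lemma hom_lincomb:
  assumes "finite X" "\<And>i. i \<in> X \<Longrightarrow> a i \<in> carrier R" "\<And>i. i \<in> X \<Longrightarrow> s i \<in> carrier M"
  shows "h (\<Oplus>\<^bsub>M\<^esub>i\<in>X. a i \<odot>\<^bsub>M\<^esub> s i) = (\<Oplus>\<^bsub>N\<^esub>i\<in>X. a i \<odot>\<^bsub>N\<^esub> h (s i))"
proof -
  have "h (\<Oplus>\<^bsub>M\<^esub>i\<in>X. a i \<odot>\<^bsub>M\<^esub> s i) = (\<Oplus>\<^bsub>N\<^esub>i\<in>X. h (a i \<odot>\<^bsub>M\<^esub> s i))"
    using assms by (intro hom_sum) auto
  also have "\<dots> = (\<Oplus>\<^bsub>N\<^esub>i\<in>X. a i \<odot>\<^bsub>N\<^esub> h (s i))"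
    by (rule cod.finsum_cong') (use assms in \<open>auto simp: hom_smult\<close>)
  finally show ?thesis .
qed

lemma submodule_vimage:
  assumes "submodule H R N" shows "submodule {x \<in> carrier M. h x \<in> H} R M"
  using assms unfolding dom.submodule_iff cod.submodule_iff by (auto simp: hom_add hom_smult)

lemma submodule_image:
  assumes "submodule H R M" shows "submodule (h ` H) R N"
proof -
  have H: "H \<subseteq> carrier M" "\<zero>\<^bsub>M\<^esub> \<in> H" "\<And>x y. x \<in> H \<Longrightarrow> y \<in> H \<Longrightarrow> x \<oplus>\<^bsub>M\<^esub> y \<in> H"
    "\<And>a x. a \<in> carrier R \<Longrightarrow> x \<in> H \<Longrightarrow> a \<odot>\<^bsub>M\<^esub> x \<in> H"
    using assms unfolding dom.submodule_iff by auto
  show ?thesis unfolding cod.submodule_iff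
  proof (intro conjI ballI)
    show "h ` H \<subseteq> carrier N" using H(1) by auto
    show "\<zero>\<^bsub>N\<^esub> \<in> h ` H" using H(2) hom_zero by (metis imageI)
    show "x \<oplus>\<^bsub>N\<^esub> y \<in> h ` H" if "x \<in> h ` H" "y \<in> h ` H" for x y
      using that H(1,3) hom_add by (auto simp: subset_iff) (metis imageI)
    show "a \<odot>\<^bsub>N\<^esub> x \<in> h ` H" if "a \<in> carrier R" "x \<in> h ` H" for a x
      using that H(1,4) hom_smult by (auto simp: subset_iff) (metis imageI)
  qed
qed

lemma fg_submodule_image:
  assumes "fg_submodule R M H" shows "fg_submodule R N (h ` H)"
proof -
  have H: "submodule H R M" using assms unfolding fg_submodule_def by simp
  obtain S where S: "finite S" "S \<subseteq> H" and "\<forall>L. submodule L R M \<longrightarrow> S \<subseteq> L \<longrightarrow> H \<subseteq> L"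
    using assms unfolding fg_submodule_def by (elim conjE exE) (rule that)
  then have least: "H \<subseteq> L" if "submodule L R M" "S \<subseteq> L" for L using that by simp
  have HM: "H \<subseteq> carrier M" using H by (simp add: dom.submodule_iff)
  show ?thesis unfolding fg_submodule_def
  proof (intro conjI exI[of _ "h ` S"] allI impI)
    show "submodule (h ` H) R N" by (rule submodule_image[OF H])
    show "h ` H \<subseteq> L" if L: "submodule L R N" "h ` S \<subseteq> L" for L
    proof -
      have "H \<subseteq> {x \<in> carrier M. h x \<in> L}"
        by (rule least[OF submodule_vimage[OF L(1)]]) (use S(2) HM L(2) in auto)
      then show ?thesis by auto
    qed
  qed (use S in auto)
qed

lemma kernel_eq: "a_kernel M N h = {x \<in> carrier M. h x = \<zero>\<^bsub>N\<^esub>}"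
  by (simp add: a_kernel_def')

lemma submodule_kernel: "submodule (a_kernel M N h) R M"
  unfolding kernel_eq dom.submodule_iff by (auto simp: hom_add hom_smult)

end

text \<open>
  If \<open>N\<close> has only finitely many classes modulo a finitely generated submodule, then representatives of
  the classes complete its generators.
\<close>

lemma fg_submodule_sum:
  assumes "right_module R M" "fg_submodule R M H" "finite T" "T \<subseteq> N" "submodule N R M" "H \<subseteq> N"
    and "\<And>x. x \<in> N \<Longrightarrow> \<exists>t\<in>T. x \<ominus>\<^bsub>M\<^esub> t \<in> H"
  shows "fg_submodule R M N"
proof -
  interpret right_module R M by fact
  obtain S where S: "finite S" "S \<subseteq> H" and "\<forall>L. submodule L R M \<longrightarrow> S \<subseteq> L \<longrightarrow> H \<subseteq> L"
    using assms(2) unfolding fg_submodule_def by (elim conjE exE) (rule that)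
  then have least: "H \<subseteq> L" if "submodule L R M" "S \<subseteq> L" for L using that by simp
  have NM: "N \<subseteq> carrier M" using assms(5) by (simp add: submodule_iff)
  show ?thesis unfolding fg_submodule_def
  proof (intro conjI exI[of _ "S \<union> T"] allI impI)
    show "N \<subseteq> L" if L: "submodule L R M" "S \<union> T \<subseteq> L" for L
    proof
      fix x assume x: "x \<in> N"
      then obtain t where t: "t \<in> T" "x \<ominus>\<^bsub>M\<^esub> t \<in> H" using assms(7) by blast
      have "H \<subseteq> L" by (rule least) (use L in auto)
      then have "(x \<ominus>\<^bsub>M\<^esub> t) \<oplus>\<^bsub>M\<^esub> t \<in> L" using L t unfolding submodule_iff by blast
      moreover have "(x \<ominus>\<^bsub>M\<^esub> t) \<oplus>\<^bsub>M\<^esub> t = x"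
        using x t NM assms(4) by (simp add: a_minus_def M.a_assoc M.l_neg subset_iff)
      ultimately show "x \<in> L" by simp
    qed
  qed (use S assms in auto)
qed

abbreviation free_rank :: "('a, 'r) ring_scheme \<Rightarrow> nat \<Rightarrow> ('a, nat \<Rightarrow> 'a) module" where
  "free_rank R n \<equiv> free_right_module R {..<n}"

definition unit_vec :: "('a, 'r) ring_scheme \<Rightarrow> nat \<Rightarrow> nat \<Rightarrow> nat \<Rightarrow> 'a" where
  "unit_vec R n j = (\<lambda>i\<in>{..<n}. if i = j then \<one>\<^bsub>R\<^esub> else \<zero>\<^bsub>R\<^esub>)"

lemma free_rank_simps:
  "carrier (free_rank R n) = ({..<n} \<rightarrow>\<^sub>E carrier R)"
  "\<zero>\<^bsub>free_rank R n\<^esub> = (\<lambda>i\<in>{..<n}. \<zero>\<^bsub>R\<^esub>)"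
  "f \<oplus>\<^bsub>free_rank R n\<^esub> g = (\<lambda>i\<in>{..<n}. f i \<oplus>\<^bsub>R\<^esub> g i)"
  "a \<odot>\<^bsub>free_rank R n\<^esub> f = (\<lambda>i\<in>{..<n}. f i \<otimes>\<^bsub>R\<^esub> a)"
  by (auto simp: free_right_module_def)

context ring
begin

lemma right_module_free_rank: "right_module R (free_rank R n)"
proof -
  have ag: "abelian_group (free_rank R n)"
  proof (rule abelian_groupI)
    fix x assume x: "x \<in> carrier (free_rank R n)"
    show "\<exists>y\<in>carrier (free_rank R n). y \<oplus>\<^bsub>free_rank R n\<^esub> x = \<zero>\<^bsub>free_rank R n\<^esub>"
      by (rule bexI[of _ "\<lambda>i\<in>{..<n}. \<ominus> x i"])
         (use x in \<open>auto simp: free_rank_simps l_neg PiE_iff intro!: restrict_ext\<close>)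
    show "\<zero>\<^bsub>free_rank R n\<^esub> \<oplus>\<^bsub>free_rank R n\<^esub> x = x"
      using x unfolding free_rank_simps by (intro PiE_ext[of _ "{..<n}" "\<lambda>_. carrier R"]) (auto simp: PiE_iff)
  qed (auto simp: free_rank_simps a_ac PiE_iff intro!: restrict_ext)
  show ?thesis
  proof (rule right_module.intro[OF ring_axioms ag], unfold_locales)
    fix x assume "x \<in> carrier (free_rank R n)"
    then show "\<one> \<odot>\<^bsub>free_rank R n\<^esub> x = x"
      unfolding free_rank_simps by (intro PiE_ext[of _ "{..<n}" "\<lambda>_. carrier R"]) (auto simp: PiE_iff)
  qed (auto simp: free_rank_simps PiE_iff r_distr l_distr m_assoc intro!: restrict_ext)
qed

lemma free_rank_minus:
  assumes "f \<in> carrier (free_rank R n)"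
  shows "\<ominus>\<^bsub>free_rank R n\<^esub> f = (\<lambda>i\<in>{..<n}. \<ominus> f i)"
proof -
  interpret F: right_module R "free_rank R n" by (rule right_module_free_rank)
  show ?thesis
    by (rule F.minus_equality)
       (use assms in \<open>auto simp: free_rank_simps l_neg PiE_iff intro!: restrict_ext\<close>)
qed

lemma free_rank_diff:
  assumes "f \<in> carrier (free_rank R n)" "g \<in> carrier (free_rank R n)"
  shows "f \<ominus>\<^bsub>free_rank R n\<^esub> g = (\<lambda>i\<in>{..<n}. f i \<ominus> g i)"
  using assms by (auto simp: a_minus_def free_rank_minus free_rank_simps(3) intro!: restrict_ext)

lemma free_rank_finsum:
  assumes "finite X" "\<And>x. x \<in> X \<Longrightarrow> f x \<in> carrier (free_rank R n)"
  shows "(\<Oplus>\<^bsub>free_rank R n\<^esub>x\<in>X. f x) = (\<lambda>i\<in>{..<n}. \<Oplus>x\<in>X. f x i)"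
  using assms
proof (induction X rule: finite_induct)
  case empty
  interpret F: right_module R "free_rank R n" by (rule right_module_free_rank)
  show ?case by (simp add: free_rank_simps)
next
  case (insert x X)
  interpret F: right_module R "free_rank R n" by (rule right_module_free_rank)
  have "(\<Oplus>\<^bsub>free_rank R n\<^esub>x\<in>insert x X. f x) = f x \<oplus>\<^bsub>free_rank R n\<^esub> (\<lambda>i\<in>{..<n}. \<Oplus>x\<in>X. f x i)"
    using insert.hyps insert.prems insert.IH by (subst F.finsum_insert) (auto simp del: restrict_apply)
  also have "\<dots> = (\<lambda>i\<in>{..<n}. \<Oplus>x\<in>insert x X. f x i)"
    using insert by (auto simp: free_rank_simps PiE_iff finsum_insert intro!: restrict_ext)
  finally show ?case .
qed

lemma unit_vec_closed [simp]: "unit_vec R n j \<in> carrier (free_rank R n)"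
  by (auto simp: unit_vec_def free_rank_simps)

lemma unit_vec_expansion:
  assumes "f \<in> carrier (free_rank R n)"
  shows "(\<Oplus>\<^bsub>free_rank R n\<^esub>i\<in>{..<n}. f i \<odot>\<^bsub>free_rank R n\<^esub> unit_vec R n i) = f"
proof -
  interpret F: right_module R "free_rank R n" by (rule right_module_free_rank)
  have fc: "f i \<in> carrier R" if "i < n" for i using assms that by (auto simp: free_rank_simps)
  have "(\<Oplus>\<^bsub>free_rank R n\<^esub>i\<in>{..<n}. f i \<odot>\<^bsub>free_rank R n\<^esub> unit_vec R n i)
      = (\<lambda>j\<in>{..<n}. \<Oplus>i\<in>{..<n}. (f i \<odot>\<^bsub>free_rank R n\<^esub> unit_vec R n i) j)"
    using fc by (intro free_rank_finsum) auto
  also have "\<dots> = (\<lambda>j\<in>{..<n}. f j)"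
  proof (rule restrict_ext)
    fix j assume j: "j \<in> {..<n}"
    have "(\<Oplus>i\<in>{..<n}. (f i \<odot>\<^bsub>free_rank R n\<^esub> unit_vec R n i) j) = (\<Oplus>i\<in>{..<n}. if j = i then f i else \<zero>)"
      using fc j by (intro finsum_cong') (auto simp: free_rank_simps unit_vec_def)
    also have "\<dots> = f j" using fc j by (intro finsum_singleton) auto
    finally show "(\<Oplus>i\<in>{..<n}. (f i \<odot>\<^bsub>free_rank R n\<^esub> unit_vec R n i) j) = f j" .
  qed
  also have "\<dots> = f" using assms by (auto simp: free_rank_simps PiE_def extensional_restrict)
  finally show ?thesis .
qed

lemma lincomb_hom_free_rank:
  assumes "right_module R M" "\<And>i. i < n \<Longrightarrow> s i \<in> carrier M"
  shows "(\<lambda>f. \<Oplus>\<^bsub>M\<^esub>i\<in>{..<n}. f i \<odot>\<^bsub>M\<^esub> s i) \<in> rmodule_hom R (free_rank R n) M"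
proof -
  interpret right_module R M by fact
  show ?thesis unfolding rmodule_hom_def hom_def
  proof (intro CollectI conjI ballI Pi_I)
    fix f assume f: "f \<in> carrier (add_monoid (free_rank R n))"
    then have fc: "f i \<in> carrier R" if "i < n" for i using that by (auto simp: free_rank_simps)
    show "(\<Oplus>\<^bsub>M\<^esub>i\<in>{..<n}. f i \<odot>\<^bsub>M\<^esub> s i) \<in> carrier (add_monoid M)"
      using fc assms by (auto intro!: M.finsum_closed)
    fix g assume g: "g \<in> carrier (add_monoid (free_rank R n))"
    then have gc: "g i \<in> carrier R" if "i < n" for i using that by (auto simp: free_rank_simps)
    have "(\<Oplus>\<^bsub>M\<^esub>i\<in>{..<n}. (f \<oplus>\<^bsub>free_rank R n\<^esub> g) i \<odot>\<^bsub>M\<^esub> s i) = (\<Oplus>\<^bsub>M\<^esub>i\<in>{..<n}. (f i \<oplus> g i) \<odot>\<^bsub>M\<^esub> s i)"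
      using fc gc assms by (intro M.finsum_cong') (auto simp: free_rank_simps)
    also have "\<dots> = (\<Oplus>\<^bsub>M\<^esub>i\<in>{..<n}. f i \<odot>\<^bsub>M\<^esub> s i) \<oplus>\<^bsub>M\<^esub> (\<Oplus>\<^bsub>M\<^esub>i\<in>{..<n}. g i \<odot>\<^bsub>M\<^esub> s i)"
      using fc gc assms by (intro action.lincomb_add_l) auto
    finally show "(\<Oplus>\<^bsub>M\<^esub>i\<in>{..<n}. (f \<otimes>\<^bsub>add_monoid (free_rank R n)\<^esub> g) i \<odot>\<^bsub>M\<^esub> s i) =
       (\<Oplus>\<^bsub>M\<^esub>i\<in>{..<n}. f i \<odot>\<^bsub>M\<^esub> s i) \<otimes>\<^bsub>add_monoid M\<^esub> (\<Oplus>\<^bsub>M\<^esub>i\<in>{..<n}. g i \<odot>\<^bsub>M\<^esub> s i)" by simp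
  next
    fix a f assume a: "a \<in> carrier R" and f: "f \<in> carrier (free_rank R n)"
    then have fc: "f i \<in> carrier R" if "i < n" for i using that by (auto simp: free_rank_simps)
    have "(\<Oplus>\<^bsub>M\<^esub>i\<in>{..<n}. (a \<odot>\<^bsub>free_rank R n\<^esub> f) i \<odot>\<^bsub>M\<^esub> s i) = (\<Oplus>\<^bsub>M\<^esub>i\<in>{..<n}. (f i \<otimes> a) \<odot>\<^bsub>M\<^esub> s i)"
      using fc a assms by (intro M.finsum_cong') (auto simp: free_rank_simps)
    also have "\<dots> = a \<odot>\<^bsub>M\<^esub> (\<Oplus>\<^bsub>M\<^esub>i\<in>{..<n}. f i \<odot>\<^bsub>M\<^esub> s i)"
      using fc a assms by (intro lincomb_smult[symmetric]) auto
    finally show "(\<Oplus>\<^bsub>M\<^esub>i\<in>{..<n}. (a \<odot>\<^bsub>free_rank R n\<^esub> f) i \<odot>\<^bsub>M\<^esub> s i) = a \<odot>\<^bsub>M\<^esub> (\<Oplus>\<^bsub>M\<^esub>i\<in>{..<n}. f i \<odot>\<^bsub>M\<^esub> s i)" .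
  qed
qed

lemma hom_free_rank_expansion:
  assumes "right_module R M" "h \<in> rmodule_hom R (free_rank R n) M" "f \<in> carrier (free_rank R n)"
  shows "h f = (\<Oplus>\<^bsub>M\<^esub>i\<in>{..<n}. f i \<odot>\<^bsub>M\<^esub> h (unit_vec R n i))"
proof -
  interpret right_module_hom R "free_rank R n" M h
    by (rule right_module_hom.intro[OF right_module_free_rank assms(1)]) (unfold_locales, rule assms(2))
  have fc: "f i \<in> carrier R" if "i < n" for i using assms(3) that by (auto simp: free_rank_simps)
  have "h f = h (\<Oplus>\<^bsub>free_rank R n\<^esub>i\<in>{..<n}. f i \<odot>\<^bsub>free_rank R n\<^esub> unit_vec R n i)"
    using unit_vec_expansion[OF assms(3)] by simp
  also have "\<dots> = (\<Oplus>\<^bsub>M\<^esub>i\<in>{..<n}. f i \<odot>\<^bsub>M\<^esub> h (unit_vec R n i))"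
    by (rule hom_lincomb) (use fc in auto)
  finally show ?thesis .
qed

end

section \<open>Finite presentation\<close>

lemma finitely_presented_iff:
  assumes "right_module R M"
  shows "finitely_presented_right_module R M \<longleftrightarrow>
    (\<exists>n h. h \<in> rmodule_hom R (free_rank R n) M \<and> h ` carrier (free_rank R n) = carrier M \<and>
      fg_submodule R (free_rank R n) (a_kernel (free_rank R n) M h))"
proof -
  interpret right_module R M by fact
  have "finitely_generated_module R (free_rank R n\<lparr>carrier := a_kernel (free_rank R n) M h\<rparr>) \<longleftrightarrow>
      fg_submodule R (free_rank R n) (a_kernel (free_rank R n) M h)"
    if "h \<in> rmodule_hom R (free_rank R n) M" for n :: nat and h
  proof -
    interpret right_module_hom R "free_rank R n" M h
      by (rule right_module_hom.intro[OF R.right_module_free_rank assms(1)]) (unfold_locales, rule that)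
    show ?thesis by (rule finitely_generated_module_iff[OF dom.right_module_axioms submodule_kernel])
  qed
  then show ?thesis using assms unfolding finitely_presented_right_module_def Let_def by (simp cong: conj_cong)
qed

text \<open>
  Schanuel's lemma: in a finitely presented module the relations between any finite set of
  generators are finitely generated.  Lifting each of two presentations \<open>h\<close> and \<open>p\<close> through the
  other gives \<open>\<alpha>\<close> and \<open>\<beta>\<close> with \<open>h \<alpha> = p\<close> and \<open>p \<beta> = h\<close>.  An element \<open>f\<close> of the kernel of \<open>p\<close> is the sum of
  \<open>f - \<beta> \<alpha> f\<close>, a combination of the images of the unit vectors, and of \<open>\<beta> \<alpha> f\<close>, which comes from the
  kernel of \<open>h\<close>.
\<close>

lemma kernel_fg_if_finitely_presented:
  assumes "right_module R M" "finitely_presented_right_module R M"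
    and p: "p \<in> rmodule_hom R (free_rank R k) M" "p ` carrier (free_rank R k) = carrier M"
  shows "fg_submodule R (free_rank R k) (a_kernel (free_rank R k) M p)"
proof -
  interpret right_module R M by fact
  obtain n h where h: "h \<in> rmodule_hom R (free_rank R n) M" "h ` carrier (free_rank R n) = carrier M"
    and fg: "fg_submodule R (free_rank R n) (a_kernel (free_rank R n) M h)"
    using assms(2) unfolding finitely_presented_iff[OF assms(1)] by auto
  let ?K = "free_rank R k" and ?N = "free_rank R n"
  have rm: "right_module R ?K" "right_module R ?N" by (rule R.right_module_free_rank)+
  interpret P: right_module_hom R ?K M p
    by (rule right_module_hom.intro[OF rm(1) assms(1)]) (unfold_locales, rule p)
  interpret H: right_module_hom R ?N M h
    by (rule right_module_hom.intro[OF rm(2) assms(1)]) (unfold_locales, rule h)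
  \<comment> \<open>Lift each presentation through the other.\<close>
  define u where "u i = (SOME y. y \<in> carrier ?N \<and> h y = p (unit_vec R k i))" for i
  have u: "u i \<in> carrier ?N \<and> h (u i) = p (unit_vec R k i)" for i
  proof -
    have "p (unit_vec R k i) \<in> h ` carrier ?N" using h(2) by simp
    then have "\<exists>y. y \<in> carrier ?N \<and> h y = p (unit_vec R k i)" by auto
    then show ?thesis unfolding u_def by (rule someI_ex)
  qed
  define v where "v i = (SOME y. y \<in> carrier ?K \<and> p y = h (unit_vec R n i))" for i
  have v: "v i \<in> carrier ?K \<and> p (v i) = h (unit_vec R n i)" for i
  proof -
    have "h (unit_vec R n i) \<in> p ` carrier ?K" using p(2) by simp
    then have "\<exists>y. y \<in> carrier ?K \<and> p y = h (unit_vec R n i)" by auto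
    then show ?thesis unfolding v_def by (rule someI_ex)
  qed
  define \<alpha> where "\<alpha> f = (\<Oplus>\<^bsub>?N\<^esub>i\<in>{..<k}. f i \<odot>\<^bsub>?N\<^esub> u i)" for f
  define \<beta> where "\<beta> f = (\<Oplus>\<^bsub>?K\<^esub>i\<in>{..<n}. f i \<odot>\<^bsub>?K\<^esub> v i)" for f
  have ah: "\<alpha> \<in> rmodule_hom R ?K ?N" unfolding \<alpha>_def
    by (rule R.lincomb_hom_free_rank[OF rm(2)]) (use u in auto)
  have bh: "\<beta> \<in> rmodule_hom R ?N ?K" unfolding \<beta>_def
    by (rule R.lincomb_hom_free_rank[OF rm(1)]) (use v in auto)
  interpret A: right_module_hom R ?K ?N \<alpha>
    by (rule right_module_hom.intro[OF rm(1,2)]) (unfold_locales, rule ah)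
  interpret B: right_module_hom R ?N ?K \<beta>
    by (rule right_module_hom.intro[OF rm(2,1)]) (unfold_locales, rule bh)
  have ha: "h (\<alpha> f) = p f" if f: "f \<in> carrier ?K" for f
  proof -
    have fc: "f i \<in> carrier R" if "i < k" for i using f that by (auto simp: free_rank_simps)
    have "h (\<alpha> f) = (\<Oplus>\<^bsub>M\<^esub>i\<in>{..<k}. f i \<odot>\<^bsub>M\<^esub> h (u i))"
      unfolding \<alpha>_def by (rule H.hom_lincomb) (use u fc in auto)
    then show ?thesis unfolding R.hom_free_rank_expansion[OF assms(1) p(1) f] using u by simp
  qed
  have pb: "p (\<beta> f) = h f" if f: "f \<in> carrier ?N" for f
  proof -
    have fc: "f i \<in> carrier R" if "i < n" for i using f that by (auto simp: free_rank_simps)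
    have "p (\<beta> f) = (\<Oplus>\<^bsub>M\<^esub>i\<in>{..<n}. f i \<odot>\<^bsub>M\<^esub> p (v i))"
      unfolding \<beta>_def by (rule P.hom_lincomb) (use v fc in auto)
    then show ?thesis unfolding R.hom_free_rank_expansion[OF assms(1) h(1) f] using v by simp
  qed
  let ?kp = "a_kernel ?K M p" and ?kh = "a_kernel ?N M h"
  have fgb: "fg_submodule R ?K (\<beta> ` ?kh)" by (rule B.fg_submodule_image[OF fg])
  obtain S where S: "finite S" "S \<subseteq> \<beta> ` ?kh"
    and "\<forall>L. submodule L R ?K \<longrightarrow> S \<subseteq> L \<longrightarrow> \<beta> ` ?kh \<subseteq> L"
    using fgb unfolding fg_submodule_def by (elim conjE exE) (rule that)
  then have least: "\<beta> ` ?kh \<subseteq> L" if "submodule L R ?K" "S \<subseteq> L" for L using that by simp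
  define d where "d f = f \<ominus>\<^bsub>?K\<^esub> \<beta> (\<alpha> f)" for f
  have dker: "d f \<in> ?kp" if "f \<in> carrier ?K" for f
    using that unfolding d_def P.kernel_eq by (simp add: P.hom_add P.hom_minus pb ha M.r_neg a_minus_def)
  have bker: "\<beta> ` ?kh \<subseteq> ?kp" unfolding P.kernel_eq H.kernel_eq by (auto simp: pb)
  have dh: "d \<in> rmodule_hom R ?K ?K"
    unfolding rmodule_hom_def hom_def
    by (auto simp: d_def A.hom_add B.hom_add A.hom_smult B.hom_smult a_minus_def P.dom.action.smult_r_distr
        P.dom.action.smult_minus_r P.dom.M.minus_add P.dom.M.a_ac)
  show ?thesis unfolding fg_submodule_def
  proof (intro conjI exI[of _ "S \<union> (\<lambda>i. d (unit_vec R k i)) ` {..<k}"] allI impI)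
    show "submodule ?kp R ?K" by (rule P.submodule_kernel)
    show "S \<union> (\<lambda>i. d (unit_vec R k i)) ` {..<k} \<subseteq> ?kp"
      using S bker dker by auto
    fix L assume L: "submodule L R ?K" "S \<union> (\<lambda>i. d (unit_vec R k i)) ` {..<k} \<subseteq> L"
    show "?kp \<subseteq> L"
    proof
      fix f assume "f \<in> ?kp"
      then have f: "f \<in> carrier ?K" and pf: "p f = \<zero>\<^bsub>M\<^esub>" by (auto simp: P.kernel_eq)
      have "d f = (\<Oplus>\<^bsub>?K\<^esub>i\<in>{..<k}. f i \<odot>\<^bsub>?K\<^esub> d (unit_vec R k i))"
        by (rule R.hom_free_rank_expansion[OF rm(1) dh f])
      also have "\<dots> \<in> L"
        using f L by (intro P.dom.submodule_lincomb) (auto simp: free_rank_simps)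
      finally have "d f \<in> L" .
      moreover have "\<beta> (\<alpha> f) \<in> L"
      proof -
        have "\<alpha> f \<in> ?kh" using f pf ha by (simp add: H.kernel_eq)
        moreover have "\<beta> ` ?kh \<subseteq> L" by (rule least) (use L in auto)
        ultimately show ?thesis by blast
      qed
      ultimately have "d f \<oplus>\<^bsub>?K\<^esub> \<beta> (\<alpha> f) \<in> L" using L(1) unfolding P.dom.submodule_iff by blast
      moreover have "d f \<oplus>\<^bsub>?K\<^esub> \<beta> (\<alpha> f) = f"
        using f by (simp add: d_def a_minus_def P.dom.M.a_assoc P.dom.M.l_neg)
      ultimately show "f \<in> L" by simp
    qed
  qed (use S in auto)
qed

text \<open>
  The quotient of \<open>M\<close> by the submodule on whose cosets \<open>q\<close> is constant and which \<open>q\<close> separates,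
  with the values of \<open>q\<close> as underlying set.  The target type of \<open>q\<close> is arbitrary, so the same construction
  yields quotients of free modules and copies of them inside a prescribed universe.
\<close>

definition image_module :: "('a, 'm) module \<Rightarrow> ('m \<Rightarrow> 'u) \<Rightarrow> ('a, 'u) module" where
  "image_module M q =
    \<lparr>carrier = q ` carrier M, monoid.mult = undefined, one = undefined,
     ring.zero = q \<zero>\<^bsub>M\<^esub>,
     ring.add = (\<lambda>u v. q (inv_into (carrier M) q u \<oplus>\<^bsub>M\<^esub> inv_into (carrier M) q v)),
     module.smult = (\<lambda>a u. q (a \<odot>\<^bsub>M\<^esub> inv_into (carrier M) q u))\<rparr>"

lemma image_module:
  assumes "right_module R M" "submodule K R M"
    and qK: "\<forall>x\<in>carrier M. \<forall>y\<in>carrier M. q x = q y \<longleftrightarrow> x \<ominus>\<^bsub>M\<^esub> y \<in> K"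
  shows "right_module R (image_module M q)" "q \<in> rmodule_hom R M (image_module M q)"
    "q ` carrier M = carrier (image_module M q)" "a_kernel M (image_module M q) q = K"
proof -
  interpret right_module R M by fact
  let ?Q = "image_module M q"
  have q: "q x = q y \<longleftrightarrow> x \<ominus>\<^bsub>M\<^esub> y \<in> K" if "x \<in> carrier M" "y \<in> carrier M" for x y
    using qK that by simp
  have K: "K \<subseteq> carrier M" "\<zero>\<^bsub>M\<^esub> \<in> K" "\<And>x y. x \<in> K \<Longrightarrow> y \<in> K \<Longrightarrow> x \<oplus>\<^bsub>M\<^esub> y \<in> K"
    "\<And>a x. a \<in> carrier R \<Longrightarrow> x \<in> K \<Longrightarrow> a \<odot>\<^bsub>M\<^esub> x \<in> K"
    using assms(2) unfolding submodule_iff by auto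
  have rep: "inv_into (carrier M) q (q x) \<in> carrier M" "q (inv_into (carrier M) q (q x)) = q x"
    if "x \<in> carrier M" for x using that by (auto simp: inv_into_into f_inv_into_f)
  have cong_add: "q (x \<oplus>\<^bsub>M\<^esub> y) = q (x' \<oplus>\<^bsub>M\<^esub> y')"
    if "x \<in> carrier M" "y \<in> carrier M" "x' \<in> carrier M" "y' \<in> carrier M" "q x = q x'" "q y = q y'" for x y x' y'
  proof -
    have "(x \<oplus>\<^bsub>M\<^esub> y) \<ominus>\<^bsub>M\<^esub> (x' \<oplus>\<^bsub>M\<^esub> y') = (x \<ominus>\<^bsub>M\<^esub> x') \<oplus>\<^bsub>M\<^esub> (y \<ominus>\<^bsub>M\<^esub> y')"
      using that by (simp add: a_minus_def M.minus_add M.a_ac)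
    then show ?thesis using that q K(3) by simp
  qed
  have cong_smult: "q (a \<odot>\<^bsub>M\<^esub> x) = q (a \<odot>\<^bsub>M\<^esub> x')"
    if "a \<in> carrier R" "x \<in> carrier M" "x' \<in> carrier M" "q x = q x'" for a x x'
  proof -
    have "a \<odot>\<^bsub>M\<^esub> x \<ominus>\<^bsub>M\<^esub> a \<odot>\<^bsub>M\<^esub> x' = a \<odot>\<^bsub>M\<^esub> (x \<ominus>\<^bsub>M\<^esub> x')"
      using that by (simp add: a_minus_def smult_r_distr action.smult_minus_r)
    then show ?thesis using that q K(4) by simp
  qed
  have Q_add: "q x \<oplus>\<^bsub>?Q\<^esub> q y = q (x \<oplus>\<^bsub>M\<^esub> y)" if "x \<in> carrier M" "y \<in> carrier M" for x y
    using that rep by (simp add: image_module_def) (intro cong_add, auto)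
  have Q_smult: "a \<odot>\<^bsub>?Q\<^esub> q x = q (a \<odot>\<^bsub>M\<^esub> x)" if "a \<in> carrier R" "x \<in> carrier M" for a x
    using that rep by (simp add: image_module_def) (intro cong_smult, auto)
  have Q_carrier: "carrier ?Q = q ` carrier M" and Q_zero: "\<zero>\<^bsub>?Q\<^esub> = q \<zero>\<^bsub>M\<^esub>" by (auto simp: image_module_def)
  have ag: "abelian_group ?Q"
  proof (rule abelian_groupI)
    fix x assume "x \<in> carrier ?Q"
    then obtain y where y: "y \<in> carrier M" "x = q y" by (auto simp: Q_carrier)
    show "\<exists>y\<in>carrier ?Q. y \<oplus>\<^bsub>?Q\<^esub> x = \<zero>\<^bsub>?Q\<^esub>"
      by (rule bexI[of _ "q (\<ominus>\<^bsub>M\<^esub> y)"]) (use y in \<open>auto simp: Q_add Q_zero Q_carrier M.l_neg\<close>)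
  qed (auto simp: Q_add Q_carrier Q_zero M.a_ac)
  show "right_module R ?Q"
    by (rule right_module.intro[OF R.ring_axioms ag], unfold_locales)
       (auto simp: Q_add Q_smult Q_carrier smult_l_distr smult_r_distr smult_assoc smult_one)
  show "q \<in> rmodule_hom R M ?Q"
    by (auto simp: rmodule_hom_def hom_def Q_add Q_smult Q_carrier)
  show "q ` carrier M = carrier ?Q" by (simp add: Q_carrier)
  have "q x = q \<zero>\<^bsub>M\<^esub> \<longleftrightarrow> x \<in> K" if "x \<in> carrier M" for x
    using q[OF that, of "\<zero>\<^bsub>M\<^esub>"] that by (simp add: a_minus_def M.minus_equality[of "\<zero>\<^bsub>M\<^esub>" "\<zero>\<^bsub>M\<^esub>"])
  then show "a_kernel M ?Q q = K" using K(1) by (auto simp: a_kernel_def' Q_zero)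
qed

text \<open>
  Map an element to a chosen representative of its coset, and embed the countably many
  representatives in \<open>'u\<close>.
\<close>

lemma exists_quotient_map:
  assumes "right_module R M" "submodule K R M" "countable (carrier M)" "infinite (UNIV :: 'u set)"
  obtains q :: "'m \<Rightarrow> 'u" where
    "\<forall>x\<in>carrier M. \<forall>y\<in>carrier M. q x = q y \<longleftrightarrow> x \<ominus>\<^bsub>(M :: ('a, 'm) module)\<^esub> y \<in> K"
proof -
  interpret right_module R M by fact
  obtain e :: "nat \<Rightarrow> 'u" where e: "inj e"
    using infinite_countable_subset[OF assms(4)] by auto
  define r where "r x = (SOME y. y \<in> carrier M \<and> x \<ominus>\<^bsub>M\<^esub> y \<in> K)" for x
  have K: "K \<subseteq> carrier M" "\<zero>\<^bsub>M\<^esub> \<in> K" "\<And>x y. x \<in> K \<Longrightarrow> y \<in> K \<Longrightarrow> x \<oplus>\<^bsub>M\<^esub> y \<in> K"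
    using assms(2) unfolding submodule_iff by auto
  have r: "r x \<in> carrier M" "x \<ominus>\<^bsub>M\<^esub> r x \<in> K" if "x \<in> carrier M" for x
  proof -
    have "x \<in> carrier M \<and> x \<ominus>\<^bsub>M\<^esub> x \<in> K" using that K by (simp add: a_minus_def M.r_neg)
    from someI[of "\<lambda>y. y \<in> carrier M \<and> x \<ominus>\<^bsub>M\<^esub> y \<in> K", OF this]
    show "r x \<in> carrier M" "x \<ominus>\<^bsub>M\<^esub> r x \<in> K" by (auto simp: r_def)
  qed
  have trans: "x \<ominus>\<^bsub>M\<^esub> z \<in> K" if "x \<in> carrier M" "y \<in> carrier M" "z \<in> carrier M" "x \<ominus>\<^bsub>M\<^esub> y \<in> K" "y \<ominus>\<^bsub>M\<^esub> z \<in> K" for x y z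
  proof -
    have "x \<ominus>\<^bsub>M\<^esub> z = (x \<ominus>\<^bsub>M\<^esub> y) \<oplus>\<^bsub>M\<^esub> (y \<ominus>\<^bsub>M\<^esub> z)"
    proof -
      have "(x \<ominus>\<^bsub>M\<^esub> y) \<oplus>\<^bsub>M\<^esub> (y \<ominus>\<^bsub>M\<^esub> z) = x \<oplus>\<^bsub>M\<^esub> ((\<ominus>\<^bsub>M\<^esub> y \<oplus>\<^bsub>M\<^esub> y) \<oplus>\<^bsub>M\<^esub> \<ominus>\<^bsub>M\<^esub> z)"
        using that by (simp only: a_minus_def M.a_assoc M.a_inv_closed M.a_closed)
      then show ?thesis using that by (simp add: M.l_neg a_minus_def)
    qed
    then show ?thesis using that K by simp
  qed
  have sym: "y \<ominus>\<^bsub>M\<^esub> x \<in> K" if "x \<in> carrier M" "y \<in> carrier M" "x \<ominus>\<^bsub>M\<^esub> y \<in> K" for x y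
  proof -
    have "y \<ominus>\<^bsub>M\<^esub> x = \<ominus>\<^bsub>M\<^esub> (x \<ominus>\<^bsub>M\<^esub> y)" using that by (simp add: a_minus_def M.minus_add M.a_ac)
    then show ?thesis using submodule_minus[OF assms(2)] that by simp
  qed
  have rr: "r x = r y \<longleftrightarrow> x \<ominus>\<^bsub>M\<^esub> y \<in> K" if "x \<in> carrier M" "y \<in> carrier M" for x y
  proof
    assume "r x = r y"
    then have "x \<ominus>\<^bsub>M\<^esub> r y \<in> K" using r[OF that(1)] by simp
    moreover have "r y \<ominus>\<^bsub>M\<^esub> y \<in> K" using sym r[OF that(2)] that by simp
    ultimately show "x \<ominus>\<^bsub>M\<^esub> y \<in> K" using trans[of x "r y" y] that r by simp
  next
    assume xy: "x \<ominus>\<^bsub>M\<^esub> y \<in> K"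
    have "(x \<ominus>\<^bsub>M\<^esub> z \<in> K) = (y \<ominus>\<^bsub>M\<^esub> z \<in> K)" if "z \<in> carrier M" for z
      using trans sym xy that \<open>x \<in> carrier M\<close> \<open>y \<in> carrier M\<close> by blast
    then have "(\<lambda>z. z \<in> carrier M \<and> x \<ominus>\<^bsub>M\<^esub> z \<in> K) = (\<lambda>z. z \<in> carrier M \<and> y \<ominus>\<^bsub>M\<^esub> z \<in> K)" by auto
    then show "r x = r y" unfolding r_def by simp
  qed
  show ?thesis
  proof (rule that[of "\<lambda>x. e (to_nat_on (carrier M) (r x))"], intro ballI)
    fix x y assume xy: "x \<in> carrier M" "y \<in> carrier M"
    have "e (to_nat_on (carrier M) (r x)) = e (to_nat_on (carrier M) (r y)) \<longleftrightarrow> r x = r y"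
      using xy r assms(3) e by (simp add: inj_eq to_nat_on_inj)
    then show "e (to_nat_on (carrier M) (r x)) = e (to_nat_on (carrier M) (r y)) \<longleftrightarrow> x \<ominus>\<^bsub>M\<^esub> y \<in> K"
      using rr xy by simp
  qed
qed

lemma finitely_presented_quotient:
  assumes "ring R" "fg_submodule R (free_rank R n) K"
    and q: "\<forall>x\<in>carrier (free_rank R n). \<forall>y\<in>carrier (free_rank R n).
        q x = q y \<longleftrightarrow> x \<ominus>\<^bsub>free_rank R n\<^esub> y \<in> K"
  shows "finitely_presented_right_module R (image_module (free_rank R n) q)"
proof -
  interpret ring R by fact
  have K: "submodule K R (free_rank R n)" using assms(2) by (simp add: fg_submodule_def)
  note * = image_module[OF right_module_free_rank K q]
  show ?thesis unfolding finitely_presented_iff[OF *(1)]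
    by (intro exI[of _ n] exI[of _ q] conjI) (use *(2-4) assms(2) in simp_all)
qed

section \<open>Ideals of finite index\<close>

text \<open>
  A subgroup has finite index iff some map with finite range separates its cosets.  In this form
  finiteness of an index passes to intersections and annihilators by forming tuples of such maps.
\<close>

lemma (in abelian_group) finite_index_separating_map:
  assumes "subgroup H (add_monoid G)" "finite (a_rcosets H)"
  obtains h :: "'a \<Rightarrow> 'a set" where "finite (h ` carrier G)"
    "\<And>x y. x \<in> carrier G \<Longrightarrow> y \<in> carrier G \<Longrightarrow> h x = h y \<Longrightarrow> x \<ominus> y \<in> H"
proof (rule that[of "\<lambda>x. H +> x"])
  have H: "H \<subseteq> carrier G" "\<zero> \<in> H"
    using subgroup.subset[OF assms(1)] subgroup.one_closed[OF assms(1)] by auto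
  have "(\<lambda>x. H +> x) ` carrier G = a_rcosets H" by (auto simp: A_RCOSETS_def')
  then show "finite ((\<lambda>x. H +> x) ` carrier G)" using assms(2) by simp
  fix x y assume xy: "x \<in> carrier G" "y \<in> carrier G" "H +> x = H +> y"
  have "\<zero> \<oplus> x \<in> H +> x" using H(2) by (auto simp: a_r_coset_def')
  then have "x \<in> H +> y" using xy by simp
  then obtain k where k: "k \<in> H" "x = k \<oplus> y" by (auto simp: a_r_coset_def')
  then have "x \<ominus> y = k" using xy H by (auto simp: a_minus_def a_assoc r_neg)
  then show "x \<ominus> y \<in> H" using k by simp
qed

lemma (in abelian_group) finite_indexI:
  assumes "subgroup H (add_monoid G)" "finite (h ` carrier G)"
    "\<And>x y. x \<in> carrier G \<Longrightarrow> y \<in> carrier G \<Longrightarrow> h x = h y \<Longrightarrow> x \<ominus> y \<in> H"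
  shows "finite (a_rcosets H)"
proof -
  have H: "H \<subseteq> carrier G" "\<And>x y. x \<in> H \<Longrightarrow> y \<in> H \<Longrightarrow> x \<oplus> y \<in> H"
    using subgroup.subset[OF assms(1)] subgroup.m_closed[OF assms(1)] by auto
  have sub: "H +> x \<subseteq> H +> y" if "x \<in> carrier G" "y \<in> carrier G" "h x = h y" for x y
  proof
    fix z assume "z \<in> H +> x"
    then obtain k where k: "k \<in> H" "z = k \<oplus> x" by (auto simp: a_r_coset_def')
    have "(k \<oplus> (x \<ominus> y)) \<oplus> y = z"
      using k H that by (simp add: a_minus_def a_assoc l_neg subset_iff)
    moreover have "k \<oplus> (x \<ominus> y) \<in> H" using H k assms(3)[OF that] by simp
    ultimately show "z \<in> H +> y" unfolding a_r_coset_def' by blast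
  qed
  define r where "r v = (SOME x. x \<in> carrier G \<and> h x = v)" for v
  have "a_rcosets H \<subseteq> (\<lambda>v. H +> r v) ` (h ` carrier G)"
  proof
    fix C assume "C \<in> a_rcosets H"
    then obtain x where x: "x \<in> carrier G" "C = H +> x" by (auto simp: A_RCOSETS_def')
    have "r (h x) \<in> carrier G \<and> h (r (h x)) = h x"
      unfolding r_def by (rule someI[of _ x]) (use x in simp)
    then have "C = H +> r (h x)" using sub[of x "r (h x)"] sub[of "r (h x)" x] x by auto
    then show "C \<in> (\<lambda>v. H +> r v) ` (h ` carrier G)" using x by auto
  qed
  then show ?thesis using assms(2) by (rule finite_subset[OF _ finite_imageI])
qed

lemma (in abelian_group) finite_index_transversal:
  assumes "subgroup H (add_monoid G)" "finite (a_rcosets H)"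
  obtains T where "finite T" "T \<subseteq> carrier G" "\<And>x. x \<in> carrier G \<Longrightarrow> \<exists>t\<in>T. x \<ominus> t \<in> H"
proof -
  obtain h :: "'a \<Rightarrow> 'a set" where h: "finite (h ` carrier G)"
    "\<And>x y. x \<in> carrier G \<Longrightarrow> y \<in> carrier G \<Longrightarrow> h x = h y \<Longrightarrow> x \<ominus> y \<in> H"
    using finite_index_separating_map[OF assms] by blast
  define r where "r v = (SOME x. x \<in> carrier G \<and> h x = v)" for v
  have r: "r (h x) \<in> carrier G \<and> h (r (h x)) = h x" if "x \<in> carrier G" for x
    unfolding r_def by (rule someI[of _ x]) (use that in simp)
  show ?thesis
  proof (rule that[of "r ` h ` carrier G"])
    show "\<exists>t\<in>r ` h ` carrier G. x \<ominus> t \<in> H" if "x \<in> carrier G" for x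
      using h(2)[of x "r (h x)"] r[OF that] that by auto
  qed (use h(1) r in auto)
qed

context ring
begin

lemma finite_index_idealD:
  assumes "I \<in> finite_index_ideals R"
  shows "ideal I R" "I \<subseteq> carrier R" "\<zero> \<in> I" "subgroup I (add_monoid R)" "finite (a_rcosets I)"
    and "x \<in> I \<Longrightarrow> y \<in> I \<Longrightarrow> x \<oplus> y \<in> I" "x \<in> I \<Longrightarrow> \<ominus> x \<in> I" "x \<in> I \<Longrightarrow> y \<in> I \<Longrightarrow> x \<ominus> y \<in> I"
    and "x \<in> I \<Longrightarrow> a \<in> carrier R \<Longrightarrow> x \<otimes> a \<in> I" "x \<in> I \<Longrightarrow> a \<in> carrier R \<Longrightarrow> a \<otimes> x \<in> I"
proof -
  show i: "ideal I R" and "finite (a_rcosets I)" using assms by (auto simp: finite_index_ideals_def)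
  interpret ideal I R by (rule i)
  show "I \<subseteq> carrier R" "\<zero> \<in> I" "subgroup I (add_monoid R)"
    "x \<in> I \<Longrightarrow> y \<in> I \<Longrightarrow> x \<oplus> y \<in> I" "x \<in> I \<Longrightarrow> \<ominus> x \<in> I"
    "x \<in> I \<Longrightarrow> a \<in> carrier R \<Longrightarrow> x \<otimes> a \<in> I" "x \<in> I \<Longrightarrow> a \<in> carrier R \<Longrightarrow> a \<otimes> x \<in> I"
    by (auto simp: a_subset a_subgroup I_l_closed I_r_closed additive_subgroup.a_inv_closed)
  show "x \<in> I \<Longrightarrow> y \<in> I \<Longrightarrow> x \<ominus> y \<in> I" by (simp add: a_minus_def)
qed

lemma finite_index_ideal_Int:
  assumes "I \<in> finite_index_ideals R" "J \<in> finite_index_ideals R"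
  shows "I \<inter> J \<in> finite_index_ideals R"
proof -
  have i: "ideal (I \<inter> J) R" using assms by (auto simp: finite_index_ideals_def intro: i_intersect)
  obtain h :: "'a \<Rightarrow> 'a set" where h: "finite (h ` carrier R)"
    "\<And>x y. x \<in> carrier R \<Longrightarrow> y \<in> carrier R \<Longrightarrow> h x = h y \<Longrightarrow> x \<ominus> y \<in> I"
    using finite_index_separating_map finite_index_idealD(4,5)[OF assms(1)] by blast
  obtain k :: "'a \<Rightarrow> 'a set" where k: "finite (k ` carrier R)"
    "\<And>x y. x \<in> carrier R \<Longrightarrow> y \<in> carrier R \<Longrightarrow> k x = k y \<Longrightarrow> x \<ominus> y \<in> J"
    using finite_index_separating_map finite_index_idealD(4,5)[OF assms(2)] by blast
  have "(\<lambda>x. (h x, k x)) ` carrier R \<subseteq> h ` carrier R \<times> k ` carrier R" by auto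
  then have fin: "finite ((\<lambda>x. (h x, k x)) ` carrier R)" using h(1) k(1) by (rule_tac finite_subset[OF _ finite_cartesian_product])
  have "finite (a_rcosets (I \<inter> J))"
    by (rule finite_indexI[OF _ fin])
       (use h k i in \<open>auto simp: ideal_def additive_subgroup.a_subgroup\<close>)
  then show ?thesis using i by (simp add: finite_index_ideals_def)
qed

lemma carrier_finite_index: "carrier R \<in> finite_index_ideals R"
proof -
  have "finite (a_rcosets (carrier R))"
    by (rule finite_indexI[of _ "\<lambda>_. ()"])
       (use oneideal in \<open>auto simp: ideal_def additive_subgroup.a_subgroup\<close>)
  then show ?thesis using oneideal by (simp add: finite_index_ideals_def)
qed

lemma finite_index_ideal_below:
  assumes "finite A" "\<And>a. a \<in> A \<Longrightarrow> J a \<in> finite_index_ideals R"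
  shows "\<exists>I\<in>finite_index_ideals R. \<forall>a\<in>A. I \<subseteq> J a"
  using assms
proof (induction A rule: finite_induct)
  case empty then show ?case using carrier_finite_index by auto
next
  case (insert a A)
  then obtain I where "I \<in> finite_index_ideals R" "\<forall>a\<in>A. I \<subseteq> J a" by auto
  then show ?case using insert.prems by (intro bexI[of _ "I \<inter> J a"]) (auto intro: finite_index_ideal_Int)
qed

end

text \<open>
  Modulo \<open>H\<close>, the action of a scalar on \<open>M\<close> is determined by what it does to finitely many
  representatives, and for each of them there are finitely many values.  So the ideal of scalars that
  map \<open>M\<close> into \<open>H\<close> has finite index.
\<close>

lemma annihilator_finite_index:
  fixes M :: "('a, 'm) module"
  assumes "right_module R M" "submodule H R M" "finite (a_rcosets\<^bsub>M\<^esub> H)"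
  obtains I where "I \<in> finite_index_ideals R" "\<And>a x. a \<in> I \<Longrightarrow> x \<in> carrier M \<Longrightarrow> a \<odot>\<^bsub>M\<^esub> x \<in> H"
proof -
  interpret right_module R M by fact
  have Hs: "subgroup H (add_monoid M)" using assms(2) by (rule submodule.axioms(1))
  have H: "H \<subseteq> carrier M" "\<zero>\<^bsub>M\<^esub> \<in> H" "\<And>x y. x \<in> H \<Longrightarrow> y \<in> H \<Longrightarrow> x \<oplus>\<^bsub>M\<^esub> y \<in> H"
    "\<And>a x. a \<in> carrier R \<Longrightarrow> x \<in> H \<Longrightarrow> a \<odot>\<^bsub>M\<^esub> x \<in> H"
    using assms(2) unfolding submodule_iff by auto
  obtain T where T: "finite T" "T \<subseteq> carrier M" "\<And>x. x \<in> carrier M \<Longrightarrow> \<exists>t\<in>T. x \<ominus>\<^bsub>M\<^esub> t \<in> H"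
    using M.finite_index_transversal[OF Hs assms(3)] by blast
  obtain h :: "'m \<Rightarrow> 'm set" where h: "finite (h ` carrier M)"
    "\<And>x y. x \<in> carrier M \<Longrightarrow> y \<in> carrier M \<Longrightarrow> h x = h y \<Longrightarrow> x \<ominus>\<^bsub>M\<^esub> y \<in> H"
    using M.finite_index_separating_map[OF Hs assms(3)] by blast
  define I where "I = {a \<in> carrier R. \<forall>x\<in>carrier M. a \<odot>\<^bsub>M\<^esub> x \<in> H}"
  have ideal: "ideal I R"
  proof (rule idealI[OF R.ring_axioms])
    show "subgroup I (add_monoid R)"
    proof (rule subgroup.intro)
      show "inv\<^bsub>add_monoid R\<^esub> x \<in> I" if "x \<in> I" for x
        using that submodule_minus[OF assms(2)]
        by (auto simp: I_def a_inv_def[symmetric] action.smult_minus_l)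
    qed (auto simp: I_def smult_l_distr H)
  qed (auto simp: I_def smult_assoc H)
  have fin: "finite ((\<lambda>a. \<lambda>t\<in>T. h (a \<odot>\<^bsub>M\<^esub> t)) ` carrier R)"
  proof (rule finite_subset)
    show "(\<lambda>a. \<lambda>t\<in>T. h (a \<odot>\<^bsub>M\<^esub> t)) ` carrier R \<subseteq> T \<rightarrow>\<^sub>E h ` carrier M" using T(2) by auto
    show "finite (T \<rightarrow>\<^sub>E h ` carrier M)" using T(1) h(1) by (simp add: finite_PiE)
  qed
  have "finite (a_rcosets\<^bsub>R\<^esub> I)"
  proof (rule R.finite_indexI[OF _ fin])
    show "subgroup I (add_monoid R)" using ideal by (simp add: ideal_def additive_subgroup.a_subgroup)
    fix a b assume ab: "a \<in> carrier R" "b \<in> carrier R"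
      and eq: "(\<lambda>t\<in>T. h (a \<odot>\<^bsub>M\<^esub> t)) = (\<lambda>t\<in>T. h (b \<odot>\<^bsub>M\<^esub> t))"
    have dl: "(a \<ominus>\<^bsub>R\<^esub> b) \<odot>\<^bsub>M\<^esub> y = a \<odot>\<^bsub>M\<^esub> y \<ominus>\<^bsub>M\<^esub> b \<odot>\<^bsub>M\<^esub> y" if "y \<in> carrier M" for y
      using ab that by (simp add: a_minus_def smult_l_distr action.smult_minus_l)
    have onT: "(a \<ominus>\<^bsub>R\<^esub> b) \<odot>\<^bsub>M\<^esub> t \<in> H" if "t \<in> T" for t
    proof -
      have "h (a \<odot>\<^bsub>M\<^esub> t) = h (b \<odot>\<^bsub>M\<^esub> t)" using fun_cong[OF eq, of t] that by simp
      then show ?thesis using h(2)[of "a \<odot>\<^bsub>M\<^esub> t" "b \<odot>\<^bsub>M\<^esub> t"] T(2) that ab dl by auto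
    qed
    have "(a \<ominus>\<^bsub>R\<^esub> b) \<odot>\<^bsub>M\<^esub> x \<in> H" if x: "x \<in> carrier M" for x
    proof -
      obtain t where t: "t \<in> T" "x \<ominus>\<^bsub>M\<^esub> t \<in> H" using T(3)[OF x] by blast
      have tM: "t \<in> carrier M" using t T(2) by auto
      have "x = (x \<ominus>\<^bsub>M\<^esub> t) \<oplus>\<^bsub>M\<^esub> t" using x tM by (simp add: a_minus_def M.a_assoc M.l_neg)
      then have "(a \<ominus>\<^bsub>R\<^esub> b) \<odot>\<^bsub>M\<^esub> x = (a \<ominus>\<^bsub>R\<^esub> b) \<odot>\<^bsub>M\<^esub> (x \<ominus>\<^bsub>M\<^esub> t) \<oplus>\<^bsub>M\<^esub> (a \<ominus>\<^bsub>R\<^esub> b) \<odot>\<^bsub>M\<^esub> t"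
        using smult_r_distr[of "a \<ominus>\<^bsub>R\<^esub> b" "x \<ominus>\<^bsub>M\<^esub> t" t] ab x tM by simp
      then show ?thesis using H onT t ab by simp
    qed
    then show "a \<ominus>\<^bsub>R\<^esub> b \<in> I" using ab by (simp add: I_def)
  qed
  then have "I \<in> finite_index_ideals R" using ideal by (simp add: finite_index_ideals_def)
  then show ?thesis by (rule that[of I]) (simp add: I_def)
qed

context ring
begin

text \<open>
  Schreier's lemma for rings: \<open>I\<close> is finitely generated as a right ideal.  Let \<open>T\<close> be a finite set of
  representatives modulo \<open>I\<close> and \<open>S\<close> a finite set of ring generators.  The differences by which sums,
  negatives and products \<open>t s\<close> of elements of \<open>T\<close> fail to lie in \<open>T\<close>, together with the elements of
  \<open>T\<close> in \<open>I\<close>, form a finite set \<open>U\<close>.  If a right ideal \<open>J\<close> contains \<open>U\<close>, then \<open>W = T + (I \<inter> J)\<close> is an additive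
  group stable under right multiplication by \<open>S\<close>, hence by \<open>R\<close>; containing \<open>1\<close>, it is all of \<open>R\<close>.  So an
  element of \<open>I\<close> differs by an element of \<open>J\<close> from an element of \<open>T \<inter> I \<subseteq> J\<close>.
\<close>

lemma finite_index_ideal_fg:
  assumes "finitely_generated_ring R" "I \<in> finite_index_ideals R"
  obtains U where "finite U" "U \<subseteq> I"
    "\<And>J. \<lbrakk>U \<subseteq> J; J \<subseteq> carrier R; \<zero> \<in> J; \<And>x y. x \<in> J \<Longrightarrow> y \<in> J \<Longrightarrow> x \<oplus> y \<in> J;
       \<And>x a. x \<in> J \<Longrightarrow> a \<in> carrier R \<Longrightarrow> x \<otimes> a \<in> J\<rbrakk> \<Longrightarrow> I \<subseteq> J"
proof -
  obtain S where S: "finite S" "S \<subseteq> carrier R" "generate_ring R S = carrier R"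
    using assms(1) unfolding finitely_generated_ring_def by auto
  note I = finite_index_idealD[OF assms(2)]
  obtain T where T: "finite T" "T \<subseteq> carrier R" "\<And>x. x \<in> carrier R \<Longrightarrow> \<exists>t\<in>T. x \<ominus> t \<in> I"
    using finite_index_transversal[OF I(4,5)] by blast
  define U where "U = I \<inter> (T \<union> (\<lambda>t. \<one> \<ominus> t) ` T \<union> (\<lambda>(t,t'). \<ominus> t \<ominus> t') ` (T \<times> T) \<union>
     (\<lambda>(t,s,t'). t \<otimes> s \<ominus> t') ` (T \<times> S \<times> T) \<union> (\<lambda>(t,t',t''). t \<oplus> t' \<ominus> t'') ` (T \<times> T \<times> T))"
  show ?thesis
  proof (rule that[of U])
    show "finite U" using S(1) T(1) by (auto simp: U_def)
    show "U \<subseteq> I" by (auto simp: U_def)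
    fix J assume J: "U \<subseteq> J" "J \<subseteq> carrier R" "\<zero> \<in> J" "\<And>x y. x \<in> J \<Longrightarrow> y \<in> J \<Longrightarrow> x \<oplus> y \<in> J"
       "\<And>x a. x \<in> J \<Longrightarrow> a \<in> carrier R \<Longrightarrow> x \<otimes> a \<in> J"
    have Jneg: "\<ominus> x \<in> J" if "x \<in> J" for x
    proof -
      have "x \<otimes> (\<ominus> \<one>) \<in> J" using J(5) that by simp
      moreover have "x \<otimes> (\<ominus> \<one>) = \<ominus> x" using that J(2) by (simp add: r_minus subset_iff)
      ultimately show ?thesis by simp
    qed
    define W where "W = {x \<in> carrier R. \<exists>t\<in>T. x \<ominus> t \<in> I \<inter> J}"
    have WI: "x \<in> W" if "x \<in> carrier R" "y \<in> carrier R" "x \<ominus> y \<in> I \<inter> J" "\<And>t. t \<in> T \<Longrightarrow> y \<ominus> t \<in> I \<Longrightarrow> y \<ominus> t \<in> U" for x y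
    proof -
      note y = that(2)
      obtain t where t: "t \<in> T" "y \<ominus> t \<in> I" using T(3)[OF y] by blast
      have tR: "t \<in> carrier R" using t T by auto
      have "x \<ominus> t = (x \<ominus> y) \<oplus> (y \<ominus> t)"
        using that(1,2) tR by (simp add: a_minus_def a_assoc) (simp add: a_assoc[symmetric] l_neg)
      moreover have "y \<ominus> t \<in> J" using that(4)[OF t] J(1) by auto
      ultimately have "x \<ominus> t \<in> I \<inter> J" using that(3) t J(4) I(6) by auto
      then show ?thesis using that(1) t by (auto simp: W_def)
    qed
    have Wadd: "x \<oplus> y \<in> W" if "x \<in> W" "y \<in> W" for x y
    proof -
      note xy = that
      obtain t t' where t: "t \<in> T" "t' \<in> T" "x \<ominus> t \<in> I \<inter> J" "y \<ominus> t' \<in> I \<inter> J"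
        and xy: "x \<in> carrier R" "y \<in> carrier R" using xy by (auto simp: W_def)
      have tR: "t \<in> carrier R" "t' \<in> carrier R" using t T by auto
      show ?thesis
      proof (rule WI[of _ "t \<oplus> t'"])
        have "(x \<oplus> y) \<ominus> (t \<oplus> t') = (x \<ominus> t) \<oplus> (y \<ominus> t')"
          using xy tR by (simp add: a_minus_def minus_add a_ac)
        then show "(x \<oplus> y) \<ominus> (t \<oplus> t') \<in> I \<inter> J" using t J(4) I(6) by auto
        show "t \<oplus> t' \<ominus> u \<in> U" if "u \<in> T" "t \<oplus> t' \<ominus> u \<in> I" for u
        proof -
          have "t \<oplus> t' \<ominus> u \<in> (\<lambda>(t,t',t''). t \<oplus> t' \<ominus> t'') ` (T \<times> T \<times> T)"
            by (rule image_eqI[of _ _ "(t, t', u)"]) (use t that in auto)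
          then show ?thesis using that unfolding U_def by blast
        qed
      qed (use xy tR in auto)
    qed
    have Wneg: "\<ominus> x \<in> W" if "x \<in> W" for x
    proof -
      note xW = \<open>x \<in> W\<close>
      obtain t where t: "t \<in> T" "x \<ominus> t \<in> I \<inter> J" and x: "x \<in> carrier R" using xW by (auto simp: W_def)
      have tR: "t \<in> carrier R" using t T by auto
      show ?thesis
      proof (rule WI[of _ "\<ominus> t"])
        have "\<ominus> x \<ominus> \<ominus> t = \<ominus> (x \<ominus> t)" using x tR by (simp add: a_minus_def minus_add)
        then show "\<ominus> x \<ominus> \<ominus> t \<in> I \<inter> J" using t Jneg I(7) by auto
        show "\<ominus> t \<ominus> u \<in> U" if "u \<in> T" "\<ominus> t \<ominus> u \<in> I" for u
        proof -
          have "\<ominus> t \<ominus> u \<in> (\<lambda>(t,t'). \<ominus> t \<ominus> t') ` (T \<times> T)"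
            by (rule image_eqI[of _ _ "(t, u)"]) (use t that in auto)
          then show ?thesis using that unfolding U_def by blast
        qed
      qed (use x tR in auto)
    qed
    have Wmult: "x \<otimes> s \<in> W" if "x \<in> W" "s \<in> S" for x s
    proof -
      note xW = \<open>x \<in> W\<close>
      obtain t where t: "t \<in> T" "x \<ominus> t \<in> I \<inter> J" and x: "x \<in> carrier R" using xW by (auto simp: W_def)
      have tR: "t \<in> carrier R" "s \<in> carrier R" using t T S that by auto
      show ?thesis
      proof (rule WI[of _ "t \<otimes> s"])
        have "x \<otimes> s \<ominus> t \<otimes> s = (x \<ominus> t) \<otimes> s" using x tR by (simp add: a_minus_def l_distr l_minus)
        then show "x \<otimes> s \<ominus> t \<otimes> s \<in> I \<inter> J" using t tR J(5) I(9) by auto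
        show "t \<otimes> s \<ominus> u \<in> U" if "u \<in> T" "t \<otimes> s \<ominus> u \<in> I" for u
        proof -
          have "t \<otimes> s \<ominus> u \<in> (\<lambda>(t,s,t'). t \<otimes> s \<ominus> t') ` (T \<times> S \<times> T)"
            by (rule image_eqI[of _ _ "(t, s, u)"]) (use t that \<open>s \<in> S\<close> in auto)
          then show ?thesis using that unfolding U_def by blast
        qed
      qed (use x tR in auto)
    qed
    have W1: "\<one> \<in> W"
    proof (rule WI[of _ "\<one>"])
      show "\<one> \<ominus> \<one> \<in> I \<inter> J" using I(3) J(3) by (simp add: a_minus_def r_neg)
      show "\<one> \<ominus> u \<in> U" if "u \<in> T" "\<one> \<ominus> u \<in> I" for u using that unfolding U_def by blast
    qed auto
    have WR: "W \<subseteq> carrier R" by (auto simp: W_def)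
    have "\<forall>x\<in>W. x \<otimes> a \<in> W" if "a \<in> generate_ring R S" for a
      using that
    proof (induction rule: generate_ring.induct)
      case one then show ?case using WR by (simp add: subset_iff)
    next
      case (incl h) then show ?case using Wmult by simp
    next
      case (a_inv h)
      then have "h \<in> carrier R" using S by simp
      then show ?case using a_inv Wneg WR by (simp add: r_minus subset_iff)
    next
      case (eng_add h1 h2)
      then have "h1 \<in> carrier R" "h2 \<in> carrier R" using S by auto
      then show ?case using eng_add Wadd WR by (simp add: r_distr subset_iff)
    next
      case (eng_mult h1 h2)
      then have "h1 \<in> carrier R" "h2 \<in> carrier R" using S by auto
      then show ?case using eng_mult WR by (simp add: m_assoc[symmetric] subset_iff)
    qed
    then have all: "a \<in> W" if "a \<in> carrier R" for a using W1 that S(3) l_one by metis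
    show "I \<subseteq> J"
    proof
      fix x assume x: "x \<in> I"
      then obtain t where t: "t \<in> T" "x \<ominus> t \<in> I \<inter> J" using all I(2) by (auto simp: W_def)
      have R: "x \<in> carrier R" "t \<in> carrier R" using x t T I(2) by auto
      have "t = x \<ominus> (x \<ominus> t)" using R by (simp add: a_minus_def minus_add a_assoc[symmetric] r_neg)
      then have "t \<in> I" using I(8)[OF x, of "x \<ominus> t"] t by simp
      then have "t \<in> J" using t J(1) by (auto simp: U_def)
      moreover have "x = (x \<ominus> t) \<oplus> t" using R by (simp add: a_minus_def a_assoc l_neg)
      ultimately show "x \<in> J" using t J(4) by (metis IntD2)
    qed
  qed
qed

lemma countable_fg_ring:
  assumes "finitely_generated_ring R" shows "countable (carrier R)"
proof -
  obtain S where S: "finite S" "S \<subseteq> carrier R" "generate_ring R S = carrier R"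
    using assms unfolding finitely_generated_ring_def by auto
  define step where "step X = X \<union> (\<lambda>x. \<ominus> x) ` X \<union> (\<lambda>(x,y). x \<oplus> y) ` (X \<times> X) \<union> (\<lambda>(x,y). x \<otimes> y) ` (X \<times> X)" for X
  define L where "L n = (step ^^ n) (insert \<one> S)" for n
  have step: "countable (step X)" if "countable X" for X
    unfolding step_def using that by (intro countable_Un countable_image countable_SIGMA) auto
  have L: "countable (L n)" for n
  proof (induction n)
    case 0 show ?case using S by (simp add: L_def countable_finite)
  next
    case (Suc n)
    have "L (Suc n) = step (L n)" by (simp add: L_def)
    then show ?case using step[OF Suc] by simp
  qed
  have "L n \<subseteq> L (Suc n)" for n by (auto simp: L_def step_def)
  then have mono: "L m \<subseteq> L n" if "m \<le> n" for m n using that by (rule lift_Suc_mono_le)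
  have lift: "\<exists>n. x \<in> L n \<and> y \<in> L n" if "x \<in> L i" "y \<in> L j" for x y i j
    using that mono[of i "max i j"] mono[of j "max i j"] by (intro exI[of _ "max i j"]) auto
  have "x \<in> (\<Union>n. L n)" if "x \<in> generate_ring R S" for x
    using that
  proof (induction rule: generate_ring.induct)
    case one show ?case by (auto simp: L_def intro!: exI[of _ 0])
  next
    case (incl h) then show ?case by (auto simp: L_def intro!: exI[of _ 0])
  next
    case (a_inv h)
    then obtain n where "h \<in> L n" by auto
    then have "\<ominus> h \<in> L (Suc n)" by (auto simp: L_def step_def)
    then show ?case by blast
  next
    case (eng_add h1 h2)
    then obtain n where "h1 \<in> L n" "h2 \<in> L n" using lift by blast
    then have "h1 \<oplus> h2 \<in> L (Suc n)" by (force simp: L_def step_def)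
    then show ?case by blast
  next
    case (eng_mult h1 h2)
    then obtain n where "h1 \<in> L n" "h2 \<in> L n" using lift by blast
    then have "h1 \<otimes> h2 \<in> L (Suc n)" by (force simp: L_def step_def)
    then show ?case by blast
  qed
  then have "carrier R \<subseteq> (\<Union>n. L n)" using S by auto
  moreover have "countable (\<Union>n. L n)" using L by (intro countable_UN) auto
  ultimately show ?thesis by (rule countable_subset)
qed

text \<open>
  Each such ideal is determined by a finite set of generators, and \<open>R\<close> is countable.
\<close>

lemma countable_finite_index_ideals:
  assumes "finitely_generated_ring R" shows "countable (finite_index_ideals R)"
proof -
  define P where "P I U \<longleftrightarrow> finite U \<and> U \<subseteq> I \<and> (\<forall>J\<in>finite_index_ideals R. U \<subseteq> J \<longrightarrow> I \<subseteq> J)" for I U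
  have ex: "\<exists>U. P I U" if I: "I \<in> finite_index_ideals R" for I
  proof (rule finite_index_ideal_fg[OF assms I])
    fix U assume U: "finite U" "U \<subseteq> I" "\<And>J. \<lbrakk>U \<subseteq> J; J \<subseteq> carrier R; \<zero> \<in> J; \<And>x y. x \<in> J \<Longrightarrow> y \<in> J \<Longrightarrow> x \<oplus> y \<in> J;
       \<And>x a. x \<in> J \<Longrightarrow> a \<in> carrier R \<Longrightarrow> x \<otimes> a \<in> J\<rbrakk> \<Longrightarrow> I \<subseteq> J"
    have "I \<subseteq> J" if "J \<in> finite_index_ideals R" "U \<subseteq> J" for J
      by (rule U(3)[OF that(2)]) (use finite_index_idealD[OF that(1)] in auto)
    then show ?thesis using U(1,2) unfolding P_def by blast
  qed
  define u where "u I = (SOME U. P I U)" for I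
  have u: "P I (u I)" if "I \<in> finite_index_ideals R" for I unfolding u_def by (rule someI_ex[OF ex[OF that]])
  have "inj_on u (finite_index_ideals R)"
  proof (rule inj_onI)
    fix I J assume IJ: "I \<in> finite_index_ideals R" "J \<in> finite_index_ideals R" "u I = u J"
    have "I \<subseteq> J" using u[OF IJ(1)] u[OF IJ(2)] IJ by (auto simp: P_def)
    moreover have "J \<subseteq> I" using u[OF IJ(1)] u[OF IJ(2)] IJ by (auto simp: P_def)
    ultimately show "I = J" by auto
  qed
  moreover have "u ` finite_index_ideals R \<subseteq> {A. A \<subseteq> carrier R \<and> finite A}"
  proof (intro image_subsetI CollectI conjI)
    fix I assume I: "I \<in> finite_index_ideals R"
    show "u I \<subseteq> carrier R" using u[OF I] finite_index_idealD(2)[OF I] by (auto simp: P_def)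
    show "finite (u I)" using u[OF I] by (simp add: P_def)
  qed
  moreover have "countable {A. A \<subseteq> carrier R \<and> finite A}"
    using countable_Collect_finite_subset[OF countable_fg_ring[OF assms]] by (simp add: conj_commute)
  ultimately show ?thesis by (metis countable_image_inj_on countable_subset)
qed

lemma finite_index_ideal_chain:
  assumes "finitely_generated_ring R"
  obtains C :: "nat \<Rightarrow> 'a set" where "\<And>n. C n \<in> finite_index_ideals R" "\<And>m n. m \<le> n \<Longrightarrow> C n \<subseteq> C m"
    "\<And>I. I \<in> finite_index_ideals R \<Longrightarrow> \<exists>n. C n \<subseteq> I"
proof -
  have ne: "finite_index_ideals R \<noteq> {}" using carrier_finite_index by auto
  define e where "e = from_nat_into (finite_index_ideals R)"
  have e: "e n \<in> finite_index_ideals R" for n unfolding e_def by (rule from_nat_into[OF ne])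
  have es: "\<exists>n. e n = I" if "I \<in> finite_index_ideals R" for I
    unfolding e_def using from_nat_into_surj[OF countable_finite_index_ideals[OF assms] that] .
  define C where "C n = (\<Inter>j\<le>n. e j)" for n
  show ?thesis
  proof (rule that[of C])
    show "C n \<in> finite_index_ideals R" for n
    proof (induction n)
      case 0 show ?case using e by (simp add: C_def)
    next
      case (Suc n)
      have "C (Suc n) = e (Suc n) \<inter> C n" by (auto simp: C_def atMost_Suc)
      then show ?case using e Suc finite_index_ideal_Int by simp
    qed
    show "C n \<subseteq> C m" if "m \<le> n" for m n using that by (force simp: C_def)
    show "\<exists>n. C n \<subseteq> I" if "I \<in> finite_index_ideals R" for I
      using es[OF that] by (auto simp: C_def)
  qed
qed

end

section \<open>Finitely generated submodules are closed in the profinite topology\<close>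

lemma (in right_module_hom) hom_diff_kernel:
  assumes "x \<in> carrier M" "k \<in> carrier M" "h k = \<zero>\<^bsub>N\<^esub>" shows "h (x \<ominus>\<^bsub>M\<^esub> k) = h x"
  using assms cod.M.minus_equality[of "\<zero>\<^bsub>N\<^esub>" "\<zero>\<^bsub>N\<^esub>"]
  by (simp add: a_minus_def hom_add hom_minus)

lemma (in ring) countable_free_rank:
  assumes "countable (carrier R)" shows "countable (carrier (free_rank R n))"
proof (rule countable_image_inj_on)
  have "(\<lambda>f. map f [0..<n]) ` carrier (free_rank R n) \<subseteq> lists (carrier R)"
    unfolding free_rank_simps by (intro image_subsetI) (auto simp: PiE_iff)
  then show "countable ((\<lambda>f. map f [0..<n]) ` carrier (free_rank R n))"
    using countable_lists[OF assms] by (rule countable_subset)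
  show "inj_on (\<lambda>f. map f [0..<n]) (carrier (free_rank R n))"
  proof (rule inj_onI)
    fix f g assume "f \<in> carrier (free_rank R n)" "g \<in> carrier (free_rank R n)" "map f [0..<n] = map g [0..<n]"
    then show "f = g" unfolding free_rank_simps
      by (intro PiE_ext[of f "{..<n}" "\<lambda>_. carrier R"]) (auto simp: PiE_iff)
  qed
qed

text \<open>
  The quotient \<open>R\<^sup>n/K\<close> is finitely presented, hence residually finite, so some submodule of finite
  index of the quotient avoids the class of \<open>x\<close>.  The ideal \<open>I\<close> of scalars that map the quotient into
  it does the job: an element congruent modulo \<open>I\<close> to an element of \<open>K\<close> has its class there.
\<close>

lemma fg_submodule_closed:
  fixes R :: "('a, 'r) ring_scheme"
  assumes "ring R" "countable (carrier R)" "infinite (UNIV :: 'u set)"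
    and resid: "\<forall>M :: ('a, 'u) module. finitely_presented_right_module R M \<longrightarrow> residually_finite_module R M"
    and K: "fg_submodule R (free_rank R n) K" and x: "x \<in> carrier (free_rank R n)" "x \<notin> K"
  shows "\<exists>I\<in>finite_index_ideals R. \<forall>k\<in>K. \<not> (\<forall>i<n. x i \<ominus>\<^bsub>R\<^esub> k i \<in> I)"
proof -
  interpret ring R by fact
  let ?F = "free_rank R n"
  have rF: "right_module R ?F" by (rule right_module_free_rank)
  interpret F: right_module R ?F by (rule rF)
  have Ksub: "submodule K R ?F" using K by (simp add: fg_submodule_def)
  then have KF: "K \<subseteq> carrier ?F" by (simp add: F.submodule_iff)
  obtain q :: "(nat \<Rightarrow> 'a) \<Rightarrow> 'u" where
    q: "\<forall>x\<in>carrier ?F. \<forall>y\<in>carrier ?F. q x = q y \<longleftrightarrow> x \<ominus>\<^bsub>?F\<^esub> y \<in> K"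
    using exists_quotient_map[OF rF Ksub countable_free_rank[OF assms(2)] assms(3)] .
  let ?Q = "image_module ?F q"
  note Q = image_module[OF rF Ksub q]
  interpret q: right_module_hom R ?F ?Q q
    by (rule right_module_hom.intro[OF rF Q(1)]) (unfold_locales, rule Q(2))
  have "residually_finite_module R ?Q"
    using resid finitely_presented_quotient[OF assms(1) K q] by simp
  then have int: "\<Inter>{N. submodule N R ?Q \<and> finite (a_rcosets\<^bsub>?Q\<^esub> N)} = {\<zero>\<^bsub>?Q\<^esub>}"
    by (simp add: residually_finite_module_def)
  have ker: "k \<in> K \<longleftrightarrow> k \<in> carrier ?F \<and> q k = \<zero>\<^bsub>?Q\<^esub>" for k
    using Q(4) q.kernel_eq by blast
  have "q x \<noteq> \<zero>\<^bsub>?Q\<^esub>" using ker x by simp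
  then have "q x \<notin> \<Inter>{N. submodule N R ?Q \<and> finite (a_rcosets\<^bsub>?Q\<^esub> N)}" unfolding int by simp
  then obtain H where H: "submodule H R ?Q" "finite (a_rcosets\<^bsub>?Q\<^esub> H)" "q x \<notin> H" by blast
  obtain I where I: "I \<in> finite_index_ideals R" "\<And>a u. a \<in> I \<Longrightarrow> u \<in> carrier ?Q \<Longrightarrow> a \<odot>\<^bsub>?Q\<^esub> u \<in> H"
    using annihilator_finite_index[OF Q(1) H(1,2)] by blast
  show ?thesis
  proof (rule bexI[OF _ I(1)], intro ballI notI)
    fix k assume k: "k \<in> K" and close: "\<forall>i<n. x i \<ominus>\<^bsub>R\<^esub> k i \<in> I"
    have kF: "k \<in> carrier ?F" "q k = \<zero>\<^bsub>?Q\<^esub>" using k ker by auto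
    let ?d = "x \<ominus>\<^bsub>?F\<^esub> k"
    have d: "?d \<in> carrier ?F" using x kF by simp
    have "q ?d = (\<Oplus>\<^bsub>?Q\<^esub>i\<in>{..<n}. ?d i \<odot>\<^bsub>?Q\<^esub> q (unit_vec R n i))"
      by (rule hom_free_rank_expansion[OF Q(1,2) d])
    also have "\<dots> \<in> H"
    proof (rule q.cod.submodule_finsum[OF H(1)])
      fix i assume "i \<in> {..<n}"
      then have "?d i \<in> I" using close x kF by (simp add: free_rank_diff)
      then show "?d i \<odot>\<^bsub>?Q\<^esub> q (unit_vec R n i) \<in> H" by (rule I(2)) simp
    qed simp
    finally have "q ?d \<in> H" .
    moreover have "q x = q ?d"
      by (rule q.hom_diff_kernel[OF x(1) kF, symmetric])
    ultimately show False using H(3) by simp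
  qed
qed

text \<open>
  The multiples of the unit vectors by generators of the right ideal \<open>I\<close> generate \<open>I\<^sup>p\<close>.
\<close>

lemma (in ring) fg_submodule_ideal_power:
  assumes "finitely_generated_ring R" "I \<in> finite_index_ideals R"
  shows "fg_submodule R (free_rank R p) {c \<in> carrier (free_rank R p). \<forall>i<p. c i \<in> I}"
    (is "fg_submodule R ?F ?Ip")
proof -
  interpret F: right_module R ?F by (rule right_module_free_rank)
  note I = finite_index_idealD[OF assms(2)]
  obtain U where U: "finite U" "U \<subseteq> I"
    "\<And>J. \<lbrakk>U \<subseteq> J; J \<subseteq> carrier R; \<zero> \<in> J; \<And>x y. x \<in> J \<Longrightarrow> y \<in> J \<Longrightarrow> x \<oplus> y \<in> J;
       \<And>x a. x \<in> J \<Longrightarrow> a \<in> carrier R \<Longrightarrow> x \<otimes> a \<in> J\<rbrakk> \<Longrightarrow> I \<subseteq> J"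
    using finite_index_ideal_fg[OF assms] by blast
  have sub: "submodule ?Ip R ?F"
    unfolding F.submodule_iff using I by (auto simp: free_rank_simps)
  let ?S = "(\<lambda>(i,u). u \<odot>\<^bsub>?F\<^esub> unit_vec R p i) ` ({..<p} \<times> U)"
  show ?thesis unfolding fg_submodule_def
  proof (intro conjI exI[of _ ?S] allI impI)
    show "?S \<subseteq> ?Ip"
    proof (rule image_subsetI)
      fix z assume "z \<in> {..<p} \<times> U"
      then obtain i u where z: "z = (i, u)" and iu: "i \<in> {..<p}" "u \<in> U" by auto
      then have u: "u \<in> I" "u \<in> carrier R" using U I(2) by auto
      have "(u \<odot>\<^bsub>?F\<^esub> unit_vec R p i) j \<in> I" if "j < p" for j
        using that u I(3) by (simp add: free_rank_simps unit_vec_def)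
      then show "(case z of (i, u) \<Rightarrow> u \<odot>\<^bsub>?F\<^esub> unit_vec R p i) \<in> ?Ip"
        using u z by simp
    qed
    fix L assume L: "submodule L R ?F" "?S \<subseteq> L"
    have unit: "a \<odot>\<^bsub>?F\<^esub> unit_vec R p i \<in> L" if "i < p" "a \<in> I" for i a
    proof -
      let ?J = "{a \<in> carrier R. a \<odot>\<^bsub>?F\<^esub> unit_vec R p i \<in> L}"
      have "I \<subseteq> ?J"
      proof (rule U(3))
        show "U \<subseteq> ?J" using U(2) I(2) L(2) that(1) by auto
        show "\<zero> \<in> ?J" using L(1) by (simp add: F.submodule_iff)
        show "x \<oplus> y \<in> ?J" if "x \<in> ?J" "y \<in> ?J" for x y
          using that L(1) by (simp add: F.submodule_iff F.smult_l_distr)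
        show "x \<otimes> b \<in> ?J" if "x \<in> ?J" "b \<in> carrier R" for x b
          using that L(1) by (simp add: F.submodule_iff F.smult_assoc)
      qed auto
      then show ?thesis using that(2) by auto
    qed
    show "?Ip \<subseteq> L"
    proof
      fix c assume c: "c \<in> ?Ip"
      have "(\<Oplus>\<^bsub>?F\<^esub>i\<in>{..<p}. c i \<odot>\<^bsub>?F\<^esub> unit_vec R p i) \<in> L"
        by (rule F.submodule_finsum[OF L(1)]) (use c unit in auto)
      then show "c \<in> L" using unit_vec_expansion[of c p] c by simp
    qed
  qed (use U(1) sub in auto)
qed

text \<open>
  Artin--Rees property: \<open>g(R\<^sup>p) \<inter> J\<^sup>k \<subseteq> g(I\<^sup>p)\<close>.  The submodule \<open>H = g(I\<^sup>p)\<close> is finitely generated, hence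
  closed, and the image of \<open>g\<close> consists of finitely many cosets of \<open>H\<close>.  Each coset other than \<open>H\<close> is
  kept away from \<open>H\<close> by an ideal of finite index, and \<open>J\<close> lies in all of these ideals.
\<close>

lemma artin_rees:
  fixes R :: "('a, 'r) ring_scheme"
  assumes "ring R" "finitely_generated_ring R" "infinite (UNIV :: 'u set)"
    and resid: "\<forall>M :: ('a, 'u) module. finitely_presented_right_module R M \<longrightarrow> residually_finite_module R M"
    and g: "g \<in> rmodule_hom R (free_rank R p) (free_rank R k)" and I: "I \<in> finite_index_ideals R"
  shows "\<exists>J\<in>finite_index_ideals R. J \<subseteq> I \<and> (\<forall>c\<in>carrier (free_rank R p). (\<forall>i<k. g c i \<in> J) \<longrightarrow>
      (\<exists>c'\<in>carrier (free_rank R p). (\<forall>i<p. c' i \<in> I) \<and> g c' = g c))"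
proof -
  interpret ring R by fact
  let ?P = "free_rank R p" and ?K = "free_rank R k"
  interpret g: right_module_hom R ?P ?K g
    by (rule right_module_hom.intro[OF right_module_free_rank right_module_free_rank]) (unfold_locales, rule g)
  note I' = finite_index_idealD[OF I]
  let ?Ip = "{c \<in> carrier ?P. \<forall>i<p. c i \<in> I}"
  define H where "H = g ` ?Ip"
  have Hfg: "fg_submodule R ?K H"
    unfolding H_def by (rule g.fg_submodule_image[OF fg_submodule_ideal_power[OF assms(2) I]])
  then have Hsub: "submodule H R ?K" by (simp add: fg_submodule_def)
  obtain T where T: "finite T" "T \<subseteq> carrier R" "\<And>x. x \<in> carrier R \<Longrightarrow> \<exists>t\<in>T. x \<ominus>\<^bsub>R\<^esub> t \<in> I"
    using finite_index_transversal[OF I'(4,5)] by blast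
  define B where "B = {t \<in> {..<p} \<rightarrow>\<^sub>E T. g t \<notin> H}"
  have finB: "finite B" using T(1) unfolding B_def by (simp add: finite_PiE)
  have TP: "t \<in> carrier ?P" if "t \<in> {..<p} \<rightarrow>\<^sub>E T" for t using that T(2) by (auto simp: free_rank_simps)
  have "\<forall>t\<in>B. \<exists>J\<in>finite_index_ideals R. \<forall>h\<in>H. \<not> (\<forall>i<k. g t i \<ominus>\<^bsub>R\<^esub> h i \<in> J)"
  proof
    fix t assume "t \<in> B"
    then show "\<exists>J\<in>finite_index_ideals R. \<forall>h\<in>H. \<not> (\<forall>i<k. g t i \<ominus>\<^bsub>R\<^esub> h i \<in> J)"
      using TP by (intro fg_submodule_closed[OF assms(1) countable_fg_ring[OF assms(2)] assms(3) resid Hfg])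
        (auto simp: B_def)
  qed
  then obtain J where J: "\<And>t. t \<in> B \<Longrightarrow> J t \<in> finite_index_ideals R"
    "\<And>t h. t \<in> B \<Longrightarrow> h \<in> H \<Longrightarrow> \<not> (\<forall>i<k. g t i \<ominus>\<^bsub>R\<^esub> h i \<in> J t)" by metis
  obtain J0 where J0: "J0 \<in> finite_index_ideals R" "\<And>t. t \<in> B \<Longrightarrow> J0 \<subseteq> J t"
    using finite_index_ideal_below[OF finB, of J] J(1) by blast
  show ?thesis
  proof (intro bexI[of _ "J0 \<inter> I"] conjI ballI impI)
    show "J0 \<inter> I \<in> finite_index_ideals R" by (rule finite_index_ideal_Int[OF J0(1) I])
    fix c assume c: "c \<in> carrier ?P" and gc: "\<forall>i<k. g c i \<in> J0 \<inter> I"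
    have cR: "c i \<in> carrier R" if "i < p" for i using c that by (auto simp: free_rank_simps)
    define t where "t = (\<lambda>i\<in>{..<p}. SOME t. t \<in> T \<and> c i \<ominus>\<^bsub>R\<^esub> t \<in> I)"
    have t: "t i \<in> T \<and> c i \<ominus>\<^bsub>R\<^esub> t i \<in> I" if "i < p" for i
    proof -
      have "\<exists>t. t \<in> T \<and> c i \<ominus>\<^bsub>R\<^esub> t \<in> I" using T(3)[OF cR[OF that]] by blast
      from someI_ex[OF this] show ?thesis using that by (simp add: t_def)
    qed
    have tT: "t \<in> {..<p} \<rightarrow>\<^sub>E T" using t by (auto simp: t_def)
    note tP = TP[OF tT]
    let ?d = "c \<ominus>\<^bsub>?P\<^esub> t"
    have dc: "?d \<in> carrier ?P" using c tP by simp
    have d: "?d \<in> ?Ip" using dc t free_rank_diff[OF c tP] by simp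
    have gd: "g ?d \<in> H" using d by (simp add: H_def)
    have gdd: "g ?d = g c \<ominus>\<^bsub>?K\<^esub> g t" using c tP by (rule g.hom_diff)
    \<comment> \<open>Modulo \<open>H\<close> the element \<open>g c\<close> agrees with \<open>g t\<close>, so \<open>g t\<close> is close to \<open>H\<close> and hence lies in it.\<close>
    have "t \<notin> B"
    proof
      assume tB: "t \<in> B"
      have "\<ominus>\<^bsub>?K\<^esub> g ?d \<in> H" by (rule g.cod.submodule_minus[OF Hsub gd])
      moreover have "g t i \<ominus>\<^bsub>R\<^esub> (\<ominus>\<^bsub>?K\<^esub> g ?d) i \<in> J t" if i: "i < k" for i
      proof -
        have R: "g c i \<in> carrier R" "g t i \<in> carrier R"
          using g.hom_closed[OF c] g.hom_closed[OF tP] i by (auto simp: free_rank_simps)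
        have "(\<ominus>\<^bsub>?K\<^esub> g ?d) i = \<ominus>\<^bsub>R\<^esub> (g c i \<ominus>\<^bsub>R\<^esub> g t i)"
          using fun_cong[OF free_rank_minus[OF g.hom_closed[OF dc]], of i]
            fun_cong[OF free_rank_diff[OF g.hom_closed[OF c] g.hom_closed[OF tP]], of i] i
          unfolding gdd by simp
        then have "g t i \<ominus>\<^bsub>R\<^esub> (\<ominus>\<^bsub>?K\<^esub> g ?d) i = g c i"
          using R by (simp add: a_minus_def a_ac r_neg)
        then show ?thesis using gc i J0(2)[OF tB] by auto
      qed
      ultimately show False using J(2)[OF tB] by blast
    qed
    then have "g t \<in> H" using tT by (auto simp: B_def)
    then have "g ?d \<oplus>\<^bsub>?K\<^esub> g t \<in> H" using gd Hsub unfolding g.cod.submodule_iff by blast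
    moreover have "g ?d \<oplus>\<^bsub>?K\<^esub> g t = g c"
      using c tP unfolding gdd by (simp add: a_minus_def g.cod.M.a_assoc g.cod.M.l_neg)
    ultimately have "g c \<in> g ` ?Ip" by (simp add: H_def)
    then show "\<exists>c'\<in>carrier ?P. (\<forall>i<p. c' i \<in> I) \<and> g c' = g c" by (auto simp: image_iff)
  qed auto
qed

section \<open>The profinite completion\<close>

context ring
begin

lemma profinite_simps:
  assumes "I \<in> finite_index_ideals R"
  shows "(\<zero>\<^bsub>profinite_completion R\<^esub>) I = I"
    "(x \<oplus>\<^bsub>profinite_completion R\<^esub> y) I = x I <+>\<^bsub>R\<^esub> y I"
    "(a \<odot>\<^bsub>profinite_completion R\<^esub> x) I = rcoset_mult R I (I +> a) (x I)"
  using assms by (auto simp: profinite_completion_def FactRing_def)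

lemma coset_eq_iff:
  assumes "I \<in> finite_index_ideals R" "a \<in> carrier R" "b \<in> carrier R"
  shows "I +> a = I +> b \<longleftrightarrow> a \<ominus> b \<in> I"
  using quotient_eq_iff_same_a_r_cos[OF finite_index_idealD(1)[OF assms(1)] assms(2,3)] by simp

lemma coset_transition:
  assumes "I \<in> finite_index_ideals R" "J \<in> finite_index_ideals R" "I \<subseteq> J" "a \<in> carrier R"
  shows "(I +> a) <+>\<^bsub>R\<^esub> J = J +> a"
proof -
  note I = finite_index_idealD[OF assms(1)] and J = finite_index_idealD[OF assms(2)]
  show ?thesis
  proof
    show "(I +> a) <+>\<^bsub>R\<^esub> J \<subseteq> J +> a"
    proof
      fix z assume "z \<in> (I +> a) <+>\<^bsub>R\<^esub> J"
      then obtain i j where ij: "i \<in> I" "j \<in> J" "z = (i \<oplus> a) \<oplus> j" by (auto simp: set_add_def' a_r_coset_def')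
      then have "z = (i \<oplus> j) \<oplus> a" using assms(4) I(2) J(2) by (simp add: a_ac subset_iff)
      moreover have "i \<oplus> j \<in> J" using ij assms(3) J(6) by auto
      ultimately show "z \<in> J +> a" by (auto simp: a_r_coset_def')
    qed
    show "J +> a \<subseteq> (I +> a) <+>\<^bsub>R\<^esub> J"
    proof
      fix z assume "z \<in> J +> a"
      then obtain j where j: "j \<in> J" "z = j \<oplus> a" by (auto simp: a_r_coset_def')
      then have "z = (\<zero> \<oplus> a) \<oplus> j" using assms(4) J(2) by (simp add: a_comm subset_iff)
      then show "z \<in> (I +> a) <+>\<^bsub>R\<^esub> J" using j I(3) by (auto simp: set_add_def' a_r_coset_def')
    qed
  qed
qed

text \<open>
  Compatibility of a family of cosets, expressed by representatives: an element that represents the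
  family modulo \<open>I\<close> also represents it modulo each larger ideal.
\<close>

lemma profinite_iff:
  "x \<in> carrier (profinite_completion R) \<longleftrightarrow> x \<in> extensional (finite_index_ideals R) \<and>
    (\<forall>I\<in>finite_index_ideals R. \<exists>a\<in>carrier R. x I = I +> a \<and>
       (\<forall>J\<in>finite_index_ideals R. I \<subseteq> J \<longrightarrow> x J = J +> a))" (is "_ \<longleftrightarrow> ?r")
proof
  assume "x \<in> carrier (profinite_completion R)"
  then have x: "x \<in> (\<Pi>\<^sub>E I\<in>finite_index_ideals R. a_rcosets I)"
    and c: "\<And>I J. I \<in> finite_index_ideals R \<Longrightarrow> J \<in> finite_index_ideals R \<Longrightarrow> I \<subseteq> J \<Longrightarrow> x I <+>\<^bsub>R\<^esub> J = x J"
    by (auto simp: profinite_completion_def FactRing_def)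
  show ?r
  proof (intro conjI ballI)
    show "x \<in> extensional (finite_index_ideals R)" using x by (auto simp: PiE_def)
    fix I assume I: "I \<in> finite_index_ideals R"
    then have "x I \<in> a_rcosets I" using x by auto
    then obtain a where a: "a \<in> carrier R" "x I = I +> a" by (auto simp: A_RCOSETS_def')
    have "x J = J +> a" if "J \<in> finite_index_ideals R" "I \<subseteq> J" for J
      using c[OF I that] coset_transition[OF I that a(1)] a(2) by simp
    then show "\<exists>a\<in>carrier R. x I = I +> a \<and> (\<forall>J\<in>finite_index_ideals R. I \<subseteq> J \<longrightarrow> x J = J +> a)"
      using a by blast
  qed
next
  assume r: ?r
  have "x I \<in> a_rcosets I" if "I \<in> finite_index_ideals R" for I
  proof -
    have "\<exists>a\<in>carrier R. x I = I +> a" using r that by metis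
    then show ?thesis by (auto simp: A_RCOSETS_def')
  qed
  moreover have "x I <+>\<^bsub>R\<^esub> J = x J" if IJ: "I \<in> finite_index_ideals R" "J \<in> finite_index_ideals R" "I \<subseteq> J" for I J
  proof -
    have "\<exists>a\<in>carrier R. x I = I +> a \<and> x J = J +> a" using r IJ by metis
    then show ?thesis using coset_transition[OF IJ] by auto
  qed
  ultimately show "x \<in> carrier (profinite_completion R)"
    using r by (auto simp: profinite_completion_def FactRing_def PiE_def)
qed

lemma profinite_rep:
  assumes "x \<in> carrier (profinite_completion R)" "I \<in> finite_index_ideals R"
  shows "\<exists>a\<in>carrier R. x I = I +> a \<and> (\<forall>J\<in>finite_index_ideals R. I \<subseteq> J \<longrightarrow> x J = J +> a)"
  using assms unfolding profinite_iff by simp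

lemma profinite_mono:
  assumes "x \<in> carrier (profinite_completion R)" "I \<in> finite_index_ideals R" "J \<in> finite_index_ideals R" "I \<subseteq> J"
    and "a \<in> carrier R" "x I = I +> a"
  shows "x J = J +> a"
proof -
  obtain b where b: "b \<in> carrier R" "x I = I +> b" "x J = J +> b" using profinite_rep[OF assms(1,2)] assms(3,4) by metis
  then have "a \<ominus> b \<in> J" using coset_eq_iff[OF assms(2,5)] assms(4,6) by auto
  then show ?thesis using coset_eq_iff[OF assms(3,5) b(1)] b by simp
qed

lemma coset_add:
  "I \<in> finite_index_ideals R \<Longrightarrow> a \<in> carrier R \<Longrightarrow> b \<in> carrier R \<Longrightarrow> (I +> a) <+>\<^bsub>R\<^esub> (I +> b) = I +> (a \<oplus> b)"
  using finite_index_idealD(1)[THEN ideal.axioms(1), THEN abelian_subgroupI3, OF _ abelian_group_axioms]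
  by (simp add: abelian_subgroup.a_rcos_sum)

lemma coset_mult:
  "I \<in> finite_index_ideals R \<Longrightarrow> a \<in> carrier R \<Longrightarrow> b \<in> carrier R \<Longrightarrow> rcoset_mult R I (I +> a) (I +> b) = I +> (a \<otimes> b)"
  by (simp add: ideal.rcoset_mult_add finite_index_idealD(1))

lemma coset_zero: "I \<in> finite_index_ideals R \<Longrightarrow> I +> \<zero> = I"
  using finite_index_idealD(2)[of I] by (auto simp: a_r_coset_def' subset_iff)

lemma profinite_add_rep:
  assumes "I \<in> finite_index_ideals R" "a \<in> carrier R" "b \<in> carrier R" "x I = I +> a" "y I = I +> b"
  shows "(x \<oplus>\<^bsub>profinite_completion R\<^esub> y) I = I +> (a \<oplus> b)"
  using assms by (simp add: profinite_simps coset_add)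

lemma profinite_smult_rep:
  assumes "I \<in> finite_index_ideals R" "a \<in> carrier R" "b \<in> carrier R" "x I = I +> b"
  shows "(a \<odot>\<^bsub>profinite_completion R\<^esub> x) I = I +> (a \<otimes> b)"
  using assms by (simp add: profinite_simps coset_mult)

lemma profinite_zero_rep:
  assumes "I \<in> finite_index_ideals R" shows "(\<zero>\<^bsub>profinite_completion R\<^esub>) I = I +> \<zero>"
  using assms by (simp add: profinite_simps coset_zero)

lemma profinite_eqI:
  assumes "x \<in> carrier (profinite_completion R)" "y \<in> carrier (profinite_completion R)"
    "\<And>I. I \<in> finite_index_ideals R \<Longrightarrow> x I = y I"
  shows "x = y"
  using assms unfolding profinite_iff by (auto intro: extensionalityI)

lemma left_module_profinite: "left_module R (profinite_completion R)"
proof -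
  let ?L = "profinite_completion R"
  have ext: "\<zero>\<^bsub>?L\<^esub> \<in> extensional (finite_index_ideals R)" "x \<oplus>\<^bsub>?L\<^esub> y \<in> extensional (finite_index_ideals R)"
    "a \<odot>\<^bsub>?L\<^esub> x \<in> extensional (finite_index_ideals R)" for x y a
    by (auto simp: profinite_completion_def)
  have add: "x \<oplus>\<^bsub>?L\<^esub> y \<in> carrier ?L" if x: "x \<in> carrier ?L" and y: "y \<in> carrier ?L" for x y
    unfolding profinite_iff
  proof (intro conjI ballI ext)
    fix I assume I: "I \<in> finite_index_ideals R"
    obtain a where a: "a \<in> carrier R" "x I = I +> a" "\<forall>J\<in>finite_index_ideals R. I \<subseteq> J \<longrightarrow> x J = J +> a"
      using profinite_rep[OF x I] by auto
    obtain b where b: "b \<in> carrier R" "y I = I +> b" "\<forall>J\<in>finite_index_ideals R. I \<subseteq> J \<longrightarrow> y J = J +> b"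
      using profinite_rep[OF y I] by auto
    show "\<exists>a\<in>carrier R. (x \<oplus>\<^bsub>?L\<^esub> y) I = I +> a \<and> (\<forall>J\<in>finite_index_ideals R. I \<subseteq> J \<longrightarrow> (x \<oplus>\<^bsub>?L\<^esub> y) J = J +> a)"
      using a b I by (intro bexI[of _ "a \<oplus> b"]) (simp_all add: profinite_add_rep)
  qed
  have smult: "r \<odot>\<^bsub>?L\<^esub> x \<in> carrier ?L" if r: "r \<in> carrier R" and x: "x \<in> carrier ?L" for r x
    unfolding profinite_iff
  proof (intro conjI ballI ext)
    fix I assume I: "I \<in> finite_index_ideals R"
    obtain a where a: "a \<in> carrier R" "x I = I +> a" "\<forall>J\<in>finite_index_ideals R. I \<subseteq> J \<longrightarrow> x J = J +> a"
      using profinite_rep[OF x I] by auto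
    show "\<exists>a\<in>carrier R. (r \<odot>\<^bsub>?L\<^esub> x) I = I +> a \<and> (\<forall>J\<in>finite_index_ideals R. I \<subseteq> J \<longrightarrow> (r \<odot>\<^bsub>?L\<^esub> x) J = J +> a)"
      using a r I by (intro bexI[of _ "r \<otimes> a"]) (simp_all add: profinite_smult_rep)
  qed
  have zero: "\<zero>\<^bsub>?L\<^esub> \<in> carrier ?L"
    unfolding profinite_iff using ext(1) profinite_zero_rep by auto
  \<comment> \<open>Every identity between elements can be checked on representatives.\<close>
  have rep: "\<exists>a\<in>carrier R. x I = I +> a" if "x \<in> carrier ?L" "I \<in> finite_index_ideals R" for x I
    using profinite_rep[OF that] by metis
  have ag: "abelian_group ?L"
  proof (rule abelian_groupI)
    fix x y z assume x: "x \<in> carrier ?L" and y: "y \<in> carrier ?L" and z: "z \<in> carrier ?L"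
    show "x \<oplus>\<^bsub>?L\<^esub> y \<oplus>\<^bsub>?L\<^esub> z = x \<oplus>\<^bsub>?L\<^esub> (y \<oplus>\<^bsub>?L\<^esub> z)"
    proof (rule profinite_eqI)
      fix I assume I: "I \<in> finite_index_ideals R"
      obtain a b c where "a \<in> carrier R" "x I = I +> a" "b \<in> carrier R" "y I = I +> b" "c \<in> carrier R" "z I = I +> c"
        using rep[OF x I] rep[OF y I] rep[OF z I] by blast
      then show "(x \<oplus>\<^bsub>?L\<^esub> y \<oplus>\<^bsub>?L\<^esub> z) I = (x \<oplus>\<^bsub>?L\<^esub> (y \<oplus>\<^bsub>?L\<^esub> z)) I"
        using I by (simp add: profinite_simps coset_add a_assoc)
    qed (use x y z add in auto)
    show "x \<oplus>\<^bsub>?L\<^esub> y = y \<oplus>\<^bsub>?L\<^esub> x"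
    proof (rule profinite_eqI)
      fix I assume I: "I \<in> finite_index_ideals R"
      obtain a b where "a \<in> carrier R" "x I = I +> a" "b \<in> carrier R" "y I = I +> b"
        using rep[OF x I] rep[OF y I] by blast
      then show "(x \<oplus>\<^bsub>?L\<^esub> y) I = (y \<oplus>\<^bsub>?L\<^esub> x) I"
        using I by (simp add: profinite_simps coset_add a_comm)
    qed (use x y add in auto)
    show "\<zero>\<^bsub>?L\<^esub> \<oplus>\<^bsub>?L\<^esub> x = x"
    proof (rule profinite_eqI)
      fix I assume I: "I \<in> finite_index_ideals R"
      obtain a where "a \<in> carrier R" "x I = I +> a" using rep[OF x I] by blast
      then show "(\<zero>\<^bsub>?L\<^esub> \<oplus>\<^bsub>?L\<^esub> x) I = x I"
        using I by (subst profinite_add_rep[of I \<zero> a]) (simp_all add: profinite_zero_rep)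
    qed (use x zero add in auto)
    show "\<exists>y\<in>carrier ?L. y \<oplus>\<^bsub>?L\<^esub> x = \<zero>\<^bsub>?L\<^esub>"
    proof (rule bexI[of _ "(\<ominus> \<one>) \<odot>\<^bsub>?L\<^esub> x"])
      show "(\<ominus> \<one>) \<odot>\<^bsub>?L\<^esub> x \<oplus>\<^bsub>?L\<^esub> x = \<zero>\<^bsub>?L\<^esub>"
      proof (rule profinite_eqI)
        fix I assume I: "I \<in> finite_index_ideals R"
        obtain a where a: "a \<in> carrier R" "x I = I +> a" using rep[OF x I] by blast
        have "((\<ominus> \<one>) \<odot>\<^bsub>?L\<^esub> x \<oplus>\<^bsub>?L\<^esub> x) I = I +> ((\<ominus> \<one>) \<otimes> a \<oplus> a)"
          using a I by (intro profinite_add_rep profinite_smult_rep) auto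
        then show "((\<ominus> \<one>) \<odot>\<^bsub>?L\<^esub> x \<oplus>\<^bsub>?L\<^esub> x) I = (\<zero>\<^bsub>?L\<^esub>) I"
          using a I by (simp add: l_minus l_neg profinite_zero_rep)
      qed (use x smult add zero in auto)
    qed (use x smult in auto)
  qed (use add zero in auto)
  show ?thesis
  proof (rule left_module.intro[OF ring_axioms ag], unfold_locales)
    fix r x assume r: "r \<in> carrier R" and x: "x \<in> carrier ?L"
    show "r \<odot>\<^bsub>?L\<^esub> x \<in> carrier ?L" by (rule smult[OF r x])
  next
    fix r s x assume r: "r \<in> carrier R" and s: "s \<in> carrier R" and x: "x \<in> carrier ?L"
      show "(r \<oplus> s) \<odot>\<^bsub>?L\<^esub> x = r \<odot>\<^bsub>?L\<^esub> x \<oplus>\<^bsub>?L\<^esub> s \<odot>\<^bsub>?L\<^esub> x"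
      proof (rule profinite_eqI)
        fix I assume I: "I \<in> finite_index_ideals R"
        obtain a where "a \<in> carrier R" "x I = I +> a" using rep[OF x I] by blast
        then show "((r \<oplus> s) \<odot>\<^bsub>?L\<^esub> x) I = (r \<odot>\<^bsub>?L\<^esub> x \<oplus>\<^bsub>?L\<^esub> s \<odot>\<^bsub>?L\<^esub> x) I"
          using I r s by (simp add: profinite_simps coset_add coset_mult l_distr)
      qed (use r s x smult add in auto)
      show "(r \<otimes> s) \<odot>\<^bsub>?L\<^esub> x = r \<odot>\<^bsub>?L\<^esub> (s \<odot>\<^bsub>?L\<^esub> x)"
      proof (rule profinite_eqI)
        fix I assume I: "I \<in> finite_index_ideals R"
        obtain a where "a \<in> carrier R" "x I = I +> a" using rep[OF x I] by blast
        then show "((r \<otimes> s) \<odot>\<^bsub>?L\<^esub> x) I = (r \<odot>\<^bsub>?L\<^esub> (s \<odot>\<^bsub>?L\<^esub> x)) I"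
          using I r s by (simp add: profinite_simps coset_mult m_assoc)
      qed (use r s x smult add in auto)
  next
    fix r x y assume r: "r \<in> carrier R" and x: "x \<in> carrier ?L" and y: "y \<in> carrier ?L"
      show "r \<odot>\<^bsub>?L\<^esub> (x \<oplus>\<^bsub>?L\<^esub> y) = r \<odot>\<^bsub>?L\<^esub> x \<oplus>\<^bsub>?L\<^esub> r \<odot>\<^bsub>?L\<^esub> y"
      proof (rule profinite_eqI)
        fix I assume I: "I \<in> finite_index_ideals R"
        obtain a b where "a \<in> carrier R" "x I = I +> a" "b \<in> carrier R" "y I = I +> b"
          using rep[OF x I] rep[OF y I] by blast
        then show "(r \<odot>\<^bsub>?L\<^esub> (x \<oplus>\<^bsub>?L\<^esub> y)) I = (r \<odot>\<^bsub>?L\<^esub> x \<oplus>\<^bsub>?L\<^esub> r \<odot>\<^bsub>?L\<^esub> y) I"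
          using I r by (simp add: profinite_simps coset_add coset_mult r_distr)
      qed (use r x y smult add in auto)
  next
    fix x assume x: "x \<in> carrier ?L"
    show "\<one> \<odot>\<^bsub>?L\<^esub> x = x"
    proof (rule profinite_eqI)
      fix I assume I: "I \<in> finite_index_ideals R"
      obtain a where "a \<in> carrier R" "x I = I +> a" using rep[OF x I] by blast
      then show "(\<one> \<odot>\<^bsub>?L\<^esub> x) I = x I" using I by (simp add: profinite_simps coset_mult)
    qed (use x smult in auto)
  qed
qed

lemma profinite_finsum_rep:
  assumes "I \<in> finite_index_ideals R" "finite X"
    "\<And>i. i \<in> X \<Longrightarrow> x i \<in> carrier (profinite_completion R)"
    "\<And>i. i \<in> X \<Longrightarrow> a i \<in> carrier R" "\<And>i. i \<in> X \<Longrightarrow> x i I = I +> a i"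
  shows "(\<Oplus>\<^bsub>profinite_completion R\<^esub>i\<in>X. x i) I = I +> (\<Oplus>i\<in>X. a i)"
  using assms(2-)
proof (induction X rule: finite_induct)
  case empty
  interpret L: left_module R "profinite_completion R" by (rule left_module_profinite)
  show ?case using profinite_zero_rep[OF assms(1)] by simp
next
  case (insert j X)
  interpret L: left_module R "profinite_completion R" by (rule left_module_profinite)
  have "(\<Oplus>\<^bsub>profinite_completion R\<^esub>i\<in>insert j X. x i) I
      = (x j \<oplus>\<^bsub>profinite_completion R\<^esub> (\<Oplus>\<^bsub>profinite_completion R\<^esub>i\<in>X. x i)) I"
    using insert by (subst L.finsum_insert) auto
  also have "\<dots> = I +> (a j \<oplus> (\<Oplus>i\<in>X. a i))"
    using insert assms(1) by (intro profinite_add_rep) (auto intro!: finsum_closed)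
  also have "a j \<oplus> (\<Oplus>i\<in>X. a i) = (\<Oplus>i\<in>insert j X. a i)"
    using insert by (subst finsum_insert) auto
  finally show ?case .
qed

lemma profinite_lincomb_rep:
  assumes "I \<in> finite_index_ideals R" "finite X" "\<And>i. i \<in> X \<Longrightarrow> r i \<in> carrier R"
    "\<And>i. i \<in> X \<Longrightarrow> x i \<in> carrier (profinite_completion R)"
    "\<And>i. i \<in> X \<Longrightarrow> a i \<in> carrier R" "\<And>i. i \<in> X \<Longrightarrow> x i I = I +> a i"
  shows "(\<Oplus>\<^bsub>profinite_completion R\<^esub>i\<in>X. r i \<odot>\<^bsub>profinite_completion R\<^esub> x i) I = I +> (\<Oplus>i\<in>X. r i \<otimes> a i)"
proof -
  interpret L: left_module R "profinite_completion R" by (rule left_module_profinite)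
  show ?thesis
    by (rule profinite_finsum_rep) (use assms in \<open>auto simp: profinite_smult_rep\<close>)
qed

text \<open>
  The limit of a sequence whose increments become small along a cofinal chain.  Its coset modulo \<open>I\<close>
  is that of the term at the first stage where the chain is inside \<open>I\<close>, and later terms give the same
  coset.
\<close>

lemma profinite_limit:
  assumes C: "\<And>n. C n \<in> finite_index_ideals R" "\<And>m n. m \<le> n \<Longrightarrow> C n \<subseteq> C m"
    "\<And>I. I \<in> finite_index_ideals R \<Longrightarrow> \<exists>n. C n \<subseteq> I"
    and c: "\<And>n :: nat. c n \<in> carrier R" "\<And>n. c (Suc n) \<ominus> c n \<in> C n"
  obtains y where "y \<in> carrier (profinite_completion R)" "\<And>n. y (C n) = C n +> c n"
proof -
  have tail: "c m \<ominus> c n \<in> C n" if "n \<le> m" for m n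
    using that
  proof (induction m rule: dec_induct)
    case base show ?case using c(1) finite_index_idealD(3)[OF C(1)] by (simp add: a_minus_def r_neg)
  next
    case (step m)
    have "c (Suc m) \<ominus> c n = (c (Suc m) \<ominus> c m) \<oplus> (c m \<ominus> c n)"
      using c(1) by (simp add: a_minus_def a_assoc) (simp add: a_assoc[symmetric] l_neg)
    moreover have "c (Suc m) \<ominus> c m \<in> C n" using c(2)[of m] C(2)[OF step(1)] by auto
    ultimately show ?case using step finite_index_idealD(6)[OF C(1)] by simp
  qed
  define N where "N I = (LEAST n. C n \<subseteq> I)" for I
  have N: "C (N I) \<subseteq> I" if "I \<in> finite_index_ideals R" for I
    unfolding N_def using C(3)[OF that] by (rule LeastI_ex)
  define y where "y = (\<lambda>I\<in>finite_index_ideals R. I +> c (N I))"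
  have y: "y I = I +> c m" if I: "I \<in> finite_index_ideals R" and m: "C m \<subseteq> I" for I m
  proof -
    let ?k = "max m (N I)"
    have "c ?k \<ominus> c m \<in> I" using tail[of m ?k] m by auto
    moreover have "c ?k \<ominus> c (N I) \<in> I" using tail[of "N I" ?k] N[OF I] by auto
    ultimately have "I +> c ?k = I +> c m" "I +> c ?k = I +> c (N I)"
      using coset_eq_iff[OF I] c(1) by auto
    then show ?thesis using I by (simp add: y_def)
  qed
  show ?thesis
  proof (rule that[of y])
    show "y \<in> carrier (profinite_completion R)"
      unfolding profinite_iff
    proof (intro conjI ballI)
      fix I assume I: "I \<in> finite_index_ideals R"
      show "\<exists>a\<in>carrier R. y I = I +> a \<and> (\<forall>J\<in>finite_index_ideals R. I \<subseteq> J \<longrightarrow> y J = J +> a)"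
      proof (intro bexI[of _ "c (N I)"] conjI ballI impI)
        show "y I = I +> c (N I)" by (rule y[OF I N[OF I]])
        show "y J = J +> c (N I)" if "J \<in> finite_index_ideals R" "I \<subseteq> J" for J
          using y[OF that(1)] N[OF I] that(2) by simp
      qed (rule c(1))
    qed (simp add: y_def)
    show "y (C n) = C n +> c n" for n using y[OF C(1)] by simp
  qed
qed

end

section \<open>Linear combinations with coefficients in a left module\<close>

text \<open>
  The tuples \<open>w\<close>, indexed by \<open>X\<close>, that are finite sums of tuples \<open>g c\<close> with \<open>g \<in> K\<close> and \<open>c \<in> L\<close>; this is the
  image of \<open>K \<otimes> L\<close> in \<open>L\<^sup>X\<close>, denoted \<open>K L\<close>.  An inductive definition lets a linear map be applied to such
  a tuple one summand at a time, without double sums.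
\<close>

inductive scalar_extension :: "('a, 'n, 'c) module_scheme \<Rightarrow> 'i set \<Rightarrow> ('i \<Rightarrow> 'a) set \<Rightarrow> ('i \<Rightarrow> 'n) \<Rightarrow> bool"
  for L X K where
    zero: "(\<And>x. x \<in> X \<Longrightarrow> w x = \<zero>\<^bsub>L\<^esub>) \<Longrightarrow> scalar_extension L X K w"
  | step: "\<lbrakk>g \<in> K; c \<in> carrier L; scalar_extension L X K v;
      \<And>x. x \<in> X \<Longrightarrow> w x = g x \<odot>\<^bsub>L\<^esub> c \<oplus>\<^bsub>L\<^esub> v x\<rbrakk> \<Longrightarrow> scalar_extension L X K w"

lemma scalar_extension_cong:
  assumes "scalar_extension L X K w" "\<And>x. x \<in> X \<Longrightarrow> w' x = w x"
  shows "scalar_extension L X K w'"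
  using assms(1)
proof cases
  case zero then show ?thesis using assms(2) by (intro scalar_extension.zero) simp
next
  case (step g c v)
  show ?thesis by (rule scalar_extension.step[OF step(1-3)]) (use step(4) assms(2) in simp)
qed

context left_module
begin

lemma scalar_extension_closed:
  assumes "scalar_extension M X K w" "\<forall>g\<in>K. \<forall>x\<in>X. g x \<in> carrier R" "x \<in> X"
  shows "w x \<in> carrier M"
  using assms(1) by induction (use assms(2,3) in auto)

lemma scalar_extension_minus:
  assumes "scalar_extension M X K w" and K: "\<forall>g\<in>K. \<forall>x\<in>X. g x \<in> carrier R"
  shows "scalar_extension M X K (\<lambda>x. \<ominus>\<^bsub>M\<^esub> w x)"
  using assms(1)
proof induction
  case (zero w)
  then show ?case using M.minus_equality[of "\<zero>\<^bsub>M\<^esub>" "\<zero>\<^bsub>M\<^esub>"] by (intro scalar_extension.zero) simp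
next
  case (step g c v w)
  show ?case
  proof (rule scalar_extension.step[OF step(1) M.a_inv_closed[OF step(2)] step.IH])
    fix x assume x: "x \<in> X"
    have "v x \<in> carrier M" by (rule scalar_extension_closed[OF step(3) K x])
    then show "\<ominus>\<^bsub>M\<^esub> w x = g x \<odot>\<^bsub>M\<^esub> (\<ominus>\<^bsub>M\<^esub> c) \<oplus>\<^bsub>M\<^esub> (\<ominus>\<^bsub>M\<^esub> v x)"
      using bspec[OF bspec[OF K step(1)] x] step(2,4) x by (simp add: M.minus_add action.smult_minus_r)
  qed
qed

lemma scalar_extension_add:
  assumes "scalar_extension M X K w" "scalar_extension M X K w'"
    and K: "\<forall>g\<in>K. \<forall>x\<in>X. g x \<in> carrier R"
  shows "scalar_extension M X K (\<lambda>x. w x \<oplus>\<^bsub>M\<^esub> w' x)"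
  using assms(1)
proof induction
  case (zero w)
  show ?case
    by (rule scalar_extension_cong[OF assms(2)])
       (use zero scalar_extension_closed[OF assms(2) K] in auto)
next
  case (step g c v w)
  show ?case
  proof (rule scalar_extension.step[OF step(1,2) step.IH])
    fix x assume x: "x \<in> X"
    have "v x \<in> carrier M" "w' x \<in> carrier M"
      using scalar_extension_closed[OF step(3) K x] scalar_extension_closed[OF assms(2) K x] .
    then show "w x \<oplus>\<^bsub>M\<^esub> w' x = g x \<odot>\<^bsub>M\<^esub> c \<oplus>\<^bsub>M\<^esub> (v x \<oplus>\<^bsub>M\<^esub> w' x)"
      using bspec[OF bspec[OF K step(1)] x] step(2,4) x by (simp add: M.a_assoc)
  qed
qed

lemma scalar_extensionI:
  assumes "\<And>q. q < (p::nat) \<Longrightarrow> g q \<in> K" "\<And>q. q < p \<Longrightarrow> c q \<in> carrier M"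
    and K: "\<forall>g\<in>K. \<forall>x\<in>X. g x \<in> carrier R"
    and "\<And>x. x \<in> X \<Longrightarrow> w x = (\<Oplus>\<^bsub>M\<^esub>q\<in>{..<p}. g q x \<odot>\<^bsub>M\<^esub> c q)"
  shows "scalar_extension M X K w"
  using assms(1,2,4)
proof (induction p arbitrary: w)
  case 0 then show ?case by (intro scalar_extension.zero) simp
next
  case (Suc p)
  show ?case
  proof (rule scalar_extension.step[where g = "g p" and c = "c p"])
    show "scalar_extension M X K (\<lambda>x. \<Oplus>\<^bsub>M\<^esub>q\<in>{..<p}. g q x \<odot>\<^bsub>M\<^esub> c q)"
      by (rule Suc.IH) (use Suc.prems in auto)
    show "w x = g p x \<odot>\<^bsub>M\<^esub> c p \<oplus>\<^bsub>M\<^esub> (\<Oplus>\<^bsub>M\<^esub>q\<in>{..<p}. g q x \<odot>\<^bsub>M\<^esub> c q)" if x: "x \<in> X" for x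
      unfolding Suc.prems(3)[OF x] lessThan_Suc
      by (rule M.finsum_insert) (use Suc.prems(1,2) K x in auto)
  qed (use Suc.prems in auto)
qed

lemma scalar_extensionE:
  assumes "scalar_extension M X K w" and K: "\<forall>g\<in>K. \<forall>x\<in>X. g x \<in> carrier R"
  shows "\<exists>(p::nat) g c. (\<forall>q<p. g q \<in> K \<and> c q \<in> carrier M) \<and>
    (\<forall>x\<in>X. w x = (\<Oplus>\<^bsub>M\<^esub>q\<in>{..<p}. g q x \<odot>\<^bsub>M\<^esub> c q))"
  using assms(1)
proof induction
  case (zero w) then show ?case by (intro exI[of _ 0]) auto
next
  case (step g0 c0 v w)
  then obtain p :: nat and g c where pgc: "\<And>q. q < p \<Longrightarrow> g q \<in> K" "\<And>q. q < p \<Longrightarrow> c q \<in> carrier M"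
    "\<And>x. x \<in> X \<Longrightarrow> v x = (\<Oplus>\<^bsub>M\<^esub>q\<in>{..<p}. g q x \<odot>\<^bsub>M\<^esub> c q)" by metis
  show ?case
  proof (intro exI[of _ "Suc p"] exI[of _ "g(p := g0)"] exI[of _ "c(p := c0)"] conjI allI impI ballI)
    fix x assume x: "x \<in> X"
    have "(\<Oplus>\<^bsub>M\<^esub>q\<in>{..<Suc p}. (g(p := g0)) q x \<odot>\<^bsub>M\<^esub> (c(p := c0)) q)
        = (g(p := g0)) p x \<odot>\<^bsub>M\<^esub> (c(p := c0)) p \<oplus>\<^bsub>M\<^esub> (\<Oplus>\<^bsub>M\<^esub>q\<in>{..<p}. (g(p := g0)) q x \<odot>\<^bsub>M\<^esub> (c(p := c0)) q)"
      unfolding lessThan_Suc by (rule M.finsum_insert) (use step(1,2) pgc(1,2) K x in auto)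
    also have "(\<Oplus>\<^bsub>M\<^esub>q\<in>{..<p}. (g(p := g0)) q x \<odot>\<^bsub>M\<^esub> (c(p := c0)) q) = v x"
      unfolding pgc(3)[OF x] by (rule M.finsum_cong') (use pgc(1,2) K x in auto)
    finally show "w x = (\<Oplus>\<^bsub>M\<^esub>q\<in>{..<Suc p}. (g(p := g0)) q x \<odot>\<^bsub>M\<^esub> (c(p := c0)) q)"
      using step(4)[OF x] by simp
  qed (use step(1,2) pgc(1,2) in \<open>auto simp: less_Suc_eq\<close>)
qed

end

section \<open>Exactness of profinite completion\<close>

text \<open>
  If \<open>y\<close> is killed by \<open>r\<close> in \<open>L\<^sup>m\<close>, then it is a combination of elements of the kernel of \<open>r\<close>.  The
  Artin--Rees property of \<open>r\<close> corrects approximations of \<open>y\<close> to elements of the kernel.  The kernel is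
  the image of a map \<open>G\<close> from a free module, and the Artin--Rees property of \<open>G\<close> makes it possible to
  lift a convergent sequence in the kernel to a convergent sequence of coefficients.
\<close>

theorem profinite_kernel:
  fixes R :: "('a, 'r) ring_scheme"
  assumes "ring R" "finitely_generated_ring R" "infinite (UNIV :: 'u set)"
    and resid: "\<forall>M :: ('a, 'u) module. finitely_presented_right_module R M \<longrightarrow> residually_finite_module R M"
    and r: "r \<in> rmodule_hom R (free_rank R n) (free_rank R m)"
    and K: "fg_submodule R (free_rank R n) (a_kernel (free_rank R n) (free_rank R m) r)"
    and y: "\<And>i. i < n \<Longrightarrow> y i \<in> carrier (profinite_completion R)"
    and ry: "\<And>I a. \<lbrakk>I \<in> finite_index_ideals R; a \<in> carrier (free_rank R n); \<And>i. i < n \<Longrightarrow> y i I = I +>\<^bsub>R\<^esub> a i\<rbrakk>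
        \<Longrightarrow> \<forall>j<m. r a j \<in> I"
  shows "scalar_extension (profinite_completion R) {..<n} (a_kernel (free_rank R n) (free_rank R m) r) y"
proof -
  interpret ring R by fact
  let ?N = "free_rank R n" and ?M = "free_rank R m" and ?L = "profinite_completion R"
  let ?K = "a_kernel ?N ?M r"
  interpret r: right_module_hom R ?N ?M r
    by (rule right_module_hom.intro[OF right_module_free_rank right_module_free_rank]) (unfold_locales, rule r)
  interpret L: left_module R ?L by (rule left_module_profinite)
  obtain p :: nat and g where "inj_on g {..<p}" and g: "\<And>q. q < p \<Longrightarrow> g q \<in> ?K"
    and span: "?K = (\<lambda>c. \<Oplus>\<^bsub>?N\<^esub>q\<in>{..<p}. c q \<odot>\<^bsub>?N\<^esub> g q) ` ({..<p} \<rightarrow>\<^sub>E carrier R)"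
    by (rule fg_submodule_obtain_generators[OF right_module_free_rank K]) (rule that)
  have gN: "g q \<in> carrier ?N" if "q < p" for q using g[OF that] by (simp add: r.kernel_eq)
  have gR: "g q i \<in> carrier R" if "q < p" "i < n" for q i using gN[OF that(1)] that(2) by (auto simp: free_rank_simps)
  let ?P = "free_rank R p"
  define G where "G c = (\<Oplus>\<^bsub>?N\<^esub>q\<in>{..<p}. c q \<odot>\<^bsub>?N\<^esub> g q)" for c
  have Gh: "G \<in> rmodule_hom R ?P ?N"
    unfolding G_def by (rule lincomb_hom_free_rank[OF right_module_free_rank gN])
  interpret G: right_module_hom R ?P ?N G
    by (rule right_module_hom.intro[OF right_module_free_rank right_module_free_rank]) (unfold_locales, rule Gh)
  have Gim: "?K = G ` carrier ?P" unfolding span G_def free_rank_simps(1) ..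
  have Gi: "G c i = (\<Oplus>\<^bsub>R\<^esub>q\<in>{..<p}. g q i \<otimes>\<^bsub>R\<^esub> c q)" if "c \<in> carrier ?P" "i < n" for c i
  proof -
    have cR: "c q \<in> carrier R" if "q < p" for q using \<open>c \<in> carrier ?P\<close> that by (auto simp: free_rank_simps)
    have "G c = (\<lambda>i\<in>{..<n}. \<Oplus>\<^bsub>R\<^esub>q\<in>{..<p}. (c q \<odot>\<^bsub>?N\<^esub> g q) i)"
      unfolding G_def by (rule free_rank_finsum) (use cR gN in auto)
    then have "G c i = (\<Oplus>\<^bsub>R\<^esub>q\<in>{..<p}. (c q \<odot>\<^bsub>?N\<^esub> g q) i)" using that by simp
    also have "\<dots> = (\<Oplus>\<^bsub>R\<^esub>q\<in>{..<p}. g q i \<otimes>\<^bsub>R\<^esub> c q)"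
      by (rule finsum_cong') (use cR gR that in \<open>auto simp: free_rank_simps\<close>)
    finally show ?thesis .
  qed
  have comp: "f i \<in> carrier R" if "f \<in> carrier (free_rank R k)" "i < k" for f i k
    using that by (auto simp: free_rank_simps)
  define approx where "approx I z \<longleftrightarrow> z \<in> carrier ?N \<and> (\<forall>i<n. y i I = I +>\<^bsub>R\<^esub> z i)" for I z
  \<comment> \<open>By Artin--Rees for \<open>r\<close>, the tuple \<open>y\<close> lies in the closure of the kernel.\<close>
  have dense: "\<exists>z\<in>?K. approx I z" if I: "I \<in> finite_index_ideals R" for I
  proof -
    note FI = finite_index_idealD[OF I]
    obtain J where J: "J \<in> finite_index_ideals R" "J \<subseteq> I" and AR: "\<forall>c\<in>carrier ?N. (\<forall>i<m. r c i \<in> J) \<longrightarrow>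
      (\<exists>c'\<in>carrier ?N. (\<forall>i<n. c' i \<in> I) \<and> r c' = r c)"
      using artin_rees[OF assms(1-3) resid r I] by (elim bexE conjE) (rule that)
    have "\<exists>a. a \<in> carrier R \<and> y i J = J +>\<^bsub>R\<^esub> a" if "i < n" for i using profinite_rep[OF y[OF that] J(1)] by blast
    then obtain a0 where a0: "\<And>i. i < n \<Longrightarrow> a0 i \<in> carrier R \<and> y i J = J +>\<^bsub>R\<^esub> a0 i" by metis
    define a where "a = (\<lambda>i\<in>{..<n}. a0 i)"
    have a: "a \<in> carrier ?N" "\<And>i. i < n \<Longrightarrow> y i J = J +>\<^bsub>R\<^esub> a i" using a0 by (auto simp: a_def free_rank_simps)
    obtain c where c: "c \<in> carrier ?N" "\<forall>i<n. c i \<in> I" "r c = r a"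
      using AR ry[OF J(1) a] a(1) by blast
    let ?z = "a \<ominus>\<^bsub>?N\<^esub> c"
    have "?z \<in> ?K" using a c r.hom_closed[OF a(1)] by (simp add: r.kernel_eq r.hom_add r.hom_minus a_minus_def r.cod.M.r_neg)
    moreover have "approx I ?z" unfolding approx_def
    proof (intro conjI allI impI)
      show "?z \<in> carrier ?N" using a c by simp
      fix i assume i: "i < n"
      have R: "a i \<in> carrier R" "c i \<in> carrier R" using comp a c i by auto
      have zi: "?z i = a i \<ominus>\<^bsub>R\<^esub> c i" using fun_cong[OF free_rank_diff[OF a(1) c(1)], of i] i by simp
      have "y i I = I +>\<^bsub>R\<^esub> a i" by (rule profinite_mono[OF y[OF i] J(1) I J(2) R(1) a(2)[OF i]])
      also have "\<dots> = I +>\<^bsub>R\<^esub> ?z i"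
      proof -
        have "a i \<ominus>\<^bsub>R\<^esub> (a i \<ominus>\<^bsub>R\<^esub> c i) = c i" using R by (simp add: a_minus_def minus_add a_assoc[symmetric] r_neg)
        then show ?thesis using coset_eq_iff[OF I R(1), of "?z i"] R c(2) i unfolding zi by simp
      qed
      finally show "y i I = I +>\<^bsub>R\<^esub> ?z i" .
    qed
    ultimately show ?thesis by blast
  qed
  obtain C :: "nat \<Rightarrow> 'a set" where C: "\<And>n. C n \<in> finite_index_ideals R" "\<And>m n. m \<le> n \<Longrightarrow> C n \<subseteq> C m"
    "\<And>I. I \<in> finite_index_ideals R \<Longrightarrow> \<exists>n. C n \<subseteq> I"
    using finite_index_ideal_chain[OF assms(2)] by blast
  \<comment> \<open>The conclusion of Artin--Rees for \<open>G\<close> and \<open>C k\<close>: small elements of the kernel have small lifts.\<close>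
  define lifts where "lifts k D \<longleftrightarrow> D \<in> finite_index_ideals R \<and> D \<subseteq> C k \<and> (\<forall>c\<in>carrier ?P. (\<forall>i<n. G c i \<in> D) \<longrightarrow>
      (\<exists>c'\<in>carrier ?P. (\<forall>q<p. c' q \<in> C k) \<and> G c' = G c))" for k D
  define ok where "ok k s \<longleftrightarrow> (case s of (c, D) \<Rightarrow> c \<in> carrier ?P \<and> lifts k D \<and> approx D (G c))" for k s
  have lift_ex: "\<exists>D. lifts k D" for k
    unfolding lifts_def using artin_rees[OF assms(1-3) resid Gh C(1)[of k]] by (simp only: Bex_def)
  \<comment> \<open>Successive approximation: each new coefficient vector corrects the previous one by something small.\<close>
  have "\<exists>f. \<forall>k. ok k (f k) \<and> (\<forall>q<p. fst (f (Suc k)) q \<ominus>\<^bsub>R\<^esub> fst (f k) q \<in> C k)"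
  proof (rule dependent_nat_choice[where Q = "\<lambda>k s s'. \<forall>q<p. fst s' q \<ominus>\<^bsub>R\<^esub> fst s q \<in> C k"])
    obtain D where D: "lifts 0 D" using lift_ex by blast
    then have "D \<in> finite_index_ideals R" by (simp add: lifts_def)
    then obtain z where "z \<in> ?K" "approx D z" using dense by blast
    then obtain c where "c \<in> carrier ?P" "approx D (G c)" unfolding Gim by blast
    then show "\<exists>s. ok 0 s" using D by (intro exI[of _ "(c, D)"]) (simp add: ok_def)
  next
    fix s k assume "ok k s"
    then obtain c D where s: "s = (c, D)" and c: "c \<in> carrier ?P" and D: "lifts k D" and app: "approx D (G c)"
      by (cases s) (auto simp: ok_def)
    have DI: "D \<in> finite_index_ideals R" using D by (simp add: lifts_def)
    obtain D0 where D0: "lifts (Suc k) D0" using lift_ex by blast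
    \<comment> \<open>Smaller ideals keep the lifting property, so the new one may be taken inside the old one.\<close>
    define D' where "D' = D0 \<inter> D"
    have D'I: "D' \<in> finite_index_ideals R" unfolding D'_def using D0 DI by (intro finite_index_ideal_Int) (auto simp: lifts_def)
    have D': "lifts (Suc k) D'" using D0 D'I unfolding lifts_def D'_def by auto
    obtain z where z: "z \<in> ?K" "approx D' z" using dense[OF D'I] by blast
    then obtain c2 where c2: "c2 \<in> carrier ?P" "z = G c2" unfolding Gim by blast
    have "\<forall>i<n. G (c2 \<ominus>\<^bsub>?P\<^esub> c) i \<in> D"
    proof (intro allI impI)
      fix i assume i: "i < n"
      have R: "G c2 i \<in> carrier R" "G c i \<in> carrier R" using comp[OF G.hom_closed i] c c2 by auto
      have "y i D = D +>\<^bsub>R\<^esub> G c2 i"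
        by (rule profinite_mono[OF y[OF i] D'I DI _ R(1)]) (use z(2) c2 i in \<open>auto simp: D'_def approx_def\<close>)
      moreover have "y i D = D +>\<^bsub>R\<^esub> G c i" using app i by (simp add: approx_def)
      ultimately have "G c2 i \<ominus>\<^bsub>R\<^esub> G c i \<in> D" using coset_eq_iff[OF DI R] by simp
      then show "G (c2 \<ominus>\<^bsub>?P\<^esub> c) i \<in> D"
        unfolding G.hom_diff[OF c2(1) c] using fun_cong[OF free_rank_diff[OF G.hom_closed[OF c2(1)] G.hom_closed[OF c]], of i] i by simp
    qed
    moreover have "c2 \<ominus>\<^bsub>?P\<^esub> c \<in> carrier ?P" using c c2 by simp
    ultimately obtain d where d: "d \<in> carrier ?P" "\<forall>q<p. d q \<in> C k" "G d = G (c2 \<ominus>\<^bsub>?P\<^esub> c)"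
      using D[unfolded lifts_def, THEN conjunct2, THEN conjunct2, THEN bspec, THEN mp] by blast
    let ?c = "c \<oplus>\<^bsub>?P\<^esub> d"
    have "G ?c = G c2"
    proof -
      have "G ?c = G c \<oplus>\<^bsub>?N\<^esub> (G c2 \<ominus>\<^bsub>?N\<^esub> G c)" using c c2 d by (simp add: G.hom_add G.hom_diff)
      also have "\<dots> = G c2"
        using G.hom_closed[OF c] G.hom_closed[OF c2(1)] by (simp add: a_minus_def r.dom.M.a_comm[of "G c2" "\<ominus>\<^bsub>?N\<^esub> G c"] r.dom.M.r_neg2)
      finally show ?thesis .
    qed
    moreover have "?c q \<ominus>\<^bsub>R\<^esub> c q \<in> C k" if q: "q < p" for q
    proof -
      have "c q \<in> carrier R" "d q \<in> carrier R" using comp[OF c q] comp[OF d(1) q] .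
      then have "?c q \<ominus>\<^bsub>R\<^esub> c q = d q" using q by (simp add: free_rank_simps(3) a_minus_def a_assoc a_comm[of "d q" "\<ominus>\<^bsub>R\<^esub> c q"] r_neg2)
      then show ?thesis using d(2) q by simp
    qed
    ultimately show "\<exists>s'. ok (Suc k) s' \<and> (\<forall>q<p. fst s' q \<ominus>\<^bsub>R\<^esub> fst s q \<in> C k)"
      using D' z c2 c d s by (intro exI[of _ "(?c, D')"]) (simp add: ok_def)
  qed
  then obtain f where f: "\<And>k. ok k (f k)" "\<And>k q. q < p \<Longrightarrow> fst (f (Suc k)) q \<ominus>\<^bsub>R\<^esub> fst (f k) q \<in> C k" by blast
  define c where "c k = fst (f k)" for k
  have cP: "c k \<in> carrier ?P" for k using f(1)[of k] by (auto simp: ok_def c_def split: prod.splits)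
  have cy: "y i (C k) = C k +>\<^bsub>R\<^esub> G (c k) i" if i: "i < n" for i k
  proof -
    obtain D where D: "lifts k D" "approx D (G (c k))" using f(1)[of k] by (auto simp: ok_def c_def split: prod.splits)
    show ?thesis
      by (rule profinite_mono[OF y[OF i] _ C(1) _ comp[OF G.hom_closed[OF cP] i]])
         (use D i in \<open>auto simp: lifts_def approx_def\<close>)
  qed
  have "\<exists>l. l \<in> carrier ?L \<and> (\<forall>k. l (C k) = C k +>\<^bsub>R\<^esub> c k q)" if q: "q < p" for q
  proof (rule profinite_limit[of C "\<lambda>k. c k q"])
    show "c k q \<in> carrier R" for k by (rule comp[OF cP q])
    show "c (Suc k) q \<ominus>\<^bsub>R\<^esub> c k q \<in> C k" for k using f(2)[OF q] by (simp add: c_def)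
    fix l assume "l \<in> carrier ?L" "\<And>k. l (C k) = C k +>\<^bsub>R\<^esub> c k q"
    then show ?thesis by blast
  qed (use C in auto)
  then obtain l where l: "\<And>q. q < p \<Longrightarrow> l q \<in> carrier ?L" "\<And>q k. q < p \<Longrightarrow> l q (C k) = C k +>\<^bsub>R\<^esub> c k q" by metis
  show ?thesis
  proof (rule L.scalar_extensionI[where g = g and c = l and p = p])
    show "\<forall>g\<in>?K. \<forall>x\<in>{..<n}. g x \<in> carrier R"
      by (auto simp: r.kernel_eq free_rank_simps)
    fix i assume "i \<in> {..<n}"
    then have i: "i < n" by simp
    let ?s = "\<Oplus>\<^bsub>?L\<^esub>q\<in>{..<p}. g q i \<odot>\<^bsub>?L\<^esub> l q"
    have s: "?s \<in> carrier ?L" by (rule L.finsum_closed) (use l gR i in auto)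
    show "y i = ?s"
    proof (rule profinite_eqI[OF y[OF i] s])
      fix I assume I: "I \<in> finite_index_ideals R"
      obtain k where k: "C k \<subseteq> I" using C(3)[OF I] by blast
      have cR: "c k q \<in> carrier R" if "q < p" for q by (rule comp[OF cP that])
      have GR: "G (c k) i \<in> carrier R" by (rule comp[OF G.hom_closed[OF cP] i])
      have "?s (C k) = C k +>\<^bsub>R\<^esub> (\<Oplus>\<^bsub>R\<^esub>q\<in>{..<p}. g q i \<otimes>\<^bsub>R\<^esub> c k q)"
        by (rule profinite_lincomb_rep[OF C(1)]) (use l gR i cR in auto)
      then have "?s (C k) = C k +>\<^bsub>R\<^esub> G (c k) i" using Gi[OF cP i] by simp
      from profinite_mono[OF s C(1) I k GR this] profinite_mono[OF y[OF i] C(1) I k GR cy[OF i]]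
      show "y i I = ?s I" by simp
    qed
  qed (use g l in auto)
qed

section \<open>Vanishing in a tensor product\<close>

text \<open>
  How a row \<open>a\<close> of scalars acts on a tuple \<open>h c + v\<close>: this is the induction step when a matrix is
  applied to an element of \<open>K L\<close>.
\<close>

lemma (in left_module) lincomb_step:
  assumes "finite X" "\<And>i. i \<in> X \<Longrightarrow> a i \<in> carrier R" "\<And>i. i \<in> X \<Longrightarrow> h i \<in> carrier R"
    "\<And>i. i \<in> X \<Longrightarrow> v i \<in> carrier M" "c \<in> carrier M" "\<And>i. i \<in> X \<Longrightarrow> w i = h i \<odot>\<^bsub>M\<^esub> c \<oplus>\<^bsub>M\<^esub> v i"
  shows "(\<Oplus>\<^bsub>M\<^esub>i\<in>X. a i \<odot>\<^bsub>M\<^esub> w i) = (\<Oplus>\<^bsub>R\<^esub>i\<in>X. a i \<otimes>\<^bsub>R\<^esub> h i) \<odot>\<^bsub>M\<^esub> c \<oplus>\<^bsub>M\<^esub> (\<Oplus>\<^bsub>M\<^esub>i\<in>X. a i \<odot>\<^bsub>M\<^esub> v i)"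
proof -
  have "(\<Oplus>\<^bsub>M\<^esub>i\<in>X. a i \<odot>\<^bsub>M\<^esub> w i) = (\<Oplus>\<^bsub>M\<^esub>i\<in>X. (a i \<otimes>\<^bsub>R\<^esub> h i) \<odot>\<^bsub>M\<^esub> c \<oplus>\<^bsub>M\<^esub> a i \<odot>\<^bsub>M\<^esub> v i)"
    by (rule M.finsum_cong') (use assms in \<open>auto simp: smult_r_distr smult_assoc\<close>)
  also have "\<dots> = (\<Oplus>\<^bsub>M\<^esub>i\<in>X. (a i \<otimes>\<^bsub>R\<^esub> h i) \<odot>\<^bsub>M\<^esub> c) \<oplus>\<^bsub>M\<^esub> (\<Oplus>\<^bsub>M\<^esub>i\<in>X. a i \<odot>\<^bsub>M\<^esub> v i)"
    by (rule M.finsum_addf) (use assms in auto)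
  also have "(\<Oplus>\<^bsub>M\<^esub>i\<in>X. (a i \<otimes>\<^bsub>R\<^esub> h i) \<odot>\<^bsub>M\<^esub> c) = (\<Oplus>\<^bsub>R\<^esub>i\<in>X. a i \<otimes>\<^bsub>R\<^esub> h i) \<odot>\<^bsub>M\<^esub> c"
    by (rule action.smult_finsum_l[symmetric]) (use assms in auto)
  finally show ?thesis .
qed

lemma (in right_module) lincomb_lincomb:
  assumes "finite X" "finite Q" "\<And>q x. q \<in> Q \<Longrightarrow> x \<in> X \<Longrightarrow> g q x \<in> carrier R"
    "\<And>q. q \<in> Q \<Longrightarrow> h q \<in> carrier R" "\<And>x. x \<in> X \<Longrightarrow> s x \<in> carrier M"
  shows "(\<Oplus>\<^bsub>M\<^esub>x\<in>X. (\<Oplus>\<^bsub>R\<^esub>q\<in>Q. g q x \<otimes>\<^bsub>R\<^esub> h q) \<odot>\<^bsub>M\<^esub> s x) = (\<Oplus>\<^bsub>M\<^esub>q\<in>Q. h q \<odot>\<^bsub>M\<^esub> (\<Oplus>\<^bsub>M\<^esub>x\<in>X. g q x \<odot>\<^bsub>M\<^esub> s x))"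
proof -
  have "(\<Oplus>\<^bsub>M\<^esub>x\<in>X. (\<Oplus>\<^bsub>R\<^esub>q\<in>Q. g q x \<otimes>\<^bsub>R\<^esub> h q) \<odot>\<^bsub>M\<^esub> s x) = (\<Oplus>\<^bsub>M\<^esub>x\<in>X. \<Oplus>\<^bsub>M\<^esub>q\<in>Q. (g q x \<otimes>\<^bsub>R\<^esub> h q) \<odot>\<^bsub>M\<^esub> s x)"
  proof (rule M.finsum_cong')
    fix x assume "x \<in> X"
    then show "(\<Oplus>\<^bsub>R\<^esub>q\<in>Q. g q x \<otimes>\<^bsub>R\<^esub> h q) \<odot>\<^bsub>M\<^esub> s x = (\<Oplus>\<^bsub>M\<^esub>q\<in>Q. (g q x \<otimes>\<^bsub>R\<^esub> h q) \<odot>\<^bsub>M\<^esub> s x)"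
      using assms by (intro action.smult_finsum_l) auto
  qed (use assms in \<open>auto intro!: M.finsum_closed\<close>)
  also have "\<dots> = (\<Oplus>\<^bsub>M\<^esub>q\<in>Q. \<Oplus>\<^bsub>M\<^esub>x\<in>X. (g q x \<otimes>\<^bsub>R\<^esub> h q) \<odot>\<^bsub>M\<^esub> s x)"
    by (rule M.finsum_swap) (use assms in auto)
  also have "\<dots> = (\<Oplus>\<^bsub>M\<^esub>q\<in>Q. h q \<odot>\<^bsub>M\<^esub> (\<Oplus>\<^bsub>M\<^esub>x\<in>X. g q x \<odot>\<^bsub>M\<^esub> s x))"
  proof (rule M.finsum_cong')
    fix q assume "q \<in> Q"
    then show "(\<Oplus>\<^bsub>M\<^esub>x\<in>X. (g q x \<otimes>\<^bsub>R\<^esub> h q) \<odot>\<^bsub>M\<^esub> s x) = h q \<odot>\<^bsub>M\<^esub> (\<Oplus>\<^bsub>M\<^esub>x\<in>X. g q x \<odot>\<^bsub>M\<^esub> s x)"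
      using assms by (intro lincomb_smult[symmetric]) auto
  qed (use assms in \<open>auto intro!: M.finsum_closed action.smult_closed\<close>)
  finally show ?thesis .
qed

text \<open>
  The kernel of the presentation \<open>R\<^sup>(\<^sup>A\<^sup>) \<rightarrow> A\<close> that takes every element of \<open>A\<close> as a generator.
\<close>

definition module_relations :: "('a, 'r) ring_scheme \<Rightarrow> ('a, 'm) module \<Rightarrow> ('m \<Rightarrow> 'a) set" where
  "module_relations R A = {g. (\<forall>x\<in>carrier A. g x \<in> carrier R) \<and>
     (\<exists>X. finite X \<and> X \<subseteq> carrier A \<and> (\<forall>x\<in>carrier A - X. g x = \<zero>\<^bsub>R\<^esub>) \<and> (\<Oplus>\<^bsub>A\<^esub>x\<in>X. g x \<odot>\<^bsub>A\<^esub> x) = \<zero>\<^bsub>A\<^esub>)}"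

text \<open>
  The coordinate at \<open>x\<close> of the homomorphism from the free abelian group on \<open>A \<times> L\<close> to \<open>L\<^sup>(\<^sup>A\<^sup>)\<close> that puts \<open>l\<close>
  at the place \<open>x\<close> for each generator \<open>(x, l)\<close>.
\<close>

definition tensor_coeff :: "('a, 'm) module \<Rightarrow> ('a, 'n) module \<Rightarrow> 'm \<Rightarrow> ('m \<times> 'n \<Rightarrow>\<^sub>0 int) \<Rightarrow> 'n" where
  "tensor_coeff A L x = (SOME h. h \<in> hom (free_Abelian_group (carrier A \<times> carrier L)) (add_monoid L) \<and>
     (\<forall>p \<in> carrier A \<times> carrier L. h (frag_of p) = (if fst p = x then snd p else \<zero>\<^bsub>L\<^esub>)))"

locale tensor = A: right_module R A + L: left_module R L
  for R :: "('a, 'r) ring_scheme" (structure) and A :: "('a, 'm) module" and L :: "('a, 'n) module"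
begin

abbreviation "FA \<equiv> free_Abelian_group (carrier A \<times> carrier L)"
abbreviation "Ker \<equiv> tensor_kernel R A L"

text \<open>
  The filter \<open>finite_subsets_at_top\<close> says that a statement holds for all sufficiently large finite sets;
  it replaces the bookkeeping of the supports of several relations.
\<close>

lemma module_relations_sum:
  assumes "g \<in> module_relations R A"
  shows "\<forall>\<^sub>F X in finite_subsets_at_top (carrier A). (\<Oplus>\<^bsub>A\<^esub>x\<in>X. g x \<odot>\<^bsub>A\<^esub> x) = \<zero>\<^bsub>A\<^esub>"
proof -
  obtain X where X: "finite X" "X \<subseteq> carrier A" "\<forall>x\<in>carrier A - X. g x = \<zero>\<^bsub>R\<^esub>" "(\<Oplus>\<^bsub>A\<^esub>x\<in>X. g x \<odot>\<^bsub>A\<^esub> x) = \<zero>\<^bsub>A\<^esub>"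
    and gR: "\<forall>x\<in>carrier A. g x \<in> carrier R"
    using assms unfolding module_relations_def by blast
  show ?thesis unfolding eventually_finite_subsets_at_top
  proof (intro exI[of _ X] conjI allI impI X(1,2))
    fix Y assume Y: "finite Y \<and> X \<subseteq> Y \<and> Y \<subseteq> carrier A"
    have "(\<Oplus>\<^bsub>A\<^esub>x\<in>X. g x \<odot>\<^bsub>A\<^esub> x) = (\<Oplus>\<^bsub>A\<^esub>x\<in>Y. g x \<odot>\<^bsub>A\<^esub> x)"
      by (rule A.add.finprod_mono_neutral_cong_left) (use X Y gR in \<open>auto simp: subset_iff\<close>)
    then show "(\<Oplus>\<^bsub>A\<^esub>x\<in>Y. g x \<odot>\<^bsub>A\<^esub> x) = \<zero>\<^bsub>A\<^esub>" using X by simp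
  qed
qed

lemma module_relations_support:
  assumes "g \<in> module_relations R A"
  shows "\<forall>\<^sub>F X in finite_subsets_at_top (carrier A). \<forall>x\<in>carrier A - X. g x = \<zero>\<^bsub>R\<^esub>"
  using assms unfolding module_relations_def eventually_finite_subsets_at_top by blast

lemma module_relations_closed: "\<forall>g\<in>module_relations R A. \<forall>x\<in>carrier A. g x \<in> carrier R"
  by (auto simp: module_relations_def)

lemma tensor_coeff_spec:
  "tensor_coeff A L x \<in> hom FA (add_monoid L) \<and>
     (\<forall>p \<in> carrier A \<times> carrier L. tensor_coeff A L x (frag_of p) = (if fst p = x then snd p else \<zero>\<^bsub>L\<^esub>))"
proof -
  let ?f = "\<lambda>p. if fst p = x then snd p else \<zero>\<^bsub>L\<^esub>"
  have "?f ` (carrier A \<times> carrier L) \<subseteq> carrier (add_monoid L)" by auto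
  then obtain h where "h \<in> hom FA (add_monoid L)" "\<And>p. p \<in> carrier A \<times> carrier L \<Longrightarrow> h (frag_of p) = ?f p"
    using comm_group.free_Abelian_group_universal[OF L.a_comm_group] by blast
  then have "\<exists>h. h \<in> hom FA (add_monoid L) \<and>
     (\<forall>p \<in> carrier A \<times> carrier L. h (frag_of p) = (if fst p = x then snd p else \<zero>\<^bsub>L\<^esub>))" by blast
  then show ?thesis unfolding tensor_coeff_def by (rule someI_ex)
qed

lemma tensor_coeff_frag [simp]:
  "x' \<in> carrier A \<Longrightarrow> l \<in> carrier L \<Longrightarrow> tensor_coeff A L x (frag_of (x', l)) = (if x' = x then l else \<zero>\<^bsub>L\<^esub>)"
  using tensor_coeff_spec[of x] by auto

lemma tensor_coeff_closed [simp]: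
  "Poly_Mapping.keys t \<subseteq> carrier A \<times> carrier L \<Longrightarrow> tensor_coeff A L x t \<in> carrier L"
  using tensor_coeff_spec[of x] by (auto simp: hom_def)

lemma tensor_coeff_add:
  "Poly_Mapping.keys s \<subseteq> carrier A \<times> carrier L \<Longrightarrow> Poly_Mapping.keys t \<subseteq> carrier A \<times> carrier L \<Longrightarrow>
    tensor_coeff A L x (s + t) = tensor_coeff A L x s \<oplus>\<^bsub>L\<^esub> tensor_coeff A L x t"
  using tensor_coeff_spec[of x] by (auto simp: hom_def)

lemma tensor_coeff_zero [simp]: "tensor_coeff A L x 0 = \<zero>\<^bsub>L\<^esub>"
  using tensor_coeff_add[of 0 0 x] tensor_coeff_closed[of 0 x]
  by (simp add: L.M.add.l_cancel_one')

lemma tensor_coeff_minus: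
  assumes "Poly_Mapping.keys t \<subseteq> carrier A \<times> carrier L"
  shows "tensor_coeff A L x (- t) = \<ominus>\<^bsub>L\<^esub> tensor_coeff A L x t"
proof -
  have "tensor_coeff A L x (- t) \<oplus>\<^bsub>L\<^esub> tensor_coeff A L x t = \<zero>\<^bsub>L\<^esub>"
    using tensor_coeff_add[of "- t" t x] assms by simp
  then show ?thesis using assms by (intro L.minus_equality[symmetric]) auto
qed

lemma tensor_coeff_diff:
  assumes "Poly_Mapping.keys s \<subseteq> carrier A \<times> carrier L" "Poly_Mapping.keys t \<subseteq> carrier A \<times> carrier L"
  shows "tensor_coeff A L x (s - t) = tensor_coeff A L x s \<ominus>\<^bsub>L\<^esub> tensor_coeff A L x t"
  using tensor_coeff_add[of s "- t" x] tensor_coeff_minus[OF assms(2)] assms by (simp add: a_minus_def)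

lemma keys_diff_subset: "Poly_Mapping.keys (s :: _ \<Rightarrow>\<^sub>0 int) \<subseteq> S \<Longrightarrow> Poly_Mapping.keys t \<subseteq> S \<Longrightarrow> Poly_Mapping.keys (s - t) \<subseteq> S"
  using keys_diff[of s t] by blast

lemma keys_sum_subset: "(\<And>i. i \<in> I \<Longrightarrow> Poly_Mapping.keys (f i :: _ \<Rightarrow>\<^sub>0 int) \<subseteq> S) \<Longrightarrow> Poly_Mapping.keys (sum f I) \<subseteq> S"
  using Poly_Mapping.keys_sum[of f I] by blast

lemma relations_keys: "r \<in> tensor_relations R A L \<Longrightarrow> Poly_Mapping.keys r \<subseteq> carrier A \<times> carrier L"
  unfolding tensor_relations_def by (elim UnE CollectE exE conjE) (simp_all add: keys_diff_subset)

lemma kernel_subgroup: "subgroup Ker FA"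
  unfolding tensor_kernel_def
  by (rule group.generate_is_subgroup) (use relations_keys in auto)

lemma kernel_keys: "t \<in> Ker \<Longrightarrow> Poly_Mapping.keys t \<subseteq> carrier A \<times> carrier L"
  using subsetD[OF subgroup.subset[OF kernel_subgroup]] by simp

lemma kernel_zero: "0 \<in> Ker" using subgroup.one_closed[OF kernel_subgroup] by simp
lemma kernel_add: "s \<in> Ker \<Longrightarrow> t \<in> Ker \<Longrightarrow> s + t \<in> Ker" using subgroup.m_closed[OF kernel_subgroup] by simp
lemma kernel_minus: "t \<in> Ker \<Longrightarrow> - t \<in> Ker" using subgroup.m_inv_closed[OF kernel_subgroup, of t] kernel_keys[of t] by simp
lemma kernel_diff: "s \<in> Ker \<Longrightarrow> t \<in> Ker \<Longrightarrow> s - t \<in> Ker" using kernel_add[of s "- t"] kernel_minus by simp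
lemma kernel_sum: "(\<And>i. i \<in> I \<Longrightarrow> f i \<in> Ker) \<Longrightarrow> sum f I \<in> Ker"
  by (induction I rule: infinite_finite_induct) (auto intro: kernel_zero kernel_add)

lemma kernel_relation: "r \<in> tensor_relations R A L \<Longrightarrow> r \<in> Ker"
  unfolding tensor_kernel_def by (rule generate.incl)

lemma kernel_add_l: "x \<in> carrier A \<Longrightarrow> y \<in> carrier A \<Longrightarrow> l \<in> carrier L \<Longrightarrow>
    frag_of (x \<oplus>\<^bsub>A\<^esub> y, l) - frag_of (x, l) - frag_of (y, l) \<in> Ker"
  by (rule kernel_relation) (auto simp: tensor_relations_def)

lemma kernel_add_r: "x \<in> carrier A \<Longrightarrow> l \<in> carrier L \<Longrightarrow> k \<in> carrier L \<Longrightarrow>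
    frag_of (x, l \<oplus>\<^bsub>L\<^esub> k) - frag_of (x, l) - frag_of (x, k) \<in> Ker"
  by (rule kernel_relation) (auto simp: tensor_relations_def)

lemma kernel_smult: "a \<in> carrier R \<Longrightarrow> x \<in> carrier A \<Longrightarrow> l \<in> carrier L \<Longrightarrow>
    frag_of (a \<odot>\<^bsub>A\<^esub> x, l) - frag_of (x, a \<odot>\<^bsub>L\<^esub> l) \<in> Ker"
  by (rule kernel_relation) (auto simp: tensor_relations_def)

lemma kernel_zero_l: "l \<in> carrier L \<Longrightarrow> frag_of (\<zero>\<^bsub>A\<^esub>, l) \<in> Ker"
  using kernel_minus[OF kernel_add_l[of "\<zero>\<^bsub>A\<^esub>" "\<zero>\<^bsub>A\<^esub>" l]] by simp

lemma kernel_zero_r: "x \<in> carrier A \<Longrightarrow> frag_of (x, \<zero>\<^bsub>L\<^esub>) \<in> Ker"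
  using kernel_minus[OF kernel_add_r[of x "\<zero>\<^bsub>L\<^esub>" "\<zero>\<^bsub>L\<^esub>"]] by simp

lemma kernel_finsum_l:
  assumes "finite X" "\<And>x. x \<in> X \<Longrightarrow> f x \<in> carrier A" "l \<in> carrier L"
  shows "frag_of (\<Oplus>\<^bsub>A\<^esub>x\<in>X. f x, l) - (\<Sum>x\<in>X. frag_of (f x, l)) \<in> Ker"
  using assms(1,2)
proof (induction X rule: finite_induct)
  case empty then show ?case using kernel_zero_l[OF assms(3)] by simp
next
  case (insert x X)
  let ?s = "\<Oplus>\<^bsub>A\<^esub>x\<in>X. f x"
  have "(frag_of (f x \<oplus>\<^bsub>A\<^esub> ?s, l) - frag_of (f x, l) - frag_of (?s, l)) + (frag_of (?s, l) - (\<Sum>x\<in>X. frag_of (f x, l))) \<in> Ker"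
    using insert assms(3) by (intro kernel_add kernel_add_l) (auto intro!: A.finsum_closed)
  moreover have "(\<Oplus>\<^bsub>A\<^esub>x\<in>insert x X. f x) = f x \<oplus>\<^bsub>A\<^esub> ?s" using insert by (intro A.finsum_insert) auto
  ultimately show ?case using insert by (simp add: algebra_simps)
qed

lemma unit_relation_sum:
  assumes "finite X" "X \<subseteq> carrier A" "y \<in> X"
  shows "(\<Oplus>\<^bsub>A\<^esub>z\<in>X. (if z = y then \<one>\<^bsub>R\<^esub> else \<zero>\<^bsub>R\<^esub>) \<odot>\<^bsub>A\<^esub> z) = y"
  using A.lincombs_unit[of X "\<lambda>z. z" y] assms by auto

lemma diff_relation:
  assumes "finite X" "X \<subseteq> carrier A" "y \<in> X"
    "\<And>z. z \<in> carrier A \<Longrightarrow> a z \<in> carrier R" "\<And>z. z \<in> carrier A \<Longrightarrow> z \<notin> X \<Longrightarrow> a z = \<zero>\<^bsub>R\<^esub>"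
    "(\<Oplus>\<^bsub>A\<^esub>z\<in>X. a z \<odot>\<^bsub>A\<^esub> z) = y"
  shows "(\<lambda>z. (if z = y then \<one>\<^bsub>R\<^esub> else \<zero>\<^bsub>R\<^esub>) \<oplus>\<^bsub>R\<^esub> \<ominus>\<^bsub>R\<^esub> a z) \<in> module_relations R A"
proof -
  have "(\<Oplus>\<^bsub>A\<^esub>z\<in>X. ((if z = y then \<one>\<^bsub>R\<^esub> else \<zero>\<^bsub>R\<^esub>) \<oplus>\<^bsub>R\<^esub> \<ominus>\<^bsub>R\<^esub> a z) \<odot>\<^bsub>A\<^esub> z)
      = (\<Oplus>\<^bsub>A\<^esub>z\<in>X. (if z = y then \<one>\<^bsub>R\<^esub> else \<zero>\<^bsub>R\<^esub>) \<odot>\<^bsub>A\<^esub> z) \<oplus>\<^bsub>A\<^esub> (\<Oplus>\<^bsub>A\<^esub>z\<in>X. (\<ominus>\<^bsub>R\<^esub> a z) \<odot>\<^bsub>A\<^esub> z)"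
    by (rule A.action.lincomb_add_l) (use assms(2,4) in auto)
  also have "(\<Oplus>\<^bsub>A\<^esub>z\<in>X. (\<ominus>\<^bsub>R\<^esub> a z) \<odot>\<^bsub>A\<^esub> z) = \<ominus>\<^bsub>A\<^esub> (\<Oplus>\<^bsub>A\<^esub>z\<in>X. a z \<odot>\<^bsub>A\<^esub> z)"
    by (rule A.action.lincomb_minus_l) (use assms(1,2,4) in auto)
  also have "(\<Oplus>\<^bsub>A\<^esub>z\<in>X. (if z = y then \<one>\<^bsub>R\<^esub> else \<zero>\<^bsub>R\<^esub>) \<odot>\<^bsub>A\<^esub> z) \<oplus>\<^bsub>A\<^esub> \<ominus>\<^bsub>A\<^esub> (\<Oplus>\<^bsub>A\<^esub>z\<in>X. a z \<odot>\<^bsub>A\<^esub> z) = \<zero>\<^bsub>A\<^esub>"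
    using unit_relation_sum[OF assms(1-3)] assms(2,3,6) by (simp add: A.M.r_neg subset_iff)
  finally have sum: "(\<Oplus>\<^bsub>A\<^esub>z\<in>X. ((if z = y then \<one>\<^bsub>R\<^esub> else \<zero>\<^bsub>R\<^esub>) \<oplus>\<^bsub>R\<^esub> \<ominus>\<^bsub>R\<^esub> a z) \<odot>\<^bsub>A\<^esub> z) = \<zero>\<^bsub>A\<^esub>" .
  have supp: "(if z = y then \<one>\<^bsub>R\<^esub> else \<zero>\<^bsub>R\<^esub>) \<oplus>\<^bsub>R\<^esub> \<ominus>\<^bsub>R\<^esub> a z = \<zero>\<^bsub>R\<^esub>" if "z \<in> carrier A - X" for z
    using that assms(3,5) by auto
  show ?thesis unfolding module_relations_def
    by (intro CollectI conjI ballI exI[of _ X]) (use assms(1,2,4) supp sum in auto)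
qed

text \<open>
  Each defining relation of the tensor product becomes a relation of \<open>A\<close> times an element of \<open>L\<close>;
  additivity on the side of \<open>L\<close> already holds for the coordinates.
\<close>

lemma relation_coeff:
  assumes "r \<in> tensor_relations R A L"
  shows "scalar_extension L (carrier A) (module_relations R A) (\<lambda>z. tensor_coeff A L z r)"
  using assms unfolding tensor_relations_def
proof (elim UnE CollectE exE conjE)
  \<comment> \<open>Left additivity comes from the relation \<open>[x + y] = [x] + [y]\<close>.\<close>
  fix x y l assume r: "r = frag_of (x \<oplus>\<^bsub>A\<^esub> y, l) - frag_of (x, l) - frag_of (y, l)"
    and x: "x \<in> carrier A" and y: "y \<in> carrier A" and l: "l \<in> carrier L"
  let ?d = "\<lambda>u z. if z = u then \<one>\<^bsub>R\<^esub> else \<zero>\<^bsub>R\<^esub>"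
  let ?a = "\<lambda>z. ?d x z \<oplus>\<^bsub>R\<^esub> ?d y z"
  have bilin: "(u1 \<odot>\<^bsub>L\<^esub> l \<ominus>\<^bsub>L\<^esub> u2 \<odot>\<^bsub>L\<^esub> l) \<ominus>\<^bsub>L\<^esub> u3 \<odot>\<^bsub>L\<^esub> l = (u1 \<oplus>\<^bsub>R\<^esub> \<ominus>\<^bsub>R\<^esub> (u2 \<oplus>\<^bsub>R\<^esub> u3)) \<odot>\<^bsub>L\<^esub> l"
    if "u1 \<in> carrier R" "u2 \<in> carrier R" "u3 \<in> carrier R" for u1 u2 u3
    using that l by (simp add: a_minus_def L.smult_l_distr L.action.smult_minus_l L.M.a_assoc L.M.minus_add del: A.R.minus_add)
  let ?X = "{x \<oplus>\<^bsub>A\<^esub> y, x, y}"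
  have "(\<Oplus>\<^bsub>A\<^esub>z\<in>?X. ?a z \<odot>\<^bsub>A\<^esub> z) = (\<Oplus>\<^bsub>A\<^esub>z\<in>?X. ?d x z \<odot>\<^bsub>A\<^esub> z) \<oplus>\<^bsub>A\<^esub> (\<Oplus>\<^bsub>A\<^esub>z\<in>?X. ?d y z \<odot>\<^bsub>A\<^esub> z)"
    by (rule A.action.lincomb_add_l) (use x y in auto)
  also have "\<dots> = x \<oplus>\<^bsub>A\<^esub> y" using unit_relation_sum[of ?X x] unit_relation_sum[of ?X y] x y by simp
  finally have sum: "(\<Oplus>\<^bsub>A\<^esub>z\<in>?X. ?a z \<odot>\<^bsub>A\<^esub> z) = x \<oplus>\<^bsub>A\<^esub> y" .
  have rel: "(\<lambda>z. ?d (x \<oplus>\<^bsub>A\<^esub> y) z \<oplus>\<^bsub>R\<^esub> \<ominus>\<^bsub>R\<^esub> ?a z) \<in> module_relations R A"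
    by (rule diff_relation[of ?X]) (use x y sum in auto)
  show ?thesis
  proof (rule scalar_extension.step[OF rel l])
    show "scalar_extension L (carrier A) (module_relations R A) (\<lambda>z. \<zero>\<^bsub>L\<^esub>)"
      by (rule scalar_extension.zero) simp
    fix z assume z: "z \<in> carrier A"
    have "tensor_coeff A L z r = (?d (x \<oplus>\<^bsub>A\<^esub> y) z \<odot>\<^bsub>L\<^esub> l \<ominus>\<^bsub>L\<^esub> ?d x z \<odot>\<^bsub>L\<^esub> l) \<ominus>\<^bsub>L\<^esub> ?d y z \<odot>\<^bsub>L\<^esub> l"
      unfolding r using x y l by (simp add: tensor_coeff_diff keys_diff_subset L.smult_one)
    also have "\<dots> = (?d (x \<oplus>\<^bsub>A\<^esub> y) z \<oplus>\<^bsub>R\<^esub> \<ominus>\<^bsub>R\<^esub> ?a z) \<odot>\<^bsub>L\<^esub> l"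
      by (rule bilin) (use l in auto)
    finally show "tensor_coeff A L z r = (?d (x \<oplus>\<^bsub>A\<^esub> y) z \<oplus>\<^bsub>R\<^esub> \<ominus>\<^bsub>R\<^esub> ?a z) \<odot>\<^bsub>L\<^esub> l \<oplus>\<^bsub>L\<^esub> \<zero>\<^bsub>L\<^esub>"
      using l by simp
  qed
next
  fix x l k assume r: "r = frag_of (x, l \<oplus>\<^bsub>L\<^esub> k) - frag_of (x, l) - frag_of (x, k)"
    and x: "x \<in> carrier A" and l: "l \<in> carrier L" and k: "k \<in> carrier L"
  have "tensor_coeff A L z r = \<zero>\<^bsub>L\<^esub>" for z
    unfolding r using x l k
    by (simp add: tensor_coeff_diff keys_diff_subset a_minus_def L.M.a_ac L.M.r_neg L.M.r_neg1 L.M.r_neg2)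
  then show ?thesis by (intro scalar_extension.zero)
next
  \<comment> \<open>Balancedness comes from the relation \<open>[x a] = [x] a\<close>.\<close>
  fix a x l assume r: "r = frag_of (a \<odot>\<^bsub>A\<^esub> x, l) - frag_of (x, a \<odot>\<^bsub>L\<^esub> l)"
    and a: "a \<in> carrier R" and x: "x \<in> carrier A" and l: "l \<in> carrier L"
  let ?d = "\<lambda>u z. if z = u then \<one>\<^bsub>R\<^esub> else \<zero>\<^bsub>R\<^esub>"
  let ?a = "\<lambda>z. ?d x z \<otimes>\<^bsub>R\<^esub> a"
  let ?X = "{a \<odot>\<^bsub>A\<^esub> x, x}"
  have "(\<Oplus>\<^bsub>A\<^esub>z\<in>?X. ?a z \<odot>\<^bsub>A\<^esub> z) = a \<odot>\<^bsub>A\<^esub> (\<Oplus>\<^bsub>A\<^esub>z\<in>?X. ?d x z \<odot>\<^bsub>A\<^esub> z)"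
    by (rule A.lincomb_smult[symmetric]) (use x a in auto)
  also have "\<dots> = a \<odot>\<^bsub>A\<^esub> x" using unit_relation_sum[of ?X x] x a by simp
  finally have sum: "(\<Oplus>\<^bsub>A\<^esub>z\<in>?X. ?a z \<odot>\<^bsub>A\<^esub> z) = a \<odot>\<^bsub>A\<^esub> x" .
  have rel: "(\<lambda>z. ?d (a \<odot>\<^bsub>A\<^esub> x) z \<oplus>\<^bsub>R\<^esub> \<ominus>\<^bsub>R\<^esub> ?a z) \<in> module_relations R A"
    by (rule diff_relation[of ?X]) (use a x sum in auto)
  show ?thesis
  proof (rule scalar_extension.step[OF rel l])
    show "scalar_extension L (carrier A) (module_relations R A) (\<lambda>z. \<zero>\<^bsub>L\<^esub>)"
      by (rule scalar_extension.zero) simp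
    fix z assume z: "z \<in> carrier A"
    have "tensor_coeff A L z r = ?d (a \<odot>\<^bsub>A\<^esub> x) z \<odot>\<^bsub>L\<^esub> l \<ominus>\<^bsub>L\<^esub> ?a z \<odot>\<^bsub>L\<^esub> l"
      unfolding r using a x l by (simp add: tensor_coeff_diff L.smult_one)
    also have "\<dots> = (?d (a \<odot>\<^bsub>A\<^esub> x) z \<oplus>\<^bsub>R\<^esub> \<ominus>\<^bsub>R\<^esub> ?a z) \<odot>\<^bsub>L\<^esub> l"
      using l a by (simp add: a_minus_def L.smult_l_distr L.action.smult_minus_l)
    finally show "tensor_coeff A L z r = (?d (a \<odot>\<^bsub>A\<^esub> x) z \<oplus>\<^bsub>R\<^esub> \<ominus>\<^bsub>R\<^esub> ?a z) \<odot>\<^bsub>L\<^esub> l \<oplus>\<^bsub>L\<^esub> \<zero>\<^bsub>L\<^esub>"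
      using l a by simp
  qed
qed

lemma kernel_coeff:
  assumes "t \<in> Ker"
  shows "scalar_extension L (carrier A) (module_relations R A) (\<lambda>z. tensor_coeff A L z t)"
  using assms unfolding tensor_kernel_def
proof (induction rule: generate.induct)
  case one then show ?case by (intro scalar_extension.zero) simp
next
  case (incl h) then show ?case by (rule relation_coeff)
next
  case (inv h)
  have "scalar_extension L (carrier A) (module_relations R A) (\<lambda>z. \<ominus>\<^bsub>L\<^esub> tensor_coeff A L z h)"
    by (rule L.scalar_extension_minus[OF relation_coeff[OF inv] module_relations_closed])
  then show ?case using relations_keys[OF inv] by (simp add: tensor_coeff_minus)
next
  case (eng h1 h2)
  have "Poly_Mapping.keys h1 \<subseteq> carrier A \<times> carrier L" "Poly_Mapping.keys h2 \<subseteq> carrier A \<times> carrier L"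
    using eng(1,2) kernel_keys unfolding tensor_kernel_def by auto
  then show ?case
    using L.scalar_extension_add[OF eng.IH module_relations_closed] by (simp add: tensor_coeff_add)
qed

text \<open>
  Modulo the tensor relations, terms with the same first entry can be collected.
\<close>

lemma tensor_normal_form:
  assumes "Poly_Mapping.keys t \<subseteq> carrier A \<times> carrier L"
  shows "\<forall>\<^sub>F X in finite_subsets_at_top (carrier A). t - (\<Sum>x\<in>X. frag_of (x, tensor_coeff A L x t)) \<in> Ker"
proof -
  let ?S = "carrier A \<times> carrier L"
  define P where "P s \<longleftrightarrow> Poly_Mapping.keys s \<subseteq> ?S \<and>
    (\<forall>\<^sub>F X in finite_subsets_at_top (carrier A). s - (\<Sum>x\<in>X. frag_of (x, tensor_coeff A L x s)) \<in> Ker)" for s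
  from assms have "P t"
  proof (induction t rule: frag_induction)
    case zero
    have "\<forall>\<^sub>F X in finite_subsets_at_top (carrier A). 0 - (\<Sum>x\<in>X. frag_of (x, tensor_coeff A L x 0)) \<in> Ker"
    proof (rule eventually_finite_subsets_at_top_weakI)
      fix X assume "finite X" "X \<subseteq> carrier A"
      then have "(\<Sum>x\<in>X. frag_of (x, \<zero>\<^bsub>L\<^esub>)) \<in> Ker" by (intro kernel_sum kernel_zero_r) auto
      then show "0 - (\<Sum>x\<in>X. frag_of (x, tensor_coeff A L x 0)) \<in> Ker" using kernel_minus by simp
    qed
    then show ?case by (simp add: P_def)
  next
    case (one p)
    obtain y l where p: "p = (y, l)" and y: "y \<in> carrier A" and l: "l \<in> carrier L" using one by auto
    have "\<forall>\<^sub>F X in finite_subsets_at_top (carrier A). frag_of p - (\<Sum>x\<in>X. frag_of (x, tensor_coeff A L x (frag_of p))) \<in> Ker"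
      unfolding eventually_finite_subsets_at_top
    proof (intro exI[of _ "{y}"] conjI allI impI)
      fix X assume X: "finite X \<and> {y} \<subseteq> X \<and> X \<subseteq> carrier A"
      have "(\<Sum>x\<in>X. frag_of (x, tensor_coeff A L x (frag_of p)))
          = frag_of (y, l) + (\<Sum>x\<in>X - {y}. frag_of (x, tensor_coeff A L x (frag_of p)))"
        using X y l by (subst sum.remove[of X y]) (auto simp: p)
      moreover have "(\<Sum>x\<in>X - {y}. frag_of (x, tensor_coeff A L x (frag_of p))) \<in> Ker"
        using X y l by (intro kernel_sum) (auto simp: p intro!: kernel_zero_r)
      ultimately show "frag_of p - (\<Sum>x\<in>X. frag_of (x, tensor_coeff A L x (frag_of p))) \<in> Ker"
        using kernel_minus by (simp add: p)
    qed (use y in auto)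
    then show ?case using y l by (simp add: P_def p)
  next
    case (diff s t)
    have fin: "\<forall>\<^sub>F X in finite_subsets_at_top (carrier A). X \<subseteq> carrier A"
      by (rule eventually_finite_subsets_at_top_weakI)
    have keys: "Poly_Mapping.keys s \<subseteq> ?S" "Poly_Mapping.keys t \<subseteq> ?S"
      and ev: "\<forall>\<^sub>F X in finite_subsets_at_top (carrier A). s - (\<Sum>x\<in>X. frag_of (x, tensor_coeff A L x s)) \<in> Ker"
        "\<forall>\<^sub>F X in finite_subsets_at_top (carrier A). t - (\<Sum>x\<in>X. frag_of (x, tensor_coeff A L x t)) \<in> Ker"
      using diff by (auto simp: P_def)
    from ev fin
    have "\<forall>\<^sub>F X in finite_subsets_at_top (carrier A). s - t - (\<Sum>x\<in>X. frag_of (x, tensor_coeff A L x (s - t))) \<in> Ker"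
    proof eventually_elim
      case (elim X)
      let ?s = "\<lambda>x. tensor_coeff A L x s" and ?t = "\<lambda>x. tensor_coeff A L x t"
      have "(\<Sum>x\<in>X. frag_of (x, ?s x) - frag_of (x, ?s x \<ominus>\<^bsub>L\<^esub> ?t x) - frag_of (x, ?t x)) \<in> Ker"
      proof (rule kernel_sum)
        fix x assume x: "x \<in> X"
        have c: "?s x \<in> carrier L" "?t x \<in> carrier L" using keys by auto
        have "(?s x \<ominus>\<^bsub>L\<^esub> ?t x) \<oplus>\<^bsub>L\<^esub> ?t x = ?s x" using c by (simp add: a_minus_def L.M.a_assoc L.M.l_neg)
        then show "frag_of (x, ?s x) - frag_of (x, ?s x \<ominus>\<^bsub>L\<^esub> ?t x) - frag_of (x, ?t x) \<in> Ker"
          using kernel_add_r[of x "?s x \<ominus>\<^bsub>L\<^esub> ?t x" "?t x"] x elim c by auto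
      qed
      moreover have "s - (\<Sum>x\<in>X. frag_of (x, ?s x)) \<in> Ker" "t - (\<Sum>x\<in>X. frag_of (x, ?t x)) \<in> Ker"
        using elim by auto
      ultimately have "(s - (\<Sum>x\<in>X. frag_of (x, ?s x))) - (t - (\<Sum>x\<in>X. frag_of (x, ?t x)))
        + (\<Sum>x\<in>X. frag_of (x, ?s x) - frag_of (x, ?s x \<ominus>\<^bsub>L\<^esub> ?t x) - frag_of (x, ?t x)) \<in> Ker"
        by (rule kernel_add[OF kernel_diff, rotated 2])
      then show "s - t - (\<Sum>x\<in>X. frag_of (x, tensor_coeff A L x (s - t))) \<in> Ker"
        using keys by (simp add: tensor_coeff_diff sum_subtractf sum.distrib algebra_simps)
    qed
    then show ?case using keys by (simp add: P_def keys_diff_subset)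
  qed
  then show ?thesis by (simp add: P_def)
qed

text \<open>
  For a relation \<open>g\<close> of \<open>A\<close> one has \<open>\<Sum>\<^sub>x x \<otimes> g(x) c = (\<Sum>\<^sub>x x g(x)) \<otimes> c = 0\<close>.
\<close>

lemma scalar_extension_kernel:
  assumes "scalar_extension L (carrier A) (module_relations R A) w"
  shows "\<forall>\<^sub>F X in finite_subsets_at_top (carrier A). (\<Sum>x\<in>X. frag_of (x, w x)) \<in> Ker"
  using assms
proof induction
  case (zero w)
  show ?case
    by (intro eventually_finite_subsets_at_top_weakI kernel_sum)
       (use zero in \<open>auto intro!: kernel_zero_r simp: subset_iff\<close>)
next
  case (step g c v w)
  have fin: "\<forall>\<^sub>F X in finite_subsets_at_top (carrier A). finite X \<and> X \<subseteq> carrier A"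
    by (rule eventually_finite_subsets_at_top_weakI) simp
  from module_relations_sum[OF step(1)] step.IH fin show ?case
  proof eventually_elim
    case (elim X)
    then have X: "finite X" "X \<subseteq> carrier A" by auto
    have gR: "g x \<in> carrier R" if "x \<in> X" for x using module_relations_closed step(1) X that by auto
    have vL: "v x \<in> carrier L" if "x \<in> X" for x
      using L.scalar_extension_closed[OF step(3) module_relations_closed] X that by auto
    have 1: "(\<Sum>x\<in>X. frag_of (x, w x) - frag_of (x, g x \<odot>\<^bsub>L\<^esub> c) - frag_of (x, v x)) \<in> Ker"
    proof (rule kernel_sum)
      fix x assume x: "x \<in> X"
      have "w x = g x \<odot>\<^bsub>L\<^esub> c \<oplus>\<^bsub>L\<^esub> v x" using step(4) x X by auto
      then show "frag_of (x, w x) - frag_of (x, g x \<odot>\<^bsub>L\<^esub> c) - frag_of (x, v x) \<in> Ker"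
        using kernel_add_r[of x "g x \<odot>\<^bsub>L\<^esub> c" "v x"] x X gR vL step(2) by auto
    qed
    have 2: "(\<Sum>x\<in>X. frag_of (g x \<odot>\<^bsub>A\<^esub> x, c) - frag_of (x, g x \<odot>\<^bsub>L\<^esub> c)) \<in> Ker"
      using X gR step(2) by (intro kernel_sum kernel_smult) auto
    have "frag_of (\<Oplus>\<^bsub>A\<^esub>x\<in>X. g x \<odot>\<^bsub>A\<^esub> x, c) - (\<Sum>x\<in>X. frag_of (g x \<odot>\<^bsub>A\<^esub> x, c)) \<in> Ker"
      using X gR step(2) by (intro kernel_finsum_l) auto
    then have "frag_of (\<zero>\<^bsub>A\<^esub>, c) - (\<Sum>x\<in>X. frag_of (g x \<odot>\<^bsub>A\<^esub> x, c)) \<in> Ker" using elim by simp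
    from kernel_diff[OF kernel_zero_l[OF step(2)] this]
    have 3: "(\<Sum>x\<in>X. frag_of (g x \<odot>\<^bsub>A\<^esub> x, c)) \<in> Ker" by simp
    have 4: "(\<Sum>x\<in>X. frag_of (x, v x)) \<in> Ker" using elim by simp
    have "(\<Sum>x\<in>X. frag_of (x, w x)) = (\<Sum>x\<in>X. frag_of (x, w x) - frag_of (x, g x \<odot>\<^bsub>L\<^esub> c) - frag_of (x, v x))
       - (\<Sum>x\<in>X. frag_of (g x \<odot>\<^bsub>A\<^esub> x, c) - frag_of (x, g x \<odot>\<^bsub>L\<^esub> c)) + (\<Sum>x\<in>X. frag_of (g x \<odot>\<^bsub>A\<^esub> x, c))
       + (\<Sum>x\<in>X. frag_of (x, v x))"
      by (simp add: sum_subtractf)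
    also have "\<dots> \<in> Ker" by (rule kernel_add[OF kernel_add[OF kernel_diff[OF 1 2] 3] 4])
    finally show "(\<Sum>x\<in>X. frag_of (x, w x)) \<in> Ker" .
  qed
qed

lemma kernel_coset_eq_iff:
  "Ker #>\<^bsub>FA\<^esub> s = Ker #>\<^bsub>FA\<^esub> t \<longleftrightarrow> s - t \<in> Ker"
proof
  assume "Ker #>\<^bsub>FA\<^esub> s = Ker #>\<^bsub>FA\<^esub> t"
  moreover have "0 + s \<in> Ker #>\<^bsub>FA\<^esub> s" using kernel_zero by (force simp: r_coset_def)
  ultimately have "0 + s \<in> Ker #>\<^bsub>FA\<^esub> t" by simp
  then obtain k where "k \<in> Ker" "0 + s = k + t" by (auto simp: r_coset_def)
  then show "s - t \<in> Ker" by simp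
next
  assume st: "s - t \<in> Ker"
  have sub: "Ker #>\<^bsub>FA\<^esub> a \<subseteq> Ker #>\<^bsub>FA\<^esub> b" if "a - b \<in> Ker" for a b
  proof
    fix z assume "z \<in> Ker #>\<^bsub>FA\<^esub> a"
    then obtain k where k: "k \<in> Ker" "z = k + a" by (auto simp: r_coset_def)
    then have "k + (a - b) \<in> Ker" using kernel_add that by auto
    then show "z \<in> Ker #>\<^bsub>FA\<^esub> b" by (auto simp: r_coset_def k(2) intro!: bexI[of _ "k + (a - b)"])
  qed
  have "t - s \<in> Ker" using kernel_minus[OF st] by simp
  then show "Ker #>\<^bsub>FA\<^esub> s = Ker #>\<^bsub>FA\<^esub> t" using sub st by blast
qed

text \<open>
  The isomorphism between \<open>A \<otimes> L\<close> and \<open>L\<^sup>(\<^sup>A\<^sup>)\<close> modulo \<open>K L\<close>, where \<open>K\<close> is the module of relations of \<open>A\<close>: it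
  makes the vanishing of a tensor explicit.
\<close>

theorem tensor_kernel_iff:
  assumes "Poly_Mapping.keys t \<subseteq> carrier A \<times> carrier L"
  shows "t \<in> Ker \<longleftrightarrow> scalar_extension L (carrier A) (module_relations R A) (\<lambda>z. tensor_coeff A L z t)"
proof
  assume "scalar_extension L (carrier A) (module_relations R A) (\<lambda>z. tensor_coeff A L z t)"
  from scalar_extension_kernel[OF this] tensor_normal_form[OF assms]
  have "\<forall>\<^sub>F X in finite_subsets_at_top (carrier A). t \<in> Ker"
  proof eventually_elim
    case (elim X)
    then show ?case using kernel_add[OF elim(2,1)] by simp
  qed
  then show "t \<in> Ker" by (simp add: eventually_const)
qed (rule kernel_coeff)

end

section \<open>The equational criterion for flatness\<close>

text \<open>
  Every solution in \<open>L\<close> of a finite homogeneous system of linear equations over \<open>R\<close> is a combination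
  of solutions in \<open>R\<close>.
\<close>

definition equationally_flat :: "('a, 'r) ring_scheme \<Rightarrow> ('a, 'n) module \<Rightarrow> bool" where
  "equationally_flat R L \<longleftrightarrow> (\<forall>(m::nat) (n::nat) \<rho> y.
     (\<forall>j<m. \<forall>i<n. \<rho> j i \<in> carrier R) \<longrightarrow> (\<forall>i<n. y i \<in> carrier L) \<longrightarrow>
     (\<forall>j<m. (\<Oplus>\<^bsub>L\<^esub>i\<in>{..<n}. \<rho> j i \<odot>\<^bsub>L\<^esub> y i) = \<zero>\<^bsub>L\<^esub>) \<longrightarrow>
     scalar_extension L {..<n} {h. (\<forall>i<n. h i \<in> carrier R) \<and>
       (\<forall>j<m. (\<Oplus>\<^bsub>R\<^esub>i\<in>{..<n}. \<rho> j i \<otimes>\<^bsub>R\<^esub> h i) = \<zero>\<^bsub>R\<^esub>)} y)"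

locale tensor_hom = A: tensor R A L + B: tensor R B L + hom: right_module_hom R A B \<phi>
  for R :: "('a, 'r) ring_scheme" and A :: "('a, 'm) module" and B :: "('a, 'k) module"
    and L :: "('a, 'n) module" and \<phi>
begin

abbreviation "push \<equiv> frag_extend (\<lambda>(x, l). frag_of (\<phi> x, l))"

lemma push_keys:
  assumes "Poly_Mapping.keys t \<subseteq> carrier A \<times> carrier L"
  shows "Poly_Mapping.keys (push t) \<subseteq> carrier B \<times> carrier L"
proof -
  have "Poly_Mapping.keys (case p of (x, l) \<Rightarrow> frag_of (\<phi> x, l)) \<subseteq> carrier B \<times> carrier L"
    if "p \<in> Poly_Mapping.keys t" for p
    using that assms by (cases p) auto
  then show ?thesis using keys_frag_extend[of "\<lambda>(x, l). frag_of (\<phi> x, l)" t] by blast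
qed

lemma push_kernel:
  assumes "t \<in> tensor_kernel R A L" shows "push t \<in> tensor_kernel R B L"
proof -
  have rel: "push r \<in> tensor_relations R B L" if "r \<in> tensor_relations R A L" for r
    using that unfolding tensor_relations_def[of R A L]
  proof (elim UnE CollectE exE conjE)
    fix x y l assume "r = frag_of (x \<oplus>\<^bsub>A\<^esub> y, l) - frag_of (x, l) - frag_of (y, l)"
      "x \<in> carrier A" "y \<in> carrier A" "l \<in> carrier L"
    then have "push r = frag_of (\<phi> x \<oplus>\<^bsub>B\<^esub> \<phi> y, l) - frag_of (\<phi> x, l) - frag_of (\<phi> y, l)"
      "\<phi> x \<in> carrier B" "\<phi> y \<in> carrier B" "l \<in> carrier L"
      by (simp_all add: frag_extend_diff hom.hom_add)
    then show ?thesis unfolding tensor_relations_def by blast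
  next
    fix x l k assume "r = frag_of (x, l \<oplus>\<^bsub>L\<^esub> k) - frag_of (x, l) - frag_of (x, k)"
      "x \<in> carrier A" "l \<in> carrier L" "k \<in> carrier L"
    then have "push r = frag_of (\<phi> x, l \<oplus>\<^bsub>L\<^esub> k) - frag_of (\<phi> x, l) - frag_of (\<phi> x, k)"
      "\<phi> x \<in> carrier B" "l \<in> carrier L" "k \<in> carrier L"
      by (simp_all add: frag_extend_diff)
    then show ?thesis unfolding tensor_relations_def by blast
  next
    fix a x l assume "r = frag_of (a \<odot>\<^bsub>A\<^esub> x, l) - frag_of (x, a \<odot>\<^bsub>L\<^esub> l)"
      "a \<in> carrier R" "x \<in> carrier A" "l \<in> carrier L"
    then have "push r = frag_of (a \<odot>\<^bsub>B\<^esub> \<phi> x, l) - frag_of (\<phi> x, a \<odot>\<^bsub>L\<^esub> l)"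
      "a \<in> carrier R" "\<phi> x \<in> carrier B" "l \<in> carrier L"
      by (simp_all add: frag_extend_diff hom.hom_smult)
    then show ?thesis unfolding tensor_relations_def by blast
  qed
  show ?thesis using assms unfolding tensor_kernel_def[of R A L]
  proof (induction rule: generate.induct)
    case one then show ?case using B.kernel_zero by simp
  next
    case (incl h) then show ?case using B.kernel_relation rel by blast
  next
    case (inv h)
    then show ?case using B.kernel_minus[OF B.kernel_relation[OF rel[OF inv]]] A.relations_keys[OF inv]
      by (simp add: frag_extend_minus)
  next
    case (eng h1 h2) then show ?case using B.kernel_add by (simp add: frag_extend_add)
  qed
qed

lemma tensor_map_coset:
  assumes "Poly_Mapping.keys t \<subseteq> carrier A \<times> carrier L"
  shows "tensor_map R B L \<phi> (tensor_kernel R A L #>\<^bsub>A.FA\<^esub> t) = tensor_kernel R B L #>\<^bsub>B.FA\<^esub> push t"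
proof -
  have "(\<lambda>c. tensor_kernel R B L #>\<^bsub>B.FA\<^esub> push c) ` (tensor_kernel R A L #>\<^bsub>A.FA\<^esub> t)
      = {tensor_kernel R B L #>\<^bsub>B.FA\<^esub> push t}"
  proof -
    have "tensor_kernel R B L #>\<^bsub>B.FA\<^esub> push (k + t) = tensor_kernel R B L #>\<^bsub>B.FA\<^esub> push t"
      if "k \<in> tensor_kernel R A L" for k
      unfolding B.kernel_coset_eq_iff using push_kernel[OF that] by (simp add: frag_extend_add)
    moreover have "0 + t \<in> tensor_kernel R A L #>\<^bsub>A.FA\<^esub> t" using A.kernel_zero by (force simp: r_coset_def)
    ultimately show ?thesis by (auto simp: r_coset_def image_iff)
  qed
  then show ?thesis by (simp add: tensor_map_def)
qed

lemma inj_tensor_map_iff: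
  "inj_on (tensor_map R B L \<phi>) (carrier (tensor_product R A L)) \<longleftrightarrow>
    (\<forall>t. Poly_Mapping.keys t \<subseteq> carrier A \<times> carrier L \<longrightarrow> push t \<in> tensor_kernel R B L \<longrightarrow> t \<in> tensor_kernel R A L)"
    (is "?inj \<longleftrightarrow> ?r")
proof -
  have carrier: "carrier (tensor_product R A L) =
      (\<lambda>t. tensor_kernel R A L #>\<^bsub>A.FA\<^esub> t) ` {t. Poly_Mapping.keys t \<subseteq> carrier A \<times> carrier L}"
    by (auto simp: tensor_product_def FactGroup_def RCOSETS_def)
  show ?thesis
  proof
    assume inj: ?inj
    show ?r
    proof (intro allI impI)
      fix t assume t: "Poly_Mapping.keys t \<subseteq> carrier A \<times> carrier L" "push t \<in> tensor_kernel R B L"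
      have z: "Poly_Mapping.keys (0 :: 'm \<times> 'n \<Rightarrow>\<^sub>0 int) \<subseteq> carrier A \<times> carrier L" by simp
      have "tensor_map R B L \<phi> (tensor_kernel R A L #>\<^bsub>A.FA\<^esub> t) = tensor_map R B L \<phi> (tensor_kernel R A L #>\<^bsub>A.FA\<^esub> 0)"
        unfolding tensor_map_coset[OF t(1)] tensor_map_coset[OF z] B.kernel_coset_eq_iff using t(2) by simp
      then have "tensor_kernel R A L #>\<^bsub>A.FA\<^esub> t = tensor_kernel R A L #>\<^bsub>A.FA\<^esub> 0"
        by (rule inj_onD[OF inj]) (unfold carrier, use t(1) in blast, rule imageI, use z in simp)
      then show "t \<in> tensor_kernel R A L" unfolding A.kernel_coset_eq_iff by simp
    qed
  next
    assume r: ?r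
    show ?inj unfolding carrier
    proof (rule inj_onI, elim imageE CollectE)
      fix X Y s t assume s: "Poly_Mapping.keys s \<subseteq> carrier A \<times> carrier L" "X = tensor_kernel R A L #>\<^bsub>A.FA\<^esub> s"
        and t: "Poly_Mapping.keys t \<subseteq> carrier A \<times> carrier L" "Y = tensor_kernel R A L #>\<^bsub>A.FA\<^esub> t"
        and eq: "tensor_map R B L \<phi> X = tensor_map R B L \<phi> Y"
      have "push s - push t \<in> tensor_kernel R B L"
        using eq unfolding s(2) t(2) tensor_map_coset[OF s(1)] tensor_map_coset[OF t(1)] B.kernel_coset_eq_iff .
      then have "s - t \<in> tensor_kernel R A L"
        using spec[OF r, of "s - t"] A.keys_diff_subset[OF s(1) t(1)] by (simp add: frag_extend_diff)
      then show "X = Y" unfolding s(2) t(2) A.kernel_coset_eq_iff .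
    qed
  qed
qed

lemma tensor_coeff_push_image:
  assumes "inj_on \<phi> (carrier A)" "x \<in> carrier A" "Poly_Mapping.keys t \<subseteq> carrier A \<times> carrier L"
  shows "tensor_coeff B L (\<phi> x) (push t) = tensor_coeff A L x t"
proof -
  define P where "P s \<longleftrightarrow> Poly_Mapping.keys s \<subseteq> carrier A \<times> carrier L \<and>
    tensor_coeff B L (\<phi> x) (push s) = tensor_coeff A L x s" for s
  from assms(3) have "P t"
  proof (induction t rule: frag_induction)
    case zero then show ?case by (simp add: P_def)
  next
    case (one p)
    then show ?case using assms(1,2) by (cases p) (auto simp: P_def inj_on_eq_iff)
  next
    case (diff s t)
    then show ?case
      by (simp add: P_def A.keys_diff_subset frag_extend_diff A.tensor_coeff_diff B.tensor_coeff_diff push_keys)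
  qed
  then show ?thesis by (simp add: P_def)
qed

lemma tensor_coeff_push_outside:
  assumes "z \<notin> \<phi> ` carrier A" "Poly_Mapping.keys t \<subseteq> carrier A \<times> carrier L"
  shows "tensor_coeff B L z (push t) = \<zero>\<^bsub>L\<^esub>"
proof -
  define P where "P s \<longleftrightarrow> Poly_Mapping.keys s \<subseteq> carrier A \<times> carrier L \<and>
    tensor_coeff B L z (push s) = \<zero>\<^bsub>L\<^esub>" for s
  from assms(2) have "P t"
  proof (induction t rule: frag_induction)
    case zero then show ?case by (simp add: P_def)
  next
    case (one p)
    then show ?case using assms(1) by (cases p) (auto simp: P_def)
  next
    case (diff s t)
    then show ?case
      by (simp add: P_def A.keys_diff_subset frag_extend_diff B.tensor_coeff_diff push_keys a_minus_def A.L.M.r_neg)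
  qed
  then show ?thesis by (simp add: P_def)
qed

end

lemma eventually_finite_subsets_ex:
  assumes "\<forall>\<^sub>F X in finite_subsets_at_top A. P X"
  shows "\<exists>X. finite X \<and> X \<subseteq> A \<and> P X"
  using assms unfolding eventually_finite_subsets_at_top by blast

text \<open>
  If a combination of relations of \<open>B\<close> is supported on the image of \<open>A\<close>, then it is a relation of \<open>A\<close>,
  because \<open>\<phi>\<close> is injective.  The set \<open>Z\<close> is a common support of the relations.
\<close>

lemma (in tensor_hom) relations_combination_image:
  assumes inj: "inj_on \<phi> (carrier A)"
    and g: "\<And>q. q < (p::nat) \<Longrightarrow> g q \<in> module_relations R B"
    and Z: "finite Z" "Z \<subseteq> carrier B" "\<And>q z. q < p \<Longrightarrow> z \<in> carrier B \<Longrightarrow> z \<notin> Z \<Longrightarrow> g q z = \<zero>\<^bsub>R\<^esub>"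
      "\<And>q. q < p \<Longrightarrow> (\<Oplus>\<^bsub>B\<^esub>z\<in>Z. g q z \<odot>\<^bsub>B\<^esub> z) = \<zero>\<^bsub>B\<^esub>"
    and h: "\<And>q. q < p \<Longrightarrow> h q \<in> carrier R"
      "\<And>z. z \<in> Z - \<phi> ` carrier A \<Longrightarrow> (\<Oplus>\<^bsub>R\<^esub>q\<in>{..<p}. g q z \<otimes>\<^bsub>R\<^esub> h q) = \<zero>\<^bsub>R\<^esub>"
  shows "(\<lambda>x. \<Oplus>\<^bsub>R\<^esub>q\<in>{..<p}. g q (\<phi> x) \<otimes>\<^bsub>R\<^esub> h q) \<in> module_relations R A"
proof -
  let ?G = "\<lambda>z. \<Oplus>\<^bsub>R\<^esub>q\<in>{..<p}. g q z \<otimes>\<^bsub>R\<^esub> h q"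
  have gR: "g q z \<in> carrier R" if "q < p" "z \<in> carrier B" for q z
    using B.module_relations_closed g[OF that(1)] that(2) by blast
  have GR: "?G z \<in> carrier R" if "z \<in> carrier B" for z
    using gR h(1) that by (intro A.A.R.finsum_closed) auto
  define X where "X = {x \<in> carrier A. \<phi> x \<in> Z}"
  have injX: "inj_on \<phi> X" using inj by (rule inj_on_subset) (auto simp: X_def)
  have fX: "finite X" by (rule inj_on_finite[OF injX _ Z(1)]) (auto simp: X_def)
  have XA: "X \<subseteq> carrier A" by (auto simp: X_def)
  have "\<phi> (\<Oplus>\<^bsub>A\<^esub>x\<in>X. ?G (\<phi> x) \<odot>\<^bsub>A\<^esub> x) = (\<Oplus>\<^bsub>B\<^esub>x\<in>X. ?G (\<phi> x) \<odot>\<^bsub>B\<^esub> \<phi> x)"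
    by (rule hom.hom_lincomb) (use fX XA GR in auto)
  also have "\<dots> = (\<Oplus>\<^bsub>B\<^esub>z\<in>\<phi> ` X. ?G z \<odot>\<^bsub>B\<^esub> z)"
    by (rule B.A.M.finsum_reindex[symmetric]) (use injX XA GR in auto)
  also have "\<dots> = (\<Oplus>\<^bsub>B\<^esub>z\<in>Z. ?G z \<odot>\<^bsub>B\<^esub> z)"
  proof (rule B.A.M.add.finprod_mono_neutral_cong_left[OF Z(1)])
    show "\<phi> ` X \<subseteq> Z" by (auto simp: X_def)
    show "?G z \<odot>\<^bsub>B\<^esub> z = \<zero>\<^bsub>B\<^esub>" if "z \<in> Z - \<phi> ` X" for z
    proof -
      have "z \<in> Z - \<phi> ` carrier A" using that by (auto simp: X_def)
      then show ?thesis using h(2) Z(2) by auto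
    qed
  qed (use Z(2) GR in auto)
  also have "\<dots> = (\<Oplus>\<^bsub>B\<^esub>q\<in>{..<p}. h q \<odot>\<^bsub>B\<^esub> (\<Oplus>\<^bsub>B\<^esub>z\<in>Z. g q z \<odot>\<^bsub>B\<^esub> z))"
    by (rule B.A.lincomb_lincomb) (use Z(1,2) gR h(1) in auto)
  also have "\<dots> = \<zero>\<^bsub>B\<^esub>"
    by (rule B.A.M.add.finprod_one_eqI[simplified]) (use Z(4) h(1) in auto)
  finally have "\<phi> (\<Oplus>\<^bsub>A\<^esub>x\<in>X. ?G (\<phi> x) \<odot>\<^bsub>A\<^esub> x) = \<phi> \<zero>\<^bsub>A\<^esub>" by simp
  then have sum: "(\<Oplus>\<^bsub>A\<^esub>x\<in>X. ?G (\<phi> x) \<odot>\<^bsub>A\<^esub> x) = \<zero>\<^bsub>A\<^esub>"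
    by (rule inj_onD[OF inj]) (use XA GR in \<open>auto intro!: A.A.M.finsum_closed A.A.action.smult_closed\<close>)
  have supp: "?G (\<phi> x) = \<zero>\<^bsub>R\<^esub>" if "x \<in> carrier A - X" for x
    by (rule A.A.R.add.finprod_one_eqI[simplified]) (use that Z(3) h(1) in \<open>auto simp: X_def\<close>)
  show ?thesis unfolding module_relations_def
    by (intro CollectI conjI ballI exI[of _ X]) (use fX XA GR supp sum in auto)
qed

text \<open>
  Let a tensor \<open>t\<close> over \<open>A\<close> vanish over \<open>B\<close>, so that its coordinates are \<open>\<Sum>\<^sub>q g\<^sub>q(z) c\<^sub>q\<close> with relations \<open>g\<^sub>q\<close> of
  \<open>B\<close>.  The coordinates outside the image of \<open>A\<close> are zero, which is a finite system of equations for
  \<open>c\<close>.  Expressing \<open>c\<close> by solutions \<open>h\<close> in \<open>R\<close> replaces the \<open>g\<^sub>q\<close> by the combinations \<open>\<Sum>\<^sub>q g\<^sub>q h\<^sub>q\<close>, which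
  vanish outside the image of \<open>A\<close> and are therefore relations of \<open>A\<close>.
\<close>

theorem flat_if_equationally_flat:
  assumes "left_module R L" "equationally_flat R L"
  shows "flat_left_module R L TYPE('u)"
  unfolding flat_left_module_def
proof (intro conjI allI impI assms(1))
  fix A B :: "('a, 'u) module" and \<phi>
  assume *: "right_module R A \<and> right_module R B \<and> \<phi> \<in> rmodule_hom R A B \<and> inj_on \<phi> (carrier A)"
  then have inj: "inj_on \<phi> (carrier A)" by simp
  interpret tensor_hom R A B L \<phi>
    by (intro tensor_hom.intro tensor.intro right_module_hom.intro) (use * assms(1) in \<open>auto simp: right_module_hom_axioms_def\<close>)
  have "t \<in> tensor_kernel R A L"
    if t: "Poly_Mapping.keys t \<subseteq> carrier A \<times> carrier L" and push: "push t \<in> tensor_kernel R B L" for t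
  proof -
    obtain p :: nat and g c where g: "\<And>q. q < p \<Longrightarrow> g q \<in> module_relations R B" and c: "\<And>q. q < p \<Longrightarrow> c q \<in> carrier L"
      and w: "\<And>z. z \<in> carrier B \<Longrightarrow> tensor_coeff B L z (push t) = (\<Oplus>\<^bsub>L\<^esub>q\<in>{..<p}. g q z \<odot>\<^bsub>L\<^esub> c q)"
      using A.L.scalar_extensionE[OF B.kernel_coeff[OF push] B.module_relations_closed] by blast
    have gR: "g q z \<in> carrier R" if "q < p" "z \<in> carrier B" for q z
      using B.module_relations_closed g[OF that(1)] that(2) by blast
    \<comment> \<open>A finite set carrying all the relations \<open>g q\<close>.\<close>
    have "\<forall>\<^sub>F Z in finite_subsets_at_top (carrier B). \<forall>q\<in>{..<p}.
        (\<forall>z\<in>carrier B - Z. g q z = \<zero>\<^bsub>R\<^esub>) \<and> (\<Oplus>\<^bsub>B\<^esub>z\<in>Z. g q z \<odot>\<^bsub>B\<^esub> z) = \<zero>\<^bsub>B\<^esub>"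
    proof (rule eventually_ball_finite)
      show "\<forall>q\<in>{..<p}. \<forall>\<^sub>F Z in finite_subsets_at_top (carrier B).
          (\<forall>z\<in>carrier B - Z. g q z = \<zero>\<^bsub>R\<^esub>) \<and> (\<Oplus>\<^bsub>B\<^esub>z\<in>Z. g q z \<odot>\<^bsub>B\<^esub> z) = \<zero>\<^bsub>B\<^esub>"
        using g by (intro ballI eventually_conj B.module_relations_support B.module_relations_sum) auto
    qed simp
    from eventually_finite_subsets_ex[OF this] obtain Z where Z: "finite Z" "Z \<subseteq> carrier B"
      "\<And>q. q < p \<Longrightarrow> (\<forall>z\<in>carrier B - Z. g q z = \<zero>\<^bsub>R\<^esub>) \<and> (\<Oplus>\<^bsub>B\<^esub>z\<in>Z. g q z \<odot>\<^bsub>B\<^esub> z) = \<zero>\<^bsub>B\<^esub>"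
      by (elim exE conjE) (rule that, assumption, assumption, erule bspec, simp)
    obtain e where e: "bij_betw e {..<card (Z - \<phi> ` carrier A)} (Z - \<phi> ` carrier A)"
      using ex_bij_betw_nat_finite[of "Z - \<phi> ` carrier A"] Z(1) by (auto simp: atLeast0LessThan)
    let ?m = "card (Z - \<phi> ` carrier A)"
    have eZ: "e j \<in> Z - \<phi> ` carrier A" if "j < ?m" for j using e that by (auto simp: bij_betw_def)
    let ?H = "{h. (\<forall>q<p. h q \<in> carrier R) \<and> (\<forall>j<?m. (\<Oplus>\<^bsub>R\<^esub>q\<in>{..<p}. g q (e j) \<otimes>\<^bsub>R\<^esub> h q) = \<zero>\<^bsub>R\<^esub>)}"
    \<comment> \<open>Outside the image of \<open>A\<close> the tensor has no coefficient: a system of equations on \<open>c\<close>.\<close>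
    have sys: "(\<Oplus>\<^bsub>L\<^esub>q\<in>{..<p}. g q (e j) \<odot>\<^bsub>L\<^esub> c q) = \<zero>\<^bsub>L\<^esub>" if "j < ?m" for j
      using w[of "e j"] eZ[OF that] Z(2) tensor_coeff_push_outside[OF _ t] by auto
    have "scalar_extension L {..<p} ?H c"
      using assms(2)[unfolded equationally_flat_def, rule_format, where m = ?m and n = p and \<rho> = "\<lambda>j q. g q (e j)" and y = c]
        gR eZ Z(2) c sys by blast
    then have "scalar_extension L (carrier A) (module_relations R A) (\<lambda>x. \<Oplus>\<^bsub>L\<^esub>q\<in>{..<p}. g q (\<phi> x) \<odot>\<^bsub>L\<^esub> c q)"
    proof induction
      case (zero c)
      show ?case
        by (rule scalar_extension.zero, rule A.L.M.add.finprod_one_eqI[simplified]) (use zero gR in auto)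
    next
      case (step h d v c)
      have h: "\<And>q. q < p \<Longrightarrow> h q \<in> carrier R" using step(1) by simp
      have vL: "v q \<in> carrier L" if "q < p" for q
        using A.L.scalar_extension_closed[OF step(3)] that by simp
      have "(\<Oplus>\<^bsub>R\<^esub>q\<in>{..<p}. g q z \<otimes>\<^bsub>R\<^esub> h q) = \<zero>\<^bsub>R\<^esub>" if "z \<in> Z - \<phi> ` carrier A" for z
      proof -
        have "z \<in> e ` {..<?m}" using e that by (auto simp: bij_betw_def)
        then show ?thesis using step(1) by auto
      qed
      then have rel: "(\<lambda>x. \<Oplus>\<^bsub>R\<^esub>q\<in>{..<p}. g q (\<phi> x) \<otimes>\<^bsub>R\<^esub> h q) \<in> module_relations R A"
        by (intro relations_combination_image[OF inj g Z(1,2) _ _ h]) (use Z(3) in auto)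
      show ?case
      proof (rule scalar_extension.step[OF rel step(2) step.IH])
        fix x assume "x \<in> carrier A"
        then show "(\<Oplus>\<^bsub>L\<^esub>q\<in>{..<p}. g q (\<phi> x) \<odot>\<^bsub>L\<^esub> c q)
            = (\<Oplus>\<^bsub>R\<^esub>q\<in>{..<p}. g q (\<phi> x) \<otimes>\<^bsub>R\<^esub> h q) \<odot>\<^bsub>L\<^esub> d \<oplus>\<^bsub>L\<^esub> (\<Oplus>\<^bsub>L\<^esub>q\<in>{..<p}. g q (\<phi> x) \<odot>\<^bsub>L\<^esub> v q)"
          by (intro A.L.lincomb_step) (use gR h vL step(2,4) in auto)
      qed
    qed
    then have "scalar_extension L (carrier A) (module_relations R A) (\<lambda>x. tensor_coeff A L x t)"
      by (rule scalar_extension_cong) (use w tensor_coeff_push_image[OF inj _ t] in \<open>auto simp flip: w\<close>)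
    then show ?thesis using A.tensor_kernel_iff[OF t] by simp
  qed
  then show "inj_on (tensor_map R B L \<phi>) (carrier (tensor_product R A L))"
    unfolding inj_tensor_map_iff by blast
qed

text \<open>
  Here \<open>a\<close> expresses the generators \<open>s\<^sub>i\<close> of \<open>N\<close> by the elements of a finite set \<open>X\<close>, and \<open>y\<close> is annihilated
  by the resulting matrix.  Hence \<open>t = \<Sum> s\<^sub>i \<otimes> y\<^sub>i\<close> vanishes over \<open>F\<close>, so it vanishes over \<open>N\<close> by
  flatness.  The coordinates of \<open>t\<close> are then a combination of relations of \<open>N\<close>; a lift of \<open>N\<close> to \<open>R\<^sup>n\<close> that
  sends \<open>s\<^sub>i\<close> to the unit vector \<open>e\<^sub>i\<close> turns relations of \<open>N\<close> into elements of the kernel of \<open>R\<^sup>n \<rightarrow> N\<close>,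
  and the coordinates of \<open>t\<close> into \<open>y\<close>.
\<close>

theorem flat_generators:
  fixes F :: "('a, 'u) module"
  assumes flat: "flat_left_module R L TYPE('u)"
    and F: "right_module R F" and N: "submodule N R F"
    and inj: "inj_on s {..<n::nat}" and s: "\<And>i. i < n \<Longrightarrow> s i \<in> N"
    and gen: "N = (\<lambda>a. \<Oplus>\<^bsub>F\<^esub>i\<in>{..<n}. a i \<odot>\<^bsub>F\<^esub> s i) ` ({..<n} \<rightarrow>\<^sub>E carrier R)"
    and y: "\<And>i. i < n \<Longrightarrow> y i \<in> carrier L"
    and a: "\<And>i x. i < n \<Longrightarrow> x \<in> carrier F \<Longrightarrow> a i x \<in> carrier R"
    and X: "finite X" "X \<subseteq> carrier F" "\<And>i x. i < n \<Longrightarrow> x \<in> carrier F \<Longrightarrow> x \<notin> X \<Longrightarrow> a i x = \<zero>\<^bsub>R\<^esub>"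
    and expand: "\<And>i. i < n \<Longrightarrow> (\<Oplus>\<^bsub>F\<^esub>x\<in>X. a i x \<odot>\<^bsub>F\<^esub> x) = s i"
    and zero: "\<And>x. x \<in> X \<Longrightarrow> (\<Oplus>\<^bsub>L\<^esub>i\<in>{..<n}. a i x \<odot>\<^bsub>L\<^esub> y i) = \<zero>\<^bsub>L\<^esub>"
  shows "scalar_extension L {..<n} {k \<in> {..<n} \<rightarrow>\<^sub>E carrier R. (\<Oplus>\<^bsub>F\<^esub>i\<in>{..<n}. k i \<odot>\<^bsub>F\<^esub> s i) = \<zero>\<^bsub>F\<^esub>} y"
    (is "scalar_extension L {..<n} ?K y")
proof -
  interpret F: right_module R F by fact
  let ?N = "F\<lparr>carrier := N\<rparr>"
  have L: "left_module R L" using flat by (simp add: flat_left_module_def)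
  have Nm: "right_module R ?N" by (rule F.right_module_submodule[OF N])
  have NF: "N \<subseteq> carrier F" using N by (simp add: F.submodule_iff)
  have id: "id \<in> rmodule_hom R ?N F" using NF by (auto simp: rmodule_hom_def hom_def)
  interpret tensor_hom R ?N F L id
    by (intro tensor_hom.intro tensor.intro right_module_hom.intro) (use F L Nm id in \<open>auto simp: right_module_hom_axioms_def\<close>)
  let ?t = "\<Sum>i<n. frag_of (s i, y i)"
  have keysN: "Poly_Mapping.keys ?t \<subseteq> carrier ?N \<times> carrier L"
    by (rule A.keys_sum_subset) (use s y in auto)
  have keysF: "Poly_Mapping.keys ?t \<subseteq> carrier F \<times> carrier L" using keysN NF by auto
  have sF: "s i \<in> carrier F" if "i < n" for i using s[OF that] NF by auto
  let ?d = "\<lambda>i x. if x = s i then \<one>\<^bsub>R\<^esub> else \<zero>\<^bsub>R\<^esub>"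
  have coeffF: "tensor_coeff F L x (\<Sum>i<k. frag_of (s i, y i)) = (\<Oplus>\<^bsub>L\<^esub>i\<in>{..<k}. ?d i x \<odot>\<^bsub>L\<^esub> y i)" if "k \<le> n" for x k
    using that
  proof (induction k)
    case 0 then show ?case by simp
  next
    case (Suc k)
    have sum: "Poly_Mapping.keys (\<Sum>i<k. frag_of (s i, y i)) \<subseteq> carrier F \<times> carrier L"
      by (rule A.keys_sum_subset) (use sF y Suc.prems in auto)
    have fr: "Poly_Mapping.keys (frag_of (s k, y k)) \<subseteq> carrier F \<times> carrier L" using sF y Suc.prems by auto
    have "tensor_coeff F L x (\<Sum>i<Suc k. frag_of (s i, y i)) = ?d k x \<odot>\<^bsub>L\<^esub> y k \<oplus>\<^bsub>L\<^esub> (\<Oplus>\<^bsub>L\<^esub>i\<in>{..<k}. ?d i x \<odot>\<^bsub>L\<^esub> y i)"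
      using Suc B.tensor_coeff_add[OF fr sum] sF y by (simp add: add.commute A.L.smult_one)
    also have "\<dots> = (\<Oplus>\<^bsub>L\<^esub>i\<in>{..<Suc k}. ?d i x \<odot>\<^bsub>L\<^esub> y i)"
      unfolding lessThan_Suc using y Suc.prems by (intro A.L.M.finsum_insert[symmetric]) auto
    finally show ?case .
  qed
  have "scalar_extension L (carrier F) (module_relations R F) (\<lambda>x. tensor_coeff F L x ?t)"
  proof (rule A.L.scalar_extensionI[where p = n and c = y and g = "\<lambda>i x. ?d i x \<oplus>\<^bsub>R\<^esub> \<ominus>\<^bsub>R\<^esub> a i x"])
    fix i assume i: "i < n"
    let ?Y = "insert (s i) X"
    have "(\<Oplus>\<^bsub>F\<^esub>x\<in>X. a i x \<odot>\<^bsub>F\<^esub> x) = (\<Oplus>\<^bsub>F\<^esub>x\<in>?Y. a i x \<odot>\<^bsub>F\<^esub> x)"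
      by (rule F.M.add.finprod_mono_neutral_cong_left) (use X a i sF[OF i] in auto)
    then show "(\<lambda>x. ?d i x \<oplus>\<^bsub>R\<^esub> \<ominus>\<^bsub>R\<^esub> a i x) \<in> module_relations R F"
      by (intro B.diff_relation[of ?Y]) (use X a i sF[OF i] expand[OF i] in auto)
  next
    fix x assume x: "x \<in> carrier F"
    have "(\<Oplus>\<^bsub>L\<^esub>i\<in>{..<n}. a i x \<odot>\<^bsub>L\<^esub> y i) = \<zero>\<^bsub>L\<^esub>"
    proof (cases "x \<in> X")
      case False
      then show ?thesis by (intro A.L.action.lincomb_zero_l) (use X(3) x y in auto)
    qed (rule zero)
    then have "(\<Oplus>\<^bsub>L\<^esub>i\<in>{..<n}. (\<ominus>\<^bsub>R\<^esub> a i x) \<odot>\<^bsub>L\<^esub> y i) = \<ominus>\<^bsub>L\<^esub> \<zero>\<^bsub>L\<^esub>"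
      using A.L.action.lincomb_minus_l[of "{..<n}" "\<lambda>i. a i x" y] a x y by simp
    then have minus: "(\<Oplus>\<^bsub>L\<^esub>i\<in>{..<n}. (\<ominus>\<^bsub>R\<^esub> a i x) \<odot>\<^bsub>L\<^esub> y i) = \<zero>\<^bsub>L\<^esub>"
      using A.L.M.minus_equality[of "\<zero>\<^bsub>L\<^esub>" "\<zero>\<^bsub>L\<^esub>"] by simp
    have "(\<Oplus>\<^bsub>L\<^esub>i\<in>{..<n}. (?d i x \<oplus>\<^bsub>R\<^esub> \<ominus>\<^bsub>R\<^esub> a i x) \<odot>\<^bsub>L\<^esub> y i)
        = (\<Oplus>\<^bsub>L\<^esub>i\<in>{..<n}. ?d i x \<odot>\<^bsub>L\<^esub> y i) \<oplus>\<^bsub>L\<^esub> (\<Oplus>\<^bsub>L\<^esub>i\<in>{..<n}. (\<ominus>\<^bsub>R\<^esub> a i x) \<odot>\<^bsub>L\<^esub> y i)"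
      by (rule A.L.action.lincomb_add_l) (use a x y in auto)
    then show "tensor_coeff F L x ?t = (\<Oplus>\<^bsub>L\<^esub>i\<in>{..<n}. (?d i x \<oplus>\<^bsub>R\<^esub> \<ominus>\<^bsub>R\<^esub> a i x) \<odot>\<^bsub>L\<^esub> y i)"
      unfolding coeffF[OF order.refl] minus using B.tensor_coeff_closed[OF keysF, of x] unfolding coeffF[OF order.refl] by simp
  qed (use y B.module_relations_closed in auto)
  then have "?t \<in> tensor_kernel R F L" using B.tensor_kernel_iff[OF keysF] by simp
  moreover have "push ?t = ?t" using frag_expansion[of ?t] by (simp add: id_def case_prod_beta')
  moreover have "inj_on (tensor_map R F L id) (carrier (tensor_product R ?N L))"
    using flat F Nm id unfolding flat_left_module_def by auto
  ultimately have "?t \<in> tensor_kernel R ?N L"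
    using inj_tensor_map_iff[THEN iffD1, THEN spec, of ?t] keysN by simp
  \<comment> \<open>Lift every element of \<open>N\<close> to the free module, the generators to the unit vectors.\<close>
  note kerN = A.kernel_coeff[OF this]
  have "\<forall>x\<in>N. \<exists>k. k \<in> {..<n} \<rightarrow>\<^sub>E carrier R \<and> (\<Oplus>\<^bsub>F\<^esub>i\<in>{..<n}. k i \<odot>\<^bsub>F\<^esub> s i) = x" using gen by auto
  then obtain v0 where v0: "\<And>x. x \<in> N \<Longrightarrow> v0 x \<in> {..<n} \<rightarrow>\<^sub>E carrier R \<and> (\<Oplus>\<^bsub>F\<^esub>i\<in>{..<n}. v0 x i \<odot>\<^bsub>F\<^esub> s i) = x" by metis
  define v where "v x = (if x \<in> s ` {..<n} then (\<lambda>i\<in>{..<n}. ?d i x) else v0 x)" for x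
  have v: "v x \<in> {..<n} \<rightarrow>\<^sub>E carrier R" "(\<Oplus>\<^bsub>F\<^esub>i\<in>{..<n}. v x i \<odot>\<^bsub>F\<^esub> s i) = x" if "x \<in> N" for x
  proof -
    show "v x \<in> {..<n} \<rightarrow>\<^sub>E carrier R" using v0[OF that] by (auto simp: v_def)
    show "(\<Oplus>\<^bsub>F\<^esub>i\<in>{..<n}. v x i \<odot>\<^bsub>F\<^esub> s i) = x"
    proof (cases "x \<in> s ` {..<n}")
      case True
      then obtain j where j: "j < n" "x = s j" by auto
      have "(\<Oplus>\<^bsub>F\<^esub>i\<in>{..<n}. v x i \<odot>\<^bsub>F\<^esub> s i) = (\<Oplus>\<^bsub>F\<^esub>i\<in>{..<n}. (if i = j then \<one>\<^bsub>R\<^esub> else \<zero>\<^bsub>R\<^esub>) \<odot>\<^bsub>F\<^esub> s i)"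
        by (rule F.M.finsum_cong') (use j sF inj in \<open>auto simp: v_def inj_on_eq_iff\<close>)
      also have "\<dots> = x" using F.lincombs_unit[of "{..<n}" s j] sF j by simp
      finally show ?thesis .
    qed (use v0[OF that] in \<open>simp add: v_def\<close>)
  qed
  have vR: "v x i \<in> carrier R" if "x \<in> N" "i < n" for x i using v(1)[OF that(1)] that(2) by auto
  have "\<forall>\<^sub>F X in finite_subsets_at_top N. scalar_extension L {..<n} ?K (\<lambda>i. \<Oplus>\<^bsub>L\<^esub>x\<in>X. v x i \<odot>\<^bsub>L\<^esub> tensor_coeff ?N L x ?t)"
    using kerN
  proof induction
    case (zero w)
    show ?case
    proof (intro eventually_finite_subsets_at_top_weakI scalar_extension.zero)
      fix X i assume "finite X" "X \<subseteq> N" "i \<in> {..<n}"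
      then show "(\<Oplus>\<^bsub>L\<^esub>x\<in>X. v x i \<odot>\<^bsub>L\<^esub> w x) = \<zero>\<^bsub>L\<^esub>"
        by (intro A.L.M.add.finprod_one_eqI[simplified]) (use zero vR in \<open>auto simp: subset_iff\<close>)
    qed
  next
    case (step g c w' w)
    have fin: "\<forall>\<^sub>F X in finite_subsets_at_top N. finite X \<and> X \<subseteq> N"
      by (rule eventually_finite_subsets_at_top_weakI) simp
    have "\<forall>\<^sub>F X in finite_subsets_at_top N. (\<Oplus>\<^bsub>?N\<^esub>x\<in>X. g x \<odot>\<^bsub>?N\<^esub> x) = \<zero>\<^bsub>?N\<^esub>"
      using A.module_relations_sum[OF step(1)] by simp
    from this step.IH fin show ?case
    proof eventually_elim
      case (elim X)
      then have X: "finite X" "X \<subseteq> N" by auto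
      have gR: "g x \<in> carrier R" if "x \<in> X" for x using A.module_relations_closed step(1) X that by auto
      have wL: "w' x \<in> carrier L" if "x \<in> X" for x
        using A.L.scalar_extension_closed[OF step(3) A.module_relations_closed] X that by auto
      let ?k = "\<lambda>i\<in>{..<n}. \<Oplus>\<^bsub>R\<^esub>x\<in>X. v x i \<otimes>\<^bsub>R\<^esub> g x"
      have kR: "?k \<in> {..<n} \<rightarrow>\<^sub>E carrier R"
        using vR gR X by (auto intro!: F.R.finsum_closed simp: subset_iff)
      have "(\<Oplus>\<^bsub>F\<^esub>i\<in>{..<n}. ?k i \<odot>\<^bsub>F\<^esub> s i) = (\<Oplus>\<^bsub>F\<^esub>i\<in>{..<n}. (\<Oplus>\<^bsub>R\<^esub>x\<in>X. v x i \<otimes>\<^bsub>R\<^esub> g x) \<odot>\<^bsub>F\<^esub> s i)"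
        using vR gR X sF by (intro F.M.finsum_cong') (auto intro!: F.R.finsum_closed F.action.smult_closed simp: subset_iff)
      also have "\<dots> = (\<Oplus>\<^bsub>F\<^esub>x\<in>X. g x \<odot>\<^bsub>F\<^esub> (\<Oplus>\<^bsub>F\<^esub>i\<in>{..<n}. v x i \<odot>\<^bsub>F\<^esub> s i))"
        by (rule F.lincomb_lincomb) (use vR gR X sF in \<open>auto simp: subset_iff\<close>)
      also have "\<dots> = (\<Oplus>\<^bsub>F\<^esub>x\<in>X. g x \<odot>\<^bsub>F\<^esub> x)"
        using v(2) gR X NF by (intro F.M.finsum_cong') (auto simp: subset_iff)
      also have "\<dots> = (\<Oplus>\<^bsub>?N\<^esub>x\<in>X. g x \<odot>\<^bsub>?N\<^esub> x)"
        using hom.hom_sum[of X "\<lambda>x. g x \<odot>\<^bsub>?N\<^esub> x"] X gR N by (auto simp: F.submodule_iff subset_iff)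
      also have "\<dots> = \<zero>\<^bsub>F\<^esub>" using elim by simp
      finally have kK: "?k \<in> ?K" using kR by simp
      show ?case
      proof (rule scalar_extension.step[OF kK step(2) elim(2)])
        fix i assume "i \<in> {..<n}"
        then have i: "i < n" by simp
        have "(\<Oplus>\<^bsub>L\<^esub>x\<in>X. v x i \<odot>\<^bsub>L\<^esub> w x)
            = (\<Oplus>\<^bsub>R\<^esub>x\<in>X. v x i \<otimes>\<^bsub>R\<^esub> g x) \<odot>\<^bsub>L\<^esub> c \<oplus>\<^bsub>L\<^esub> (\<Oplus>\<^bsub>L\<^esub>x\<in>X. v x i \<odot>\<^bsub>L\<^esub> w' x)"
          by (rule A.L.lincomb_step) (use X vR i gR wL step(2,4) in \<open>auto simp: subset_iff\<close>)
        then show "(\<Oplus>\<^bsub>L\<^esub>x\<in>X. v x i \<odot>\<^bsub>L\<^esub> w x) = ?k i \<odot>\<^bsub>L\<^esub> c \<oplus>\<^bsub>L\<^esub> (\<Oplus>\<^bsub>L\<^esub>x\<in>X. v x i \<odot>\<^bsub>L\<^esub> w' x)"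
          using i by simp
      qed
    qed
  qed
  then obtain X0 where X0: "finite X0" "X0 \<subseteq> N"
    and ext0: "\<forall>X. finite X \<and> X0 \<subseteq> X \<and> X \<subseteq> N \<longrightarrow>
      scalar_extension L {..<n} ?K (\<lambda>i. \<Oplus>\<^bsub>L\<^esub>x\<in>X. v x i \<odot>\<^bsub>L\<^esub> tensor_coeff ?N L x ?t)"
    unfolding eventually_finite_subsets_at_top by (elim exE conjE) (rule that)
  let ?X = "X0 \<union> s ` {..<n}"
  have ext: "scalar_extension L {..<n} ?K (\<lambda>i. \<Oplus>\<^bsub>L\<^esub>x\<in>?X. v x i \<odot>\<^bsub>L\<^esub> tensor_coeff ?N L x ?t)"
    by (rule ext0[rule_format]) (use X0 s in auto)
  have coeffN: "tensor_coeff ?N L x ?t = (\<Oplus>\<^bsub>L\<^esub>i\<in>{..<n}. ?d i x \<odot>\<^bsub>L\<^esub> y i)" if "x \<in> N" for x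
    using tensor_coeff_push_image[of x ?t] that keysN \<open>push ?t = ?t\<close> coeffF[of n x] by simp
  have coeff_s: "tensor_coeff ?N L (s j) ?t = y j" if "j < n" for j
  proof -
    have "tensor_coeff ?N L (s j) ?t = (\<Oplus>\<^bsub>L\<^esub>i\<in>{..<n}. ?d i (s j) \<odot>\<^bsub>L\<^esub> y i)" by (rule coeffN[OF s[OF that]])
    also have "\<dots> = ?d j (s j) \<odot>\<^bsub>L\<^esub> y j"
      by (rule A.L.action.lincomb_single) (use that y inj in \<open>auto simp: inj_on_eq_iff\<close>)
    finally show ?thesis using y[OF that] by (simp add: A.L.smult_one)
  qed
  have coeff_0: "tensor_coeff ?N L x ?t = \<zero>\<^bsub>L\<^esub>" if "x \<in> N" "x \<notin> s ` {..<n}" for x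
    unfolding coeffN[OF that(1)] by (rule A.L.action.lincomb_zero_l) (use that y in auto)
  show ?thesis
  proof (rule scalar_extension_cong[OF ext])
    fix i assume "i \<in> {..<n}"
    then have i: "i < n" by simp
    have summand: "v x i \<odot>\<^bsub>L\<^esub> tensor_coeff ?N L x ?t = (if s i = x then y i else \<zero>\<^bsub>L\<^esub>)" if x: "x \<in> ?X" for x
    proof (cases "x \<in> s ` {..<n}")
      case True
      then obtain j where j: "j < n" "x = s j" by auto
      then show ?thesis using i inj y coeff_s[OF j(1)] by (auto simp: v_def inj_on_eq_iff A.L.smult_one)
    next
      case False
      then have "x \<in> N" using x X0 by auto
      then show ?thesis using False coeff_0 vR i by auto
    qed
    have "(\<Oplus>\<^bsub>L\<^esub>x\<in>?X. v x i \<odot>\<^bsub>L\<^esub> tensor_coeff ?N L x ?t) = (\<Oplus>\<^bsub>L\<^esub>x\<in>?X. if s i = x then y i else \<zero>\<^bsub>L\<^esub>)"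
      by (rule A.L.M.finsum_cong') (use summand y i in auto)
    also have "\<dots> = y i" using A.L.M.finsum_singleton[of "s i" ?X "\<lambda>_. y i"] X0(1) i y by auto
    finally show "y i = (\<Oplus>\<^bsub>L\<^esub>x\<in>?X. v x i \<odot>\<^bsub>L\<^esub> tensor_coeff ?N L x ?t)" by simp
  qed
qed

section \<open>Coherence implies flatness\<close>

lemma scalar_extension_mono:
  assumes "scalar_extension L X K w" "K \<subseteq> K'"
  shows "scalar_extension L X K' w"
  using assms(1)
proof induction
  case (zero w) then show ?case by (intro scalar_extension.zero) simp
next
  case (step g c v w)
  show ?case by (rule scalar_extension.step[OF _ step(2) step.IH step(4)]) (use step(1) assms(2) in auto)
qed

lemma (in ring) unit_vec_inj:
  assumes "\<one> \<noteq> \<zero>" shows "inj_on (unit_vec R m) {..<m}"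
proof (rule inj_onI)
  fix i j assume ij: "i \<in> {..<m}" "j \<in> {..<m}" "unit_vec R m i = unit_vec R m j"
  then have "unit_vec R m i i = unit_vec R m j i" by simp
  then show "i = j" using ij assms by (auto simp: unit_vec_def split: if_splits)
qed

text \<open>
  An injective image of \<open>R\<^sup>m\<close> has the images of the unit vectors as a basis.  Over the zero ring the unit
  vectors coincide, and the basis condition is checked separately.
\<close>

lemma free_image_module:
  fixes R :: "('a, 'r) ring_scheme"
  assumes "ring R"
    and q: "\<forall>x\<in>carrier (free_rank R m). \<forall>y\<in>carrier (free_rank R m).
      q x = q y \<longleftrightarrow> x \<ominus>\<^bsub>free_rank R m\<^esub> y \<in> {\<zero>\<^bsub>free_rank R m\<^esub>}"
  shows "is_free_right_module R (image_module (free_rank R m) q)"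
proof -
  interpret ring R by fact
  let ?F = "free_rank R m" and ?Q = "image_module (free_rank R m) q"
  interpret F: right_module R ?F by (rule right_module_free_rank)
  have "submodule {\<zero>\<^bsub>?F\<^esub>} R ?F" by (simp add: F.submodule_iff)
  note Q = image_module[OF F.right_module_axioms this q]
  interpret q: right_module_hom R ?F ?Q q
    by (rule right_module_hom.intro[OF F.right_module_axioms Q(1)]) (unfold_locales, rule Q(2))
  have inj: "inj_on q (carrier ?F)"
  proof (rule inj_onI)
    fix x y assume xy: "x \<in> carrier ?F" "y \<in> carrier ?F" "q x = q y"
    then have "x \<ominus>\<^bsub>?F\<^esub> y = \<zero>\<^bsub>?F\<^esub>" using q by blast
    moreover have "(x \<ominus>\<^bsub>?F\<^esub> y) \<oplus>\<^bsub>?F\<^esub> y = x" using xy by (simp add: a_minus_def F.M.a_assoc F.M.l_neg)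
    ultimately show "x = y" using xy by simp
  qed
  define e where "e j = q (unit_vec R m j)" for j
  define B where "B = e ` {..<m}"
  have eQ: "e j \<in> carrier ?Q" for j by (simp add: e_def)
  have BQ: "B \<subseteq> carrier ?Q" using eQ by (auto simp: B_def)
  let ?FB = "free_right_module R B"
  let ?\<Phi> = "\<lambda>f. \<Oplus>\<^bsub>?Q\<^esub>b\<in>{b \<in> B. f b \<noteq> \<zero>\<^bsub>R\<^esub>}. f b \<odot>\<^bsub>?Q\<^esub> b"
  have FB: "carrier ?FB = (B \<rightarrow>\<^sub>E carrier R)" by (auto simp: free_right_module_def B_def)
  have "bij_betw ?\<Phi> (carrier ?FB) (carrier ?Q)"
  proof (cases "\<one>\<^bsub>R\<^esub> = \<zero>\<^bsub>R\<^esub>")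
    case True
    then have R0: "carrier R = {\<zero>\<^bsub>R\<^esub>}" by (simp add: carrier_one_zero)
    have 1: "carrier ?FB = {\<lambda>b\<in>B. \<zero>\<^bsub>R\<^esub>}" unfolding FB R0 by (auto simp: PiE_eq_singleton)
    have 2: "carrier ?Q = {\<zero>\<^bsub>?Q\<^esub>}"
    proof -
      have "carrier ?F = {\<zero>\<^bsub>?F\<^esub>}" unfolding free_rank_simps R0 by (auto simp: PiE_eq_singleton)
      then have "carrier ?Q = {q \<zero>\<^bsub>?F\<^esub>}" using Q(3) by (metis image_empty image_insert)
      then show ?thesis by simp
    qed
    have "{b \<in> B. (\<lambda>b\<in>B. \<zero>\<^bsub>R\<^esub>) b \<noteq> \<zero>\<^bsub>R\<^esub>} = {}" by auto
    then have "?\<Phi> (\<lambda>b\<in>B. \<zero>\<^bsub>R\<^esub>) = \<zero>\<^bsub>?Q\<^esub>" by (simp only: q.cod.M.finsum_empty)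
    then show ?thesis unfolding 1 2 bij_betw_def by simp
  next
    case False
    have einj: "inj_on e {..<m}"
      unfolding e_def using comp_inj_on[OF unit_vec_inj[OF False] inj_on_subset[OF inj]] by (auto simp: comp_def image_subset_iff)
    have \<Phi>: "?\<Phi> f = q (\<lambda>j\<in>{..<m}. f (e j))" if f: "f \<in> carrier ?FB" for f
    proof -
      have fR: "f (e j) \<in> carrier R" if "j < m" for j using f that unfolding FB by (auto simp: B_def)
      have fB: "f b \<odot>\<^bsub>?Q\<^esub> b \<in> carrier ?Q" "f b = \<zero>\<^bsub>R\<^esub> \<Longrightarrow> f b \<odot>\<^bsub>?Q\<^esub> b = \<zero>\<^bsub>?Q\<^esub>" if "b \<in> B" for b
        using that fR eQ by (auto simp: B_def)
      have "?\<Phi> f = (\<Oplus>\<^bsub>?Q\<^esub>b\<in>B. f b \<odot>\<^bsub>?Q\<^esub> b)"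
        by (rule q.cod.M.add.finprod_mono_neutral_cong_left) (use fB BQ in \<open>auto simp: B_def\<close>)
      also have "\<dots> = (\<Oplus>\<^bsub>?Q\<^esub>j\<in>{..<m}. f (e j) \<odot>\<^bsub>?Q\<^esub> e j)"
        unfolding B_def by (rule q.cod.M.finsum_reindex) (use einj fR eQ in auto)
      also have "\<dots> = (\<Oplus>\<^bsub>?Q\<^esub>j\<in>{..<m}. (\<lambda>j\<in>{..<m}. f (e j)) j \<odot>\<^bsub>?Q\<^esub> q (unit_vec R m j))"
        by (rule q.cod.M.finsum_cong') (use fR eQ in \<open>auto simp: e_def\<close>)
      also have "\<dots> = q (\<lambda>j\<in>{..<m}. f (e j))"
        by (rule hom_free_rank_expansion[OF Q(1,2), symmetric])
           (unfold free_rank_simps(1), intro PiE_I, simp_all add: fR)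
      finally show ?thesis .
    qed
    show ?thesis
    proof (rule bij_betw_imageI)
      show "inj_on ?\<Phi> (carrier ?FB)"
      proof (rule inj_onI)
        fix f f' assume f: "f \<in> carrier ?FB" and f': "f' \<in> carrier ?FB" and eq: "?\<Phi> f = ?\<Phi> f'"
        have "(\<lambda>j\<in>{..<m}. f (e j)) \<in> carrier ?F" "(\<lambda>j\<in>{..<m}. f' (e j)) \<in> carrier ?F"
          using f f' unfolding FB free_rank_simps by (auto simp: B_def)
        moreover have "q (\<lambda>j\<in>{..<m}. f (e j)) = q (\<lambda>j\<in>{..<m}. f' (e j))"
          using eq unfolding \<Phi>[OF f] \<Phi>[OF f'] .
        ultimately have same: "(\<lambda>j\<in>{..<m}. f (e j)) = (\<lambda>j\<in>{..<m}. f' (e j))" using inj by (auto dest: inj_onD)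
        have "f (e j) = f' (e j)" if "j < m" for j using fun_cong[OF same, of j] that by simp
        then show "f = f'" using f f' unfolding FB by (intro PiE_ext[of f B "\<lambda>_. carrier R" f']) (auto simp: B_def)
      qed
      show "?\<Phi> ` carrier ?FB = carrier ?Q"
      proof
        show "?\<Phi> ` carrier ?FB \<subseteq> carrier ?Q"
        proof (rule image_subsetI)
          fix f assume f: "f \<in> carrier ?FB"
          have "(\<lambda>j\<in>{..<m}. f (e j)) \<in> carrier ?F" using f unfolding FB free_rank_simps by (auto simp: B_def)
          then show "?\<Phi> f \<in> carrier ?Q" unfolding \<Phi>[OF f] by (rule q.hom_closed)
        qed
        show "carrier ?Q \<subseteq> ?\<Phi> ` carrier ?FB"
        proof
          fix u assume "u \<in> carrier ?Q"
          then obtain g where g: "g \<in> carrier ?F" "u = q g" using Q(3) by auto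
          define f where "f = (\<lambda>b\<in>B. g (the_inv_into {..<m} e b))"
          have fe: "f (e j) = g j" if "j < m" for j
            using that einj by (simp add: f_def B_def the_inv_into_f_f)
          have f: "f \<in> carrier ?FB"
            unfolding FB
          proof (rule PiE_I)
            fix b assume "b \<in> B"
            then obtain j where "j < m" "b = e j" by (auto simp: B_def)
            then show "f b \<in> carrier R" using fe g(1) by (auto simp: free_rank_simps)
          qed (simp add: f_def)
          have "(\<lambda>j\<in>{..<m}. f (e j)) = g"
            using g(1) fe unfolding free_rank_simps by (intro PiE_ext[of _ "{..<m}" "\<lambda>_. carrier R"]) auto
          then show "u \<in> ?\<Phi> ` carrier ?FB" using \<Phi>[OF f] f g(2) by (intro image_eqI[of _ _ f]) simp_all
        qed
      qed
    qed
  qed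
  then show ?thesis unfolding is_free_right_module_def using Q(1) BQ by blast
qed

text \<open>
  The image of \<open>r\<close> is a finitely generated submodule of a free module, of which there is a copy in
  \<open>'u\<close>.  By coherence it is finitely presented, and Schanuel's lemma applies to \<open>r\<close>.
\<close>

lemma coherent_kernel_fg:
  fixes R :: "('a, 'r) ring_scheme"
  assumes "ring R" "countable (carrier R)" "infinite (UNIV :: 'u set)" "right_coherent R TYPE('u)"
    and r: "r \<in> rmodule_hom R (free_rank R n) (free_rank R m)"
  shows "fg_submodule R (free_rank R n) (a_kernel (free_rank R n) (free_rank R m) r)"
proof -
  interpret ring R by fact
  let ?N = "free_rank R n" and ?M = "free_rank R m"
  interpret r: right_module_hom R ?N ?M r
    by (rule right_module_hom.intro[OF right_module_free_rank right_module_free_rank]) (unfold_locales, rule r)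
  have sub0: "submodule {\<zero>\<^bsub>?M\<^esub>} R ?M" by (simp add: r.cod.submodule_iff)
  obtain q :: "(nat \<Rightarrow> 'a) \<Rightarrow> 'u" where
    q: "\<forall>x\<in>carrier ?M. \<forall>y\<in>carrier ?M. q x = q y \<longleftrightarrow> x \<ominus>\<^bsub>?M\<^esub> y \<in> {\<zero>\<^bsub>?M\<^esub>}"
    using exists_quotient_map[OF right_module_free_rank sub0 countable_free_rank[OF assms(2)] assms(3)] .
  let ?Q = "image_module ?M q"
  note Q = image_module[OF right_module_free_rank sub0 q]
  interpret q: right_module_hom R ?M ?Q q
    by (rule right_module_hom.intro[OF right_module_free_rank Q(1)]) (unfold_locales, rule Q(2))
  let ?p = "\<lambda>x. q (r x)"
  have ph: "?p \<in> rmodule_hom R ?N ?Q"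
    by (auto simp: rmodule_hom_def hom_def r.hom_add q.hom_add r.hom_smult q.hom_smult)
  interpret p: right_module_hom R ?N ?Q ?p
    by (rule right_module_hom.intro[OF right_module_free_rank Q(1)]) (unfold_locales, rule ph)
  let ?I = "?p ` carrier ?N"
  have "fg_submodule R ?N (carrier ?N)"
  proof -
    have "(\<lambda>a. \<Oplus>\<^bsub>?N\<^esub>i\<in>{..<n}. a i \<odot>\<^bsub>?N\<^esub> unit_vec R n i) ` ({..<n} \<rightarrow>\<^sub>E carrier R) = carrier ?N"
      using unit_vec_expansion[of _ n] by (simp add: free_rank_simps(1))
    then show ?thesis using fg_submodule_lincombs[OF right_module_free_rank, of "{..<n}" "unit_vec R n" n] by simp
  qed
  then have fgI: "fg_submodule R ?Q ?I" by (rule p.fg_submodule_image)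
  then have I: "submodule ?I R ?Q" by (simp add: fg_submodule_def)
  let ?QI = "?Q\<lparr>carrier := ?I\<rparr>"
  have "finitely_presented_right_module R ?QI"
    using assms(4) free_image_module[OF assms(1) q] I finitely_generated_module_iff[OF Q(1) I] fgI
    unfolding right_coherent_def by blast
  moreover have "right_module R ?QI" by (rule q.cod.right_module_submodule[OF I])
  moreover have "?p \<in> rmodule_hom R ?N ?QI" using ph by (auto simp: rmodule_hom_def hom_def)
  ultimately have "fg_submodule R ?N (a_kernel ?N ?QI ?p)" by (intro kernel_fg_if_finitely_presented) auto
  moreover have "a_kernel ?N ?QI ?p = a_kernel ?N ?M r"
  proof -
    have "q x = \<zero>\<^bsub>?Q\<^esub> \<longleftrightarrow> x = \<zero>\<^bsub>?M\<^esub>" if "x \<in> carrier ?M" for x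
      using Q(4) that unfolding q.kernel_eq by blast
    then show ?thesis by (auto simp: a_kernel_def')
  qed
  ultimately show ?thesis by simp
qed

lemma coherent_equationally_flat:
  fixes R :: "('a, 'r) ring_scheme"
  assumes "ring R" "finitely_generated_ring R" "infinite (UNIV :: 'u set)"
    and resid: "\<forall>M :: ('a, 'u) module. finitely_presented_right_module R M \<longrightarrow> residually_finite_module R M"
    and coh: "right_coherent R TYPE('u)"
  shows "equationally_flat R (profinite_completion R)"
  unfolding equationally_flat_def
proof (intro allI impI)
  interpret ring R by fact
  let ?L = "profinite_completion R"
  fix m n :: nat and \<rho> :: "nat \<Rightarrow> nat \<Rightarrow> 'a" and y
  assume \<rho>: "\<forall>j<m. \<forall>i<n. \<rho> j i \<in> carrier R" and y: "\<forall>i<n. y i \<in> carrier ?L"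
    and eq: "\<forall>j<m. (\<Oplus>\<^bsub>?L\<^esub>i\<in>{..<n}. \<rho> j i \<odot>\<^bsub>?L\<^esub> y i) = \<zero>\<^bsub>?L\<^esub>"
  let ?N = "free_rank R n" and ?M = "free_rank R m"
  define col where "col i = (\<lambda>j\<in>{..<m}. \<rho> j i)" for i
  have col: "col i \<in> carrier ?M" if "i < n" for i using \<rho> that by (auto simp: col_def free_rank_simps)
  define r where "r f = (\<Oplus>\<^bsub>?M\<^esub>i\<in>{..<n}. f i \<odot>\<^bsub>?M\<^esub> col i)" for f
  have rh: "r \<in> rmodule_hom R ?N ?M"
    unfolding r_def by (rule lincomb_hom_free_rank[OF right_module_free_rank col])
  interpret M: right_module R ?M by (rule right_module_free_rank)
  have rj: "r f j = (\<Oplus>\<^bsub>R\<^esub>i\<in>{..<n}. \<rho> j i \<otimes>\<^bsub>R\<^esub> f i)" if f: "f \<in> carrier ?N" and j: "j < m" for f j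
  proof -
    have fR: "f i \<in> carrier R" if "i < n" for i using f that by (auto simp: free_rank_simps)
    have "r f = (\<lambda>j\<in>{..<m}. \<Oplus>\<^bsub>R\<^esub>i\<in>{..<n}. (f i \<odot>\<^bsub>?M\<^esub> col i) j)"
      unfolding r_def by (rule free_rank_finsum) (use fR col in auto)
    then have "r f j = (\<Oplus>\<^bsub>R\<^esub>i\<in>{..<n}. (f i \<odot>\<^bsub>?M\<^esub> col i) j)" using j by simp
    also have "\<dots> = (\<Oplus>\<^bsub>R\<^esub>i\<in>{..<n}. \<rho> j i \<otimes>\<^bsub>R\<^esub> f i)"
      by (rule finsum_cong') (use fR \<rho> j in \<open>auto simp: free_rank_simps col_def\<close>)
    finally show ?thesis .
  qed
  have "scalar_extension ?L {..<n} (a_kernel ?N ?M r) y"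
  proof (rule profinite_kernel[OF assms(1-3) resid rh coherent_kernel_fg[OF assms(1) countable_fg_ring[OF assms(2)] assms(3) coh rh]])
    show "i < n \<Longrightarrow> y i \<in> carrier ?L" for i using y by simp
    fix I a assume I: "I \<in> finite_index_ideals R" and a: "a \<in> carrier ?N" and ya: "\<And>i. i < n \<Longrightarrow> y i I = I +>\<^bsub>R\<^esub> a i"
    have aR: "a i \<in> carrier R" if "i < n" for i using a that by (auto simp: free_rank_simps)
    show "\<forall>j<m. r a j \<in> I"
    proof (intro allI impI)
      fix j assume j: "j < m"
      let ?s = "\<Oplus>\<^bsub>R\<^esub>i\<in>{..<n}. \<rho> j i \<otimes>\<^bsub>R\<^esub> a i"
      have sR: "?s \<in> carrier R" using \<rho> aR j by (intro finsum_closed) auto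
      have "(\<Oplus>\<^bsub>?L\<^esub>i\<in>{..<n}. \<rho> j i \<odot>\<^bsub>?L\<^esub> y i) I = I +>\<^bsub>R\<^esub> ?s"
        by (rule profinite_lincomb_rep[OF I]) (use \<rho> y aR ya j in auto)
      then have "I +>\<^bsub>R\<^esub> ?s = I +>\<^bsub>R\<^esub> \<zero>\<^bsub>R\<^esub>" using eq j profinite_zero_rep[OF I] by simp
      then have "?s \<ominus>\<^bsub>R\<^esub> \<zero>\<^bsub>R\<^esub> \<in> I" using coset_eq_iff[OF I sR zero_closed] by simp
      then show "r a j \<in> I" using rj[OF a j] sR by (simp add: a_minus_def)
    qed
  qed
  then show "scalar_extension ?L {..<n} {h. (\<forall>i<n. h i \<in> carrier R) \<and>
       (\<forall>j<m. (\<Oplus>\<^bsub>R\<^esub>i\<in>{..<n}. \<rho> j i \<otimes>\<^bsub>R\<^esub> h i) = \<zero>\<^bsub>R\<^esub>)} y"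
  proof (rule scalar_extension_mono, intro subsetI CollectI conjI allI impI)
    fix h assume "h \<in> a_kernel ?N ?M r"
    then have h: "h \<in> carrier ?N" "r h = \<zero>\<^bsub>?M\<^esub>" by (auto simp: a_kernel_def')
    show "h i \<in> carrier R" if "i < n" for i using h(1) that by (auto simp: free_rank_simps)
    show "(\<Oplus>\<^bsub>R\<^esub>i\<in>{..<n}. \<rho> j i \<otimes>\<^bsub>R\<^esub> h i) = \<zero>\<^bsub>R\<^esub>" if "j < m" for j
      using rj[OF h(1) that] h(2) that by (simp add: free_rank_simps)
  qed
qed

section \<open>Flatness implies coherence\<close>

text \<open>
  A Baire category argument.  Suppose that \<open>K\<close> is the union of an increasing sequence of finitely
  generated submodules \<open>S\<^sub>j \<noteq> K\<close>.  No \<open>S\<^sub>j\<close> contains a translate of a neighbourhood \<open>K \<inter> I\<^sup>n\<close> of \<open>0\<close>, since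
  \<open>K \<inter> I\<^sup>n\<close> has finite index in \<open>K\<close>.  So one can choose elements \<open>y\<^sub>j\<close> of \<open>K\<close> with ever smaller increments,
  each of them at a distance from the closed set \<open>S\<^sub>j\<close> that later increments do not affect.  The limit is in the
  closure of \<open>K\<close>, hence in \<open>K L\<close>, hence in \<open>S\<^sub>j L\<close> for some \<open>j\<close>; reducing its coefficients modulo a small
  ideal shows that \<open>y\<^sub>j\<close> is close to \<open>S\<^sub>j\<close>, which was excluded.
\<close>

lemma fg_if_closure_generated:
  fixes R :: "('a, 'r) ring_scheme"
  assumes "ring R" "finitely_generated_ring R" "infinite (UNIV :: 'u set)"
    and resid: "\<forall>M :: ('a, 'u) module. finitely_presented_right_module R M \<longrightarrow> residually_finite_module R M"
    and K: "submodule K R (free_rank R n)"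
    and closure: "\<And>y. \<lbrakk>\<And>i. i < n \<Longrightarrow> y i \<in> carrier (profinite_completion R);
        \<And>I. I \<in> finite_index_ideals R \<Longrightarrow> \<exists>k\<in>K. \<forall>i<n. y i I = I +>\<^bsub>R\<^esub> k i\<rbrakk>
        \<Longrightarrow> scalar_extension (profinite_completion R) {..<n} K y"
  shows "fg_submodule R (free_rank R n) K"
proof (rule ccontr)
  assume not_fg: "\<not> fg_submodule R (free_rank R n) K"
  interpret ring R by fact
  let ?N = "free_rank R n" and ?L = "profinite_completion R"
  interpret N: right_module R ?N by (rule right_module_free_rank)
  interpret L: left_module R ?L by (rule left_module_profinite)
  have Ks: "K \<subseteq> carrier ?N" "\<zero>\<^bsub>?N\<^esub> \<in> K" "\<And>x y. x \<in> K \<Longrightarrow> y \<in> K \<Longrightarrow> x \<oplus>\<^bsub>?N\<^esub> y \<in> K"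
    using K unfolding N.submodule_iff by auto
  have comp: "x i \<in> carrier R" if "x \<in> carrier ?N" "i < n" for x i using that by (auto simp: free_rank_simps)
  have ctbl: "countable (carrier R)" by (rule countable_fg_ring[OF assms(2)])
  have "countable K" using Ks(1) countable_free_rank[OF ctbl] by (rule countable_subset)
  moreover have "K \<noteq> {}" using Ks(2) by auto
  ultimately obtain k :: "nat \<Rightarrow> nat \<Rightarrow> 'a" where k: "range k = K"
    using uncountable_def by blast
  have kN: "k i \<in> carrier ?N" for i using k Ks(1) by auto
  \<comment> \<open>An exhaustion of \<open>K\<close> by finitely generated submodules.\<close>
  define S where "S j = (\<lambda>a. \<Oplus>\<^bsub>?N\<^esub>i\<in>{..<j}. a i \<odot>\<^bsub>?N\<^esub> k i) ` ({..<j} \<rightarrow>\<^sub>E carrier R)" for j :: nat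
  have Sfg: "fg_submodule R ?N (S j)" for j
    unfolding S_def by (rule fg_submodule_lincombs[OF right_module_free_rank]) (use kN in auto)
  have Ssub: "submodule (S j) R ?N" for j using Sfg by (simp add: fg_submodule_def)
  have kK: "k i \<in> K" for i using k by auto
  have SK: "S j \<subseteq> K" for j unfolding S_def using kK by (auto intro!: N.submodule_lincomb[OF K])
  have kS: "k i \<in> S j" if "i < j" for i j
    unfolding S_def by (rule N.generator_in_lincombs) (use that kN in auto)
  have Smono: "S i \<subseteq> S j" if "i \<le> j" for i j
    unfolding S_def[of i] using kS that by (auto intro!: N.submodule_lincomb[OF Ssub])
  obtain C :: "nat \<Rightarrow> 'a set" where C: "\<And>n. C n \<in> finite_index_ideals R" "\<And>m n. m \<le> n \<Longrightarrow> C n \<subseteq> C m"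
    "\<And>I. I \<in> finite_index_ideals R \<Longrightarrow> \<exists>n. C n \<subseteq> I"
    using finite_index_ideal_chain[OF assms(2)] by blast
  have closed: "\<exists>i. i \<ge> i0 \<and> (\<forall>z\<in>S j. \<not> (\<forall>l<n. x l \<ominus>\<^bsub>R\<^esub> z l \<in> C i))" if x: "x \<in> K" "x \<notin> S j" for x j i0
  proof -
    have "x \<in> carrier ?N" using x Ks(1) by auto
    then obtain I where I: "I \<in> finite_index_ideals R" "\<forall>z\<in>S j. \<not> (\<forall>l<n. x l \<ominus>\<^bsub>R\<^esub> z l \<in> I)"
      using fg_submodule_closed[OF assms(1) ctbl assms(3) resid Sfg _ x(2)] by blast
    obtain i where "C i \<subseteq> I" using C(3)[OF I(1)] by blast
    then have "C (max i0 i) \<subseteq> I" using C(2)[of i "max i0 i"] by auto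
    then have "\<forall>z\<in>S j. \<not> (\<forall>l<n. x l \<ominus>\<^bsub>R\<^esub> z l \<in> C (max i0 i))" using I(2) by blast
    then show ?thesis by (intro exI[of _ "max i0 i"] conjI) simp_all
  qed
  \<comment> \<open>Otherwise \<open>S j\<close> would contain \<open>K \<inter> I\<^sup>n\<close> for \<open>I = C i\<close>; this has finite index in \<open>K\<close>, and \<open>K\<close> would be
    finitely generated.\<close>
  have escape: "\<exists>z\<in>K. (\<forall>l<n. z l \<in> C i) \<and> y \<oplus>\<^bsub>?N\<^esub> z \<notin> S j" if y: "y \<in> K" for y i j
  proof (rule ccontr)
    assume no: "\<not> ?thesis"
    have yN: "y \<in> carrier ?N" using y Ks(1) by auto
    have "y \<oplus>\<^bsub>?N\<^esub> \<zero>\<^bsub>?N\<^esub> \<in> S j"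
      using no Ks(2) finite_index_idealD(3)[OF C(1)] by (auto simp: free_rank_simps(2))
    then have yS: "y \<in> S j" using yN by simp
    have small: "z \<in> S j" if z: "z \<in> K" "\<forall>l<n. z l \<in> C i" for z
    proof -
      have zN: "z \<in> carrier ?N" using z Ks(1) by auto
      have "y \<oplus>\<^bsub>?N\<^esub> z \<in> S j" using no z by blast
      then have "(y \<oplus>\<^bsub>?N\<^esub> z) \<ominus>\<^bsub>?N\<^esub> y \<in> S j" using yS by (rule N.submodule_diff[OF Ssub])
      moreover have "(y \<oplus>\<^bsub>?N\<^esub> z) \<ominus>\<^bsub>?N\<^esub> y = z"
        using yN zN by (simp add: a_minus_def N.M.a_assoc N.M.a_comm[of z "\<ominus>\<^bsub>?N\<^esub> y"] N.M.r_neg2)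
      ultimately show ?thesis by simp
    qed
    obtain h :: "'a \<Rightarrow> 'a set" where h: "finite (h ` carrier R)"
      "\<And>x y. x \<in> carrier R \<Longrightarrow> y \<in> carrier R \<Longrightarrow> h x = h y \<Longrightarrow> x \<ominus>\<^bsub>R\<^esub> y \<in> C i"
      using finite_index_separating_map finite_index_idealD(4,5)[OF C(1)] by blast
    \<comment> \<open>Two elements of \<open>K\<close> with the same \<open>\<kappa>\<close> differ by an element of \<open>K \<inter> I\<^sup>n\<close>, where \<open>I = C i\<close>.\<close>
    define \<kappa> where "\<kappa> x = (\<lambda>l\<in>{..<n}. h (x l))" for x
    have "\<kappa> ` K \<subseteq> {..<n} \<rightarrow>\<^sub>E h ` carrier R" using comp Ks(1) by (auto simp: \<kappa>_def)
    then have fin: "finite (\<kappa> ` K)" by (rule finite_subset) (simp add: h(1) finite_PiE)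
    define rep where "rep v = (SOME x. x \<in> K \<and> \<kappa> x = v)" for v
    have rep: "rep (\<kappa> x) \<in> K \<and> \<kappa> (rep (\<kappa> x)) = \<kappa> x" if "x \<in> K" for x
      unfolding rep_def by (rule someI[of _ x]) (use that in simp)
    have "fg_submodule R ?N K"
    proof (rule fg_submodule_sum[OF right_module_free_rank Sfg[of j] _ _ K SK])
      show "finite (rep ` \<kappa> ` K)" using fin by simp
      show "rep ` \<kappa> ` K \<subseteq> K" using rep by auto
      fix x assume x: "x \<in> K"
      let ?t = "rep (\<kappa> x)"
      have t: "?t \<in> K" "\<kappa> ?t = \<kappa> x" using rep[OF x] by auto
      have xt: "x \<in> carrier ?N" "?t \<in> carrier ?N" using x t Ks(1) by auto
      have "x \<ominus>\<^bsub>?N\<^esub> ?t \<in> K" by (rule N.submodule_diff[OF K x t(1)])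
      moreover have "(x \<ominus>\<^bsub>?N\<^esub> ?t) l \<in> C i" if l: "l < n" for l
      proof -
        have "h (x l) = h (?t l)" using fun_cong[OF t(2), of l] l by (simp add: \<kappa>_def)
        then have "x l \<ominus>\<^bsub>R\<^esub> ?t l \<in> C i" using h(2) comp[OF xt(1) l] comp[OF xt(2) l] by blast
        then show ?thesis using fun_cong[OF free_rank_diff[OF xt], of l] l by simp
      qed
      ultimately have "x \<ominus>\<^bsub>?N\<^esub> ?t \<in> S j" using small by blast
      then show "\<exists>t\<in>rep ` \<kappa> ` K. x \<ominus>\<^bsub>?N\<^esub> t \<in> S j" using x by blast
    qed
    then show False using not_fg by simp
  qed
  \<comment> \<open>A state is an element \<open>y\<close> of \<open>K\<close> with an index \<open>i\<close> such that \<open>y\<close> is not congruent modulo \<open>C i\<close> to any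
    element of \<open>S j\<close>; the condition \<open>j \<le> i\<close> keeps the chosen ideals cofinal.\<close>
  define ok where "ok j s \<longleftrightarrow> (case s of (y, i) \<Rightarrow> y \<in> K \<and> j \<le> i \<and> (\<forall>z\<in>S j. \<not> (\<forall>l<n. y l \<ominus>\<^bsub>R\<^esub> z l \<in> C i)))"
    for j :: nat and s :: "(nat \<Rightarrow> 'a) \<times> nat"
  define nxt where "nxt s s' \<longleftrightarrow> snd s \<le> snd s' \<and> (\<forall>l<n. fst s' l \<ominus>\<^bsub>R\<^esub> fst s l \<in> C (snd s))"
    for s s' :: "(nat \<Rightarrow> 'a) \<times> nat"
  have "\<exists>f. \<forall>j. ok j (f j) \<and> nxt (f j) (f (Suc j))"
  proof (rule dependent_nat_choice[where Q = "\<lambda>_. nxt"])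
    have "S 0 \<noteq> K" using Sfg[of 0] not_fg by auto
    then obtain x where x: "x \<in> K" "x \<notin> S 0" using SK[of 0] by auto
    then obtain i where "\<forall>z\<in>S 0. \<not> (\<forall>l<n. x l \<ominus>\<^bsub>R\<^esub> z l \<in> C i)" using closed[OF x] by blast
    then show "\<exists>s. ok 0 s" using x(1) by (intro exI[of _ "(x, i)"]) (simp add: ok_def)
  next
    fix s j assume "ok j s"
    then obtain y i where s: "s = (y, i)" and y: "y \<in> K" by (cases s) (auto simp: ok_def)
    obtain z where z: "z \<in> K" "\<forall>l<n. z l \<in> C i" "y \<oplus>\<^bsub>?N\<^esub> z \<notin> S (Suc j)" using escape[OF y] by blast
    let ?y = "y \<oplus>\<^bsub>?N\<^esub> z"
    have yK: "?y \<in> K" using Ks(3) y z by blast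
    obtain i' where i': "i' \<ge> max i (Suc j)" "\<forall>w\<in>S (Suc j). \<not> (\<forall>l<n. ?y l \<ominus>\<^bsub>R\<^esub> w l \<in> C i')"
      using closed[OF yK z(3), of "max i (Suc j)"] by blast
    have "?y l \<ominus>\<^bsub>R\<^esub> y l \<in> C i" if l: "l < n" for l
    proof -
      have R: "y l \<in> carrier R" "z l \<in> carrier R" using comp y z Ks(1) l by auto
      then have "?y l \<ominus>\<^bsub>R\<^esub> y l = z l"
        using l by (simp add: free_rank_simps(3) a_minus_def a_assoc a_comm[of "z l" "\<ominus>\<^bsub>R\<^esub> y l"] r_neg2)
      then show ?thesis using z(2) l by simp
    qed
    then show "\<exists>s'. ok (Suc j) s' \<and> nxt s s'"
      using yK i' s by (intro exI[of _ "(?y, i')"]) (simp add: ok_def nxt_def)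
  qed
  then obtain f where f: "\<And>j. ok j (f j)" "\<And>j. nxt (f j) (f (Suc j))" by blast
  define y where "y j = fst (f j)" for j
  define D where "D j = C (snd (f j))" for j
  have yK: "y j \<in> K" and far: "\<forall>z\<in>S j. \<not> (\<forall>l<n. y j l \<ominus>\<^bsub>R\<^esub> z l \<in> D j)" and jle: "j \<le> snd (f j)" for j
    using f(1)[of j] by (auto simp: ok_def y_def D_def split: prod.splits)
  have yR: "y j l \<in> carrier R" if "l < n" for j l using comp yK Ks(1) that by auto
  have DI: "D j \<in> finite_index_ideals R" for j by (simp add: D_def C(1))
  have smono: "snd (f i) \<le> snd (f j)" if "i \<le> j" for i j
    using lift_Suc_mono_le[of "\<lambda>j. snd (f j)" i j] f(2) that by (simp add: nxt_def)
  have Dmono: "D j \<subseteq> D i" if "i \<le> j" for i j unfolding D_def by (rule C(2)[OF smono[OF that]])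
  have Dcof: "\<exists>j. D j \<subseteq> I" if "I \<in> finite_index_ideals R" for I
  proof -
    note I = that
    obtain i where "C i \<subseteq> I" using C(3)[OF I] by blast
    then show ?thesis using C(2)[OF jle[of i]] unfolding D_def by blast
  qed
  have "\<exists>w. w \<in> carrier ?L \<and> (\<forall>j. w (D j) = D j +>\<^bsub>R\<^esub> y j l)" if l: "l < n" for l
  proof (rule profinite_limit[of D "\<lambda>j. y j l"])
    show "y (Suc j) l \<ominus>\<^bsub>R\<^esub> y j l \<in> D j" for j using f(2)[of j] l by (simp add: nxt_def y_def D_def)
    fix w assume "w \<in> carrier ?L" "\<And>j. w (D j) = D j +>\<^bsub>R\<^esub> y j l"
    then show ?thesis by blast
  qed (use DI Dmono Dcof yR[OF l] in auto)
  then obtain w where w: "\<And>l. l < n \<Longrightarrow> w l \<in> carrier ?L" "\<And>l j. l < n \<Longrightarrow> w l (D j) = D j +>\<^bsub>R\<^esub> y j l" by metis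
  have "scalar_extension ?L {..<n} K w"
  proof (rule closure[OF w(1)])
    fix I assume I: "I \<in> finite_index_ideals R"
    obtain j where j: "D j \<subseteq> I" using Dcof[OF I] by blast
    have "w l I = I +>\<^bsub>R\<^esub> y j l" if "l < n" for l
      by (rule profinite_mono[OF w(1)[OF that] DI I j yR[OF that] w(2)[OF that]])
    then show "\<exists>k\<in>K. \<forall>l<n. w l I = I +>\<^bsub>R\<^esub> k l" using yK by blast
  qed
  moreover have KR: "\<forall>g\<in>K. \<forall>l\<in>{..<n}. g l \<in> carrier R" using comp Ks(1) by auto
  ultimately obtain p :: nat and g c where g: "\<And>q. q < p \<Longrightarrow> g q \<in> K" and c: "\<And>q. q < p \<Longrightarrow> c q \<in> carrier ?L"
    and wsum: "\<And>l. l < n \<Longrightarrow> w l = (\<Oplus>\<^bsub>?L\<^esub>q\<in>{..<p}. g q l \<odot>\<^bsub>?L\<^esub> c q)"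
    using L.scalar_extensionE[of "{..<n}" K w] by blast
  \<comment> \<open>The finitely many \<open>g q\<close> occur at a finite stage, which \<open>w\<close> was built to avoid.\<close>
  have "\<exists>j. \<forall>q<p'. g q \<in> S j" if "p' \<le> p" for p'
    using that
  proof (induction p')
    case (Suc p')
    then obtain j where j: "\<forall>q<p'. g q \<in> S j" by auto
    obtain i where i: "g p' = k i" using g[of p'] Suc.prems k by auto
    have "g p' \<in> S (Suc i)" using kS[of i "Suc i"] i by simp
    then have "g q \<in> S (max j (Suc i))" if "q < Suc p'" for q
      using j that Smono[of j "max j (Suc i)"] Smono[of "Suc i" "max j (Suc i)"] by (cases "q = p'") auto
    then show ?case by blast
  qed simp
  then obtain j where gS: "\<And>q. q < p \<Longrightarrow> g q \<in> S j" by blast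
  have "\<exists>d. d \<in> carrier R \<and> c q (D j) = D j +>\<^bsub>R\<^esub> d" if "q < p" for q
    using profinite_rep[OF c[OF that] DI] by metis
  then obtain d where d: "\<And>q. q < p \<Longrightarrow> d q \<in> carrier R" "\<And>q. q < p \<Longrightarrow> c q (D j) = D j +>\<^bsub>R\<^esub> d q" by metis
  have gN: "g q \<in> carrier ?N" if "q < p" for q using g[OF that] Ks(1) by auto
  let ?z = "\<Oplus>\<^bsub>?N\<^esub>q\<in>{..<p}. d q \<odot>\<^bsub>?N\<^esub> g q"
  have "?z \<in> S j" by (rule N.submodule_lincomb[OF Ssub]) (use d gS in auto)
  moreover have "y j l \<ominus>\<^bsub>R\<^esub> ?z l \<in> D j" if l: "l < n" for l
  proof -
    have "?z = (\<lambda>l\<in>{..<n}. \<Oplus>\<^bsub>R\<^esub>q\<in>{..<p}. (d q \<odot>\<^bsub>?N\<^esub> g q) l)"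
      by (rule free_rank_finsum) (use d gN in auto)
    then have "?z l = (\<Oplus>\<^bsub>R\<^esub>q\<in>{..<p}. (d q \<odot>\<^bsub>?N\<^esub> g q) l)" using l by simp
    also have "\<dots> = (\<Oplus>\<^bsub>R\<^esub>q\<in>{..<p}. g q l \<otimes>\<^bsub>R\<^esub> d q)"
      by (rule finsum_cong') (use d gN comp l in \<open>auto simp: free_rank_simps\<close>)
    finally have zl: "?z l = (\<Oplus>\<^bsub>R\<^esub>q\<in>{..<p}. g q l \<otimes>\<^bsub>R\<^esub> d q)" .
    have "w l (D j) = D j +>\<^bsub>R\<^esub> ?z l"
      unfolding zl wsum[OF l] by (rule profinite_lincomb_rep[OF DI]) (use d c gN comp l in auto)
    moreover have "?z l \<in> carrier R" unfolding zl using gN comp d l by (intro finsum_closed) auto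
    ultimately show ?thesis using w(2)[OF l, of j] coset_eq_iff[OF DI yR[OF l]] by simp
  qed
  ultimately show False using far[of j] by blast
qed

text \<open>
  Finitely many elements of a free module involve a finite part \<open>X\<close> of a basis; the last conclusion is
  the linear independence of \<open>X\<close>.
\<close>

lemma free_basis_coordinates:
  fixes F :: "('a, 'u) module"
  assumes "is_free_right_module R F" "\<And>i. i < (n::nat) \<Longrightarrow> s i \<in> carrier F"
  obtains X a where "finite X" "X \<subseteq> carrier F"
    "\<And>i x. i < n \<Longrightarrow> x \<in> carrier F \<Longrightarrow> a i x \<in> carrier R"
    "\<And>i x. i < n \<Longrightarrow> x \<in> carrier F \<Longrightarrow> x \<notin> X \<Longrightarrow> a i x = \<zero>\<^bsub>R\<^esub>"
    "\<And>i. i < n \<Longrightarrow> (\<Oplus>\<^bsub>F\<^esub>x\<in>X. a i x \<odot>\<^bsub>F\<^esub> x) = s i"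
    "\<forall>b. (\<forall>x\<in>X. b x \<in> carrier R) \<longrightarrow> (\<Oplus>\<^bsub>F\<^esub>x\<in>X. b x \<odot>\<^bsub>F\<^esub> x) = \<zero>\<^bsub>F\<^esub> \<longrightarrow> (\<forall>x\<in>X. b x = \<zero>\<^bsub>R\<^esub>)"
proof -
  interpret F: right_module R F using assms(1) by (simp add: is_free_right_module_def)
  obtain B where B: "B \<subseteq> carrier F"
    and bij: "bij_betw (\<lambda>f. \<Oplus>\<^bsub>F\<^esub>b\<in>{b \<in> B. f b \<noteq> \<zero>\<^bsub>R\<^esub>}. f b \<odot>\<^bsub>F\<^esub> b) (carrier (free_right_module R B)) (carrier F)"
    using assms(1) unfolding is_free_right_module_def by blast
  let ?\<Phi> = "\<lambda>f. \<Oplus>\<^bsub>F\<^esub>b\<in>{b \<in> B. f b \<noteq> \<zero>\<^bsub>R\<^esub>}. f b \<odot>\<^bsub>F\<^esub> b"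
  have FB: "f \<in> carrier (free_right_module R B) \<longleftrightarrow> f \<in> B \<rightarrow>\<^sub>E carrier R \<and> finite {b \<in> B. f b \<noteq> \<zero>\<^bsub>R\<^esub>}" for f
    by (simp add: free_right_module_def)
  have "\<exists>f. f \<in> carrier (free_right_module R B) \<and> ?\<Phi> f = s i" if "i < n" for i
  proof -
    have "s i \<in> ?\<Phi> ` carrier (free_right_module R B)" using bij assms(2)[OF that] by (simp add: bij_betw_def)
    then show ?thesis by auto
  qed
  note ex = this
  define f where "f i = (SOME f. f \<in> carrier (free_right_module R B) \<and> ?\<Phi> f = s i)" for i
  have f: "f i \<in> carrier (free_right_module R B) \<and> ?\<Phi> (f i) = s i" if "i < n" for i
    unfolding f_def by (rule someI_ex[OF ex[OF that]])
  define X where "X = (\<Union>i<n. {b \<in> B. f i b \<noteq> \<zero>\<^bsub>R\<^esub>})"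
  define a where "a i x = (if x \<in> B then f i x else \<zero>\<^bsub>R\<^esub>)" for i x
  have XB: "X \<subseteq> B" and finX: "finite X" using f by (auto simp: X_def FB)
  have fR: "f i x \<in> carrier R" if "i < n" "x \<in> B" for i x using f[OF that(1)] that(2) by (auto simp: FB)
  have sum_X: "?\<Phi> g = (\<Oplus>\<^bsub>F\<^esub>x\<in>X. g x \<odot>\<^bsub>F\<^esub> x)"
    if "\<And>x. x \<in> B \<Longrightarrow> g x \<in> carrier R" "\<And>x. x \<in> B \<Longrightarrow> x \<notin> X \<Longrightarrow> g x = \<zero>\<^bsub>R\<^esub>" for g
    by (rule F.M.add.finprod_mono_neutral_cong_left) (use that finX XB B in \<open>auto simp: subset_iff\<close>)
  show ?thesis
  proof (rule that[of X a])
    show "finite X" by (rule finX)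
    show "X \<subseteq> carrier F" using XB B by auto
    show "a i x \<in> carrier R" if "i < n" "x \<in> carrier F" for i x using fR that by (simp add: a_def)
    show "a i x = \<zero>\<^bsub>R\<^esub>" if "i < n" "x \<in> carrier F" "x \<notin> X" for i x using that by (auto simp: a_def X_def)
    show "(\<Oplus>\<^bsub>F\<^esub>x\<in>X. a i x \<odot>\<^bsub>F\<^esub> x) = s i" if i: "i < n" for i
    proof -
      have "(\<Oplus>\<^bsub>F\<^esub>x\<in>X. a i x \<odot>\<^bsub>F\<^esub> x) = (\<Oplus>\<^bsub>F\<^esub>x\<in>X. f i x \<odot>\<^bsub>F\<^esub> x)"
        by (rule F.M.finsum_cong') (use XB B fR i in \<open>auto simp: a_def subset_iff\<close>)
      also have "\<dots> = ?\<Phi> (f i)" by (rule sum_X[symmetric]) (use fR i in \<open>auto simp: X_def\<close>)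
      finally show ?thesis using f[OF i] by simp
    qed
    show "\<forall>b. (\<forall>x\<in>X. b x \<in> carrier R) \<longrightarrow> (\<Oplus>\<^bsub>F\<^esub>x\<in>X. b x \<odot>\<^bsub>F\<^esub> x) = \<zero>\<^bsub>F\<^esub> \<longrightarrow> (\<forall>x\<in>X. b x = \<zero>\<^bsub>R\<^esub>)"
    proof (intro allI impI ballI)
      fix b x assume b: "\<forall>x\<in>X. b x \<in> carrier R" and sum: "(\<Oplus>\<^bsub>F\<^esub>x\<in>X. b x \<odot>\<^bsub>F\<^esub> x) = \<zero>\<^bsub>F\<^esub>" and x: "x \<in> X"
      define b' where "b' = (\<lambda>x\<in>B. if x \<in> X then b x else \<zero>\<^bsub>R\<^esub>)"
      have b': "b' \<in> carrier (free_right_module R B)"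
        unfolding FB
      proof
        show "b' \<in> B \<rightarrow>\<^sub>E carrier R" using b by (auto simp: b'_def)
        show "finite {x \<in> B. b' x \<noteq> \<zero>\<^bsub>R\<^esub>}" by (rule finite_subset[OF _ finX]) (auto simp: b'_def)
      qed
      have "?\<Phi> b' = (\<Oplus>\<^bsub>F\<^esub>x\<in>X. b' x \<odot>\<^bsub>F\<^esub> x)"
        by (rule sum_X) (use b in \<open>auto simp: b'_def\<close>)
      also have "\<dots> = (\<Oplus>\<^bsub>F\<^esub>x\<in>X. b x \<odot>\<^bsub>F\<^esub> x)"
        by (rule F.M.finsum_cong') (use b XB B in \<open>auto simp: b'_def subset_iff\<close>)
      finally have "?\<Phi> b' = \<zero>\<^bsub>F\<^esub>" using sum by simp
      moreover have "?\<Phi> (\<lambda>x\<in>B. \<zero>\<^bsub>R\<^esub>) = \<zero>\<^bsub>F\<^esub>"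
      proof -
        have "{x \<in> B. (\<lambda>x\<in>B. \<zero>\<^bsub>R\<^esub>) x \<noteq> \<zero>\<^bsub>R\<^esub>} = {}" by auto
        then show ?thesis by (simp only: F.M.finsum_empty)
      qed
      ultimately have eq: "?\<Phi> b' = ?\<Phi> (\<lambda>x\<in>B. \<zero>\<^bsub>R\<^esub>)" by simp
      have z: "(\<lambda>x\<in>B. \<zero>\<^bsub>R\<^esub>) \<in> carrier (free_right_module R B)" by (auto simp: FB)
      have "b' = (\<lambda>x\<in>B. \<zero>\<^bsub>R\<^esub>)" by (rule inj_onD[OF bij_betw_imp_inj_on[OF bij] eq b' z])
      from fun_cong[OF this, of x] show "b x = \<zero>\<^bsub>R\<^esub>" using x XB by (auto simp: b'_def)
    qed
  qed
qed

text \<open>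
  Coordinates with respect to a basis are continuous: a limit of elements of the kernel of \<open>R\<^sup>n \<rightarrow> N\<close> is
  annihilated by the coordinate matrix of the generators of \<open>N\<close>.  This is the hypothesis of
  \<open>flat_generators\<close>, whose conclusion is the hypothesis of \<open>fg_if_closure_generated\<close>.
\<close>

lemma flat_coherent:
  fixes R :: "('a, 'r) ring_scheme"
  assumes "ring R" "finitely_generated_ring R" "infinite (UNIV :: 'u set)"
    and resid: "\<forall>M :: ('a, 'u) module. finitely_presented_right_module R M \<longrightarrow> residually_finite_module R M"
    and flat: "flat_left_module R (profinite_completion R) TYPE('u)"
  shows "right_coherent R TYPE('u)"
  unfolding right_coherent_def
proof (intro allI impI)
  fix F :: "('a, 'u) module" and N
  assume *: "is_free_right_module R F \<and> submodule N R F \<and> finitely_generated_module R (F\<lparr>carrier := N\<rparr>)"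
  then have free: "is_free_right_module R F" and N: "submodule N R F" by auto
  interpret F: right_module R F using free by (simp add: is_free_right_module_def)
  let ?L = "profinite_completion R" and ?FN = "F\<lparr>carrier := N\<rparr>"
  interpret L: left_module R ?L by (rule F.R.left_module_profinite)
  have fgN: "fg_submodule R F N" using * finitely_generated_module_iff[OF F.right_module_axioms N] by simp
  obtain n :: nat and s where inj: "inj_on s {..<n}" and s: "\<And>i. i < n \<Longrightarrow> s i \<in> N"
    and gen: "N = (\<lambda>a. \<Oplus>\<^bsub>F\<^esub>i\<in>{..<n}. a i \<odot>\<^bsub>F\<^esub> s i) ` ({..<n} \<rightarrow>\<^sub>E carrier R)"
    by (rule fg_submodule_obtain_generators[OF F.right_module_axioms fgN]) (rule that)
  have sF: "s i \<in> carrier F" if "i < n" for i using s[OF that] N by (auto simp: F.submodule_iff)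
  let ?R = "free_rank R n"
  define p where "p f = (\<Oplus>\<^bsub>F\<^esub>i\<in>{..<n}. f i \<odot>\<^bsub>F\<^esub> s i)" for f
  have ph: "p \<in> rmodule_hom R ?R F"
    unfolding p_def by (rule F.R.lincomb_hom_free_rank[OF F.right_module_axioms sF])
  interpret p: right_module_hom R ?R F p
    by (rule right_module_hom.intro[OF F.R.right_module_free_rank F.right_module_axioms]) (unfold_locales, rule ph)
  have im: "p ` carrier ?R = N" unfolding gen p_def free_rank_simps(1) ..
  let ?K = "{k \<in> {..<n} \<rightarrow>\<^sub>E carrier R. (\<Oplus>\<^bsub>F\<^esub>i\<in>{..<n}. k i \<odot>\<^bsub>F\<^esub> s i) = \<zero>\<^bsub>F\<^esub>}"
  have K: "a_kernel ?R F p = ?K" by (simp add: a_kernel_def' p_def free_rank_simps)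
  obtain X a where X: "finite X" "X \<subseteq> carrier F" and a: "\<And>i x. i < n \<Longrightarrow> x \<in> carrier F \<Longrightarrow> a i x \<in> carrier R"
    and a0: "\<And>i x. i < n \<Longrightarrow> x \<in> carrier F \<Longrightarrow> x \<notin> X \<Longrightarrow> a i x = \<zero>\<^bsub>R\<^esub>"
    and expand: "\<And>i. i < n \<Longrightarrow> (\<Oplus>\<^bsub>F\<^esub>x\<in>X. a i x \<odot>\<^bsub>F\<^esub> x) = s i"
    and indep: "\<forall>b. (\<forall>x\<in>X. b x \<in> carrier R) \<longrightarrow> (\<Oplus>\<^bsub>F\<^esub>x\<in>X. b x \<odot>\<^bsub>F\<^esub> x) = \<zero>\<^bsub>F\<^esub> \<longrightarrow> (\<forall>x\<in>X. b x = \<zero>\<^bsub>R\<^esub>)"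
    by (rule free_basis_coordinates[OF free, of n s]) (erule sF, rule that)
  have XF: "x \<in> carrier F" if "x \<in> X" for x using X(2) that by auto
  have coord: "(\<Oplus>\<^bsub>R\<^esub>i\<in>{..<n}. a i x \<otimes>\<^bsub>R\<^esub> k i) = \<zero>\<^bsub>R\<^esub>" if k: "k \<in> ?K" and x: "x \<in> X" for k x
  proof -
    have kR: "k i \<in> carrier R" if "i < n" for i using k that by auto
    have coef: "(\<Oplus>\<^bsub>R\<^esub>i\<in>{..<n}. a i x \<otimes>\<^bsub>R\<^esub> k i) \<in> carrier R" if "x \<in> X" for x
      using a XF[OF that] kR by (intro F.R.finsum_closed) auto
    have "(\<Oplus>\<^bsub>F\<^esub>x\<in>X. (\<Oplus>\<^bsub>R\<^esub>i\<in>{..<n}. a i x \<otimes>\<^bsub>R\<^esub> k i) \<odot>\<^bsub>F\<^esub> x) = (\<Oplus>\<^bsub>F\<^esub>i\<in>{..<n}. k i \<odot>\<^bsub>F\<^esub> (\<Oplus>\<^bsub>F\<^esub>x\<in>X. a i x \<odot>\<^bsub>F\<^esub> x))"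
      by (rule F.lincomb_lincomb) (use X a kR in auto)
    also have "\<dots> = (\<Oplus>\<^bsub>F\<^esub>i\<in>{..<n}. k i \<odot>\<^bsub>F\<^esub> s i)"
      by (rule F.M.finsum_cong') (use expand kR sF in auto)
    finally have "(\<Oplus>\<^bsub>F\<^esub>x\<in>X. (\<Oplus>\<^bsub>R\<^esub>i\<in>{..<n}. a i x \<otimes>\<^bsub>R\<^esub> k i) \<odot>\<^bsub>F\<^esub> x) = \<zero>\<^bsub>F\<^esub>" using k by simp
    then show ?thesis using coef indep[THEN spec, of "\<lambda>x. \<Oplus>\<^bsub>R\<^esub>i\<in>{..<n}. a i x \<otimes>\<^bsub>R\<^esub> k i"] x by blast
  qed
  have "fg_submodule R ?R ?K"
  proof (rule fg_if_closure_generated[OF assms(1-3) resid])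
    show "submodule ?K R ?R" using p.submodule_kernel unfolding K .
    fix y assume y: "\<And>i. i < n \<Longrightarrow> y i \<in> carrier ?L"
      and near: "\<And>I. I \<in> finite_index_ideals R \<Longrightarrow> \<exists>k\<in>?K. \<forall>i<n. y i I = I +>\<^bsub>R\<^esub> k i"
    show "scalar_extension ?L {..<n} ?K y"
    proof (rule flat_generators[OF flat F.right_module_axioms N inj s gen y a X a0 expand])
      fix x assume x: "x \<in> X"
      show "(\<Oplus>\<^bsub>?L\<^esub>i\<in>{..<n}. a i x \<odot>\<^bsub>?L\<^esub> y i) = \<zero>\<^bsub>?L\<^esub>"
      proof (rule F.R.profinite_eqI)
        fix I assume I: "I \<in> finite_index_ideals R"
        obtain k where k: "k \<in> ?K" "\<forall>i<n. y i I = I +>\<^bsub>R\<^esub> k i" using near[OF I] by blast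
        have "(\<Oplus>\<^bsub>?L\<^esub>i\<in>{..<n}. a i x \<odot>\<^bsub>?L\<^esub> y i) I = I +>\<^bsub>R\<^esub> (\<Oplus>\<^bsub>R\<^esub>i\<in>{..<n}. a i x \<otimes>\<^bsub>R\<^esub> k i)"
          by (rule F.R.profinite_lincomb_rep[OF I]) (use a XF[OF x] y k in auto)
        then show "(\<Oplus>\<^bsub>?L\<^esub>i\<in>{..<n}. a i x \<odot>\<^bsub>?L\<^esub> y i) I = (\<zero>\<^bsub>?L\<^esub>) I"
          using coord[OF k(1) x] F.R.profinite_zero_rep[OF I] by simp
      qed (use a XF[OF x] y in \<open>auto intro!: L.finsum_closed L.action.smult_closed\<close>)
    qed
  qed
  moreover have "right_module R ?FN" by (rule F.right_module_submodule[OF N])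
  moreover have "p \<in> rmodule_hom R ?R ?FN" using ph im by (auto simp: rmodule_hom_def hom_def)
  moreover have "a_kernel ?R ?FN p = ?K" using K by (simp add: a_kernel_def')
  ultimately show "finitely_presented_right_module R ?FN"
    using im by (subst finitely_presented_iff) (auto intro!: exI[of _ n] exI[of _ p])
qed

section \<open>The equivalence\<close>

theorem theorem4p1:
  fixes R :: "('a, 'r) ring_scheme"
  assumes "ring R"
    and "finitely_generated_ring R"
    and "residually_finite_ring R"
    and "infinite (UNIV :: 'u set)"
    and "\<forall>M :: ('a, 'u) module.
           finitely_presented_right_module R M \<longrightarrow> residually_finite_module R M"
  shows "flat_left_module R (profinite_completion R) TYPE('u) \<longleftrightarrow> right_coherent R TYPE('u)"
proof
  assume "flat_left_module R (profinite_completion R) TYPE('u)"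
  then show "right_coherent R TYPE('u)" by (rule flat_coherent[OF assms(1,2,4,5)])
next
  assume "right_coherent R TYPE('u)"
  then have "equationally_flat R (profinite_completion R)"
    by (rule coherent_equationally_flat[OF assms(1,2,4,5)])
  then show "flat_left_module R (profinite_completion R) TYPE('u)"
    by (rule flat_if_equationally_flat[OF ring.left_module_profinite[OF assms(1)]])
qed

end
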